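(* Let $(X_t)_{t\ge0}$ be a Markov process in $\mathbb R^d$ whose pointwise generator $(\mathcal A,\mathscr D(\mathcal A))$ is a Lévy-type operator with characteristic triplet $(a,b,\Pi)$, and let $\pi=(\nu,\mu,\rho)$ be a convenient decomposition of the Lévy kernel $\Pi$. Assume $\mathcal C_c^\infty(\mathbb R^d)\subset\mathscr D(\mathcal A)$ and let $\eta\in\mathcal M(\mathcal A,\pi)$. If $\eta$ is invariant for $(X_t)_{t\ge0}$, and for every $f\in\mathcal C_c^\infty(\mathbb R^d)$ there exist $g\in L^1(\eta)$ and $T>0$ such that $\left|\frac{P_tf(x)-f(x)}{t}\right|\le g(x)$ for all $x\in\mathbb R^d$ and $0<t\le T$, then $\eta$ solves the distributional equation $$-\nabla\cdot((a+a_\pi)\eta)+\tfrac12\nabla\cdot b\nabla\eta+U^\pi(\eta)+\nabla\cdot V^\pi(\eta)+\mathbf H\cdot W^\pi(\eta)=0.$$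
   Context: **Markov processes.** $(X_t)_{t\ge0}$ is time-homogeneous, $P_tf(x)=\mathbb E^x[f(X_t)]$ for $f\in\mathcal C_\infty(\mathbb R^d)$ (continuous functions vanishing at infinity). The pointwise generator is $\mathcal Af(x)=\lim_{t\downarrow0}t^{-1}(P_tf(x)-f(x))$ with domain $\mathscr D(\mathcal A)$ the set of $f\in\mathcal C_\infty(\mathbb R^d)$ for which this limit exists for all $x\in\mathbb R^d$. A (positive) measure $\eta$ is invariant if $\int\mathbb P^x(X_t\in B)\eta(dx)=\eta(B)$ for all $t\ge0$ and Borel $B$. **Lévy-type operators.** Let $\mathcal E$ be a Banach space of functions $f:\mathbb R^d\to\mathbb R$. A Lévy-type operator is a pair $(\mathcal A,\mathscr D(\mathcal A))$ with $\mathscr D(\mathcal A)\subset\mathcal E$ and $\mathcal A:\mathscr D(\mathcal A)\to\mathcal E$ of the form $$\mathcal Af(x)=a(x)\cdot\nabla f(x)+\tfrac12\nabla\cdot b(x)\nabla f(x)+\int_{\mathbb R^d}\big(f(x+y)-f(x)-\nabla f(x)\cdot y\mathbf 1_{\{|y|<1\}}\big)\Pi(x,dy),$$ where $\nabla\cdot b\nabla f=\sum_{i,j}\partial_i(b_{ij}\partial_jf)$, $a:\mathbb R^d\to\mathbb R^d$ is Borel, $b$ is Borel with values in the symmetric positive semidefinite $d\times d$ matrices, and $\Pi$ is a Lévy kernel: $\Pi(x,\cdot)$ is a Lévy measure on $\mathbb R^d$ for each $x$, $\Pi(\cdot,B)$ is Borel for each Borel $B$, $\Pi(x,\{0\})=0$.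 $(a,b,\Pi)$ is the characteristic triplet. **Convenient decomposition.** $\pi=(\nu,\mu,\rho)$ is a convenient decomposition of $\Pi$ if there are non-negative continuous functions $h_\nu,h_\mu,h_\rho$ on $\mathbb R^d$ with $\nu=h_\nu\Pi$, $\mu=h_\mu\Pi$, $\rho=h_\rho\Pi$ (i.e. $\nu(x,dy)=h_\nu(y)\Pi(x,dy)$ etc.), $\Pi=\nu+\mu+\rho$, and for all $x$: $\nu(x,\mathbb R^d)<\infty$, $\int(1\wedge|y|)\mu(x,dy)<\infty$, $\int(|y|\wedge|y|^2)\rho(x,dy)<\infty$. Put $a_\pi(x)=-\int_{|y|<1}y\,\nu(x,dy)-\int_{|y|<1}y\,\mu(x,dy)+\int_{|y|\ge1}y\,\rho(x,dy)$. **Integrated tails.** A polar decomposition of a $\sigma$-finite measure $Q$ on $\mathbb R^d$ with $Q(\{0\})=0$ is a finite measure $Q_o$ on the unit sphere $S^{d-1}$ and a measurable family $(Q_\xi)_{\xi\in S^{d-1}}$ of $\sigma$-finite measures on $(0,\infty)$ with $Q_\xi((0,\infty))>0$ and $Q(B)=\int_{S^{d-1}}\int_{(0,\infty)}\mathbf 1_B(r\xi)Q_\xi(dr)Q_o(d\xi)$. For a Lévy kernel $Q$ choose for each $x$ a polar decomposition of $Q(x,\cdot)$ whose radial parts are Lévy measures. The integrated radial tail is $\overline Q(x,B)=\int_{S^{d-1}}\int_{(0,\infty)}\mathbf 1_B(z\xi)\int_{(z,\infty)}Q_\xi(x,dr)\,dz\,Q_o(x,d\xi)$, and, if $\int(|y|\wedge|y|^2)Q(x,dy)<\infty$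 for all $x$ (radial parts chosen with $\int(r\wedge r^2)Q_\xi(x,dr)<\infty$), the double-integrated radial tail is $\overline{\overline Q}(x,B)=\int_{S^{d-1}}\int_{(0,\infty)}\mathbf 1_B(z_2\xi)\int_{(z_2,\infty)}\int_{(z_1,\infty)}Q_\xi(x,dr)\,dz_1\,dz_2\,Q_o(x,d\xi)$. Both are independent of the choice. **Jump functionals.** For test functions $f$: $\langle U^\pi(\eta),f\rangle=\int\big(\int f(x+y)\nu(x,dy)-f(x)\nu(x,\mathbb R^d)\big)\eta(dx)$, $\langle V^\pi_i(\eta),f\rangle=\int\int f(x+y)\frac{y_i}{|y|}\overline\mu(x,dy)\eta(dx)$, $\langle W^\pi_{ij}(\eta),f\rangle=\int\int f(x+y)\frac{y_iy_j}{|y|^2}\overline{\overline\rho}(x,dy)\eta(dx)$. **The space $\mathcal M(\mathcal A,\pi)$.** It is the set of measures $\eta$ on $\mathbb R^d$ such that $\nabla\cdot((a+a_\pi)\eta)$, $\frac12\nabla\cdot b\nabla\eta$, $U^\pi(\eta)$, $\nabla\cdot V^\pi(\eta)$, $\mathbf H\cdot W^\pi(\eta)$ define distributions. Here $\nabla\cdot F=\sum_i\partial_iF_i$ and $\mathbf H\cdot M=\sum_{i,j}\partial_i\partial_jM_{ij}$, with derivatives understood in the distributional sense; $\frac12\nabla\cdot b\nabla\eta$ is the functional $f\mapsto\int\frac12\nabla\cdot b\nabla f\,d\eta$.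
   Formalization: The term +∇·V^π(η) is corrected to −∇·V^π(η), since with distributional derivatives the printed sign is false; measures in M(A,π) are taken to be Radon (finite on compact sets), without which the claim fails, e.g. for η=dx/|x| under the flow X_t=e^{-t}x. *)

theory Defs
  imports "HOL-Probability.Probability"
begin

section \<open>Differentiation, test functions, distributions\<close>

text \<open>Partial derivatives are taken along the coordinate line only, since they are also applied to
  products \<open>b\<^sub>i\<^sub>j \<partial>\<^sub>j f\<close> for which no more regularity is available.\<close>

definition has_pd :: "'n::finite \<Rightarrow> (real^'n \<Rightarrow> real) \<Rightarrow> real^'n \<Rightarrow> bool" where
  "has_pd i f x \<longleftrightarrow> (\<lambda>t::real. f (x + t *\<^sub>R axis i 1)) differentiable (at 0)"

definition pd :: "'n::finite \<Rightarrow> (real^'n \<Rightarrow> real) \<Rightarrow> real^'n \<Rightarrow> real" where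
  "pd i f x = deriv (\<lambda>t::real. f (x + t *\<^sub>R axis i 1)) 0"

definition grad :: "(real^'n::finite \<Rightarrow> real) \<Rightarrow> real^'n \<Rightarrow> real^'n" where
  "grad f x = (\<chi> i. pd i f x)"

primrec iter_pd :: "'n::finite list \<Rightarrow> (real^'n \<Rightarrow> real) \<Rightarrow> real^'n \<Rightarrow> real" where
  "iter_pd [] f = f"
| "iter_pd (i # is) f = pd i (iter_pd is f)"

definition C_k :: "nat \<Rightarrow> (real^'n::finite \<Rightarrow> real) \<Rightarrow> bool" where
  "C_k k f \<longleftrightarrow>
     (\<forall>is. length is \<le> k \<longrightarrow> continuous_on UNIV (iter_pd is f)) \<and>
     (\<forall>is i x. length is < k \<longrightarrow> has_pd i (iter_pd is f) x)"

definition test_fun :: "(real^'n::finite \<Rightarrow> real) set" where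
  "test_fun = {f. (\<forall>k. C_k k f) \<and> compact (closure {x. f x \<noteq> 0})}"

definition C_infty :: "(real^'n::finite \<Rightarrow> real) set" where
  "C_infty = {f. continuous_on UNIV f \<and> (f \<longlongrightarrow> 0) at_infinity}"

text \<open>Functionals on test functions are total HOL functions; only their values on
  \<^const>\<open>test_fun\<close> matter.\<close>

definition distribution :: "((real^'n::finite \<Rightarrow> real) \<Rightarrow> real) \<Rightarrow> bool" where
  "distribution u \<longleftrightarrow>
     (\<forall>f\<in>test_fun. \<forall>g\<in>test_fun. u (\<lambda>x. f x + g x) = u f + u g) \<and>
     (\<forall>f\<in>test_fun. \<forall>c. u (\<lambda>x. c * f x) = c * u f) \<and>
     (\<forall>K. compact K \<longrightarrow> (\<exists>C k. \<forall>f\<in>test_fun. {x. f x \<noteq> 0} \<subseteq> K \<longrightarrow>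
        \<bar>u f\<bar> \<le> C * (\<Sum>is\<in>{is. length is \<le> k}. \<Squnion>x. \<bar>iter_pd is f x\<bar>)))"

text \<open>Distributional divergence and second-order divergence:
  \<open>\<langle>\<partial>\<^sub>i F\<^sub>i, f\<rangle> = - \<langle>F\<^sub>i, \<partial>\<^sub>i f\<rangle>\<close> and
  \<open>\<langle>\<partial>\<^sub>i \<partial>\<^sub>j M\<^sub>i\<^sub>j, f\<rangle> = \<langle>M\<^sub>i\<^sub>j, \<partial>\<^sub>j \<partial>\<^sub>i f\<rangle>\<close>.\<close>

definition dist_div ::
    "('n \<Rightarrow> (real^'n::finite \<Rightarrow> real) \<Rightarrow> real) \<Rightarrow> (real^'n \<Rightarrow> real) \<Rightarrow> real" where
  "dist_div F f = (\<Sum>i\<in>UNIV. - F i (pd i f))"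

definition dist_hess ::
    "('n \<Rightarrow> 'n \<Rightarrow> (real^'n::finite \<Rightarrow> real) \<Rightarrow> real) \<Rightarrow> (real^'n \<Rightarrow> real) \<Rightarrow> real" where
  "dist_hess M f = (\<Sum>i\<in>UNIV. \<Sum>j\<in>UNIV. M i j (pd j (pd i f)))"


section \<open>Markov processes\<close>

definition past ::
    "(real^'n::finite \<Rightarrow> 'w measure) \<Rightarrow> (real \<Rightarrow> 'w \<Rightarrow> real^'n) \<Rightarrow> real^'n \<Rightarrow> real \<Rightarrow> 'w measure" where
  "past P X x s = sigma (space (P x))
     {X u -` B \<inter> space (P x) | u B. 0 \<le> u \<and> u \<le> s \<and> B \<in> sets borel}"

definition trans_prob ::
    "(real^'n::finite \<Rightarrow> 'w measure) \<Rightarrow> (real \<Rightarrow> 'w \<Rightarrow> real^'n) \<Rightarrow> real \<Rightarrow> real^'n \<Rightarrow> (real^'n) set \<Rightarrow> ennreal"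
  where "trans_prob P X t x B = emeasure (P x) (X t -` B \<inter> space (P x))"

text \<open>\<open>P x\<close> is the law under which the process starts in \<open>x\<close>; the Markov property is required
  with respect to the natural filtration.\<close>

definition markov_process ::
    "(real^'n::finite \<Rightarrow> 'w measure) \<Rightarrow> (real \<Rightarrow> 'w \<Rightarrow> real^'n) \<Rightarrow> bool" where
  "markov_process P X \<longleftrightarrow>
     (\<forall>x y. sets (P x) = sets (P y)) \<and>
     (\<forall>x. prob_space (P x)) \<and>
     (\<forall>x. \<forall>t\<ge>0. X t \<in> borel_measurable (P x)) \<and>
     (\<forall>t\<ge>0. \<forall>B\<in>sets borel. (\<lambda>x. trans_prob P X t x B) \<in> borel_measurable borel) \<and>
     (\<forall>x. AE \<omega> in P x. X 0 \<omega> = x) \<and>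
     (\<forall>x. \<forall>s\<ge>0. \<forall>t\<ge>0. \<forall>B\<in>sets borel. AE \<omega> in P x.
        real_cond_exp (P x) (past P X x s) (\<lambda>\<omega>'. indicator B (X (s + t) \<omega>')) \<omega>
          = enn2real (trans_prob P X t (X s \<omega>) B))"

definition markov_semigroup ::
    "(real^'n::finite \<Rightarrow> 'w measure) \<Rightarrow> (real \<Rightarrow> 'w \<Rightarrow> real^'n) \<Rightarrow> real \<Rightarrow>
     (real^'n \<Rightarrow> real) \<Rightarrow> real^'n \<Rightarrow> real" where
  "markov_semigroup P X t f x = (\<integral>\<omega>. f (X t \<omega>) \<partial>P x)"

definition pw_generator_dom ::
    "(real^'n::finite \<Rightarrow> 'w measure) \<Rightarrow> (real \<Rightarrow> 'w \<Rightarrow> real^'n) \<Rightarrow> (real^'n \<Rightarrow> real) set" where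
  "pw_generator_dom P X =
     {f\<in>C_infty. \<forall>x. \<exists>l. ((\<lambda>t. (markov_semigroup P X t f x - f x) / t) \<longlongrightarrow> l) (at_right 0)}"

definition pw_generator ::
    "(real^'n::finite \<Rightarrow> 'w measure) \<Rightarrow> (real \<Rightarrow> 'w \<Rightarrow> real^'n) \<Rightarrow>
     (real^'n \<Rightarrow> real) \<Rightarrow> real^'n \<Rightarrow> real" where
  "pw_generator P X f x = Lim (at_right 0) (\<lambda>t. (markov_semigroup P X t f x - f x) / t)"

definition invariant_measure ::
    "(real^'n::finite \<Rightarrow> 'w measure) \<Rightarrow> (real \<Rightarrow> 'w \<Rightarrow> real^'n) \<Rightarrow> (real^'n) measure \<Rightarrow> bool" where
  "invariant_measure P X \<eta> \<longleftrightarrow>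
     (\<forall>t\<ge>0. \<forall>B\<in>sets borel. (\<integral>\<^sup>+x. trans_prob P X t x B \<partial>\<eta>) = emeasure \<eta> B)"


section \<open>Levy-type operators\<close>

text \<open>A Banach space \<open>E\<close> of functions with norm \<open>N\<close>.\<close>

definition banach_function_space ::
    "(real^'n::finite \<Rightarrow> real) set \<Rightarrow> ((real^'n \<Rightarrow> real) \<Rightarrow> real) \<Rightarrow> bool" where
  "banach_function_space E N \<longleftrightarrow>
     (\<lambda>x. 0) \<in> E \<and>
     (\<forall>f\<in>E. \<forall>g\<in>E. (\<lambda>x. f x + g x) \<in> E) \<and>
     (\<forall>f\<in>E. \<forall>c. (\<lambda>x. c * f x) \<in> E) \<and>
     (\<forall>f\<in>E. 0 \<le> N f \<and> (N f = 0 \<longleftrightarrow> f = (\<lambda>x. 0))) \<and>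
     (\<forall>f\<in>E. \<forall>g\<in>E. N (\<lambda>x. f x + g x) \<le> N f + N g) \<and>
     (\<forall>f\<in>E. \<forall>c. N (\<lambda>x. c * f x) = \<bar>c\<bar> * N f) \<and>
     (\<forall>u::nat \<Rightarrow> real^'n \<Rightarrow> real.
        (\<forall>n. u n \<in> E) \<and>
        (\<forall>e>0. \<exists>n0. \<forall>m\<ge>n0. \<forall>n\<ge>n0. N (\<lambda>x. u m x - u n x) < e) \<longrightarrow>
        (\<exists>f\<in>E. (\<lambda>n. N (\<lambda>x. u n x - f x)) \<longlonglongrightarrow> 0))"

definition levy_measure :: "(real^'n::finite) measure \<Rightarrow> bool" where
  "levy_measure Q \<longleftrightarrow>
     sets Q = sets borel \<and> emeasure Q {0} = 0 \<and>
     (\<integral>\<^sup>+y. ennreal (min 1 ((norm y)\<^sup>2)) \<partial>Q) < \<infinity>"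

definition levy_kernel :: "(real^'n::finite \<Rightarrow> (real^'n) measure) \<Rightarrow> bool" where
  "levy_kernel \<Lambda> \<longleftrightarrow>
     (\<forall>x. levy_measure (\<Lambda> x)) \<and>
     (\<forall>B\<in>sets borel. (\<lambda>x. emeasure (\<Lambda> x) B) \<in> borel_measurable borel)"

definition div_b_grad ::
    "(real^'n::finite \<Rightarrow> real^'n^'n) \<Rightarrow> (real^'n \<Rightarrow> real) \<Rightarrow> real^'n \<Rightarrow> real" where
  "div_b_grad b f x = (\<Sum>i\<in>UNIV. \<Sum>j\<in>UNIV. pd i (\<lambda>z. b z $ i $ j * pd j f z) x)"

definition jump_integrand ::
    "(real^'n::finite \<Rightarrow> real) \<Rightarrow> real^'n \<Rightarrow> real^'n \<Rightarrow> real" where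
  "jump_integrand f x y = f (x + y) - f x - (grad f x \<bullet> y) * indicator {y. norm y < 1} y"

definition characteristic_triplet ::
    "(real^'n::finite \<Rightarrow> real^'n) \<Rightarrow> (real^'n \<Rightarrow> real^'n^'n) \<Rightarrow>
     (real^'n \<Rightarrow> (real^'n) measure) \<Rightarrow> bool" where
  "characteristic_triplet a b \<Lambda> \<longleftrightarrow>
     a \<in> borel_measurable borel \<and>
     b \<in> borel_measurable borel \<and>
     (\<forall>x. transpose (b x) = b x \<and> (\<forall>v. 0 \<le> v \<bullet> (b x *v v))) \<and>
     levy_kernel \<Lambda>"

text \<open>The defining formula involves second-order classical derivatives, so it is required of those
  \<open>f\<close> in the domain that are of class \<open>C\<^sup>2\<close>: the domain of a pointwise generator usually also contains
  functions for which the right-hand side has no meaning. For \<open>C\<^sup>2\<close> functions, the existence of the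
  derivatives and of the integral is part of the requirement.\<close>

definition levy_type_operator ::
    "(real^'n::finite \<Rightarrow> real) set \<Rightarrow> ((real^'n \<Rightarrow> real) \<Rightarrow> real) \<Rightarrow>
     (real^'n \<Rightarrow> real) set \<Rightarrow> ((real^'n \<Rightarrow> real) \<Rightarrow> real^'n \<Rightarrow> real) \<Rightarrow>
     (real^'n \<Rightarrow> real^'n) \<Rightarrow> (real^'n \<Rightarrow> real^'n^'n) \<Rightarrow>
     (real^'n \<Rightarrow> (real^'n) measure) \<Rightarrow> bool" where
  "levy_type_operator E N D A a b \<Lambda> \<longleftrightarrow>
     banach_function_space E N \<and> D \<subseteq> E \<and> A ` D \<subseteq> E \<and>
     characteristic_triplet a b \<Lambda> \<and>
     (\<forall>f\<in>D. C_k 2 f \<longrightarrow> (\<forall>x.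
        (\<forall>i j. has_pd i (\<lambda>z. b z $ i $ j * pd j f z) x) \<and>
        integrable (\<Lambda> x) (jump_integrand f x) \<and>
        A f x = a x \<bullet> grad f x + (1/2) * div_b_grad b f x
                + (\<integral>y. jump_integrand f x y \<partial>\<Lambda> x)))"


section \<open>Convenient decompositions\<close>

definition convenient_decomposition ::
    "(real^'n::finite \<Rightarrow> (real^'n) measure) \<Rightarrow> (real^'n \<Rightarrow> (real^'n) measure) \<Rightarrow>
     (real^'n \<Rightarrow> (real^'n) measure) \<Rightarrow> (real^'n \<Rightarrow> (real^'n) measure) \<Rightarrow> bool" where
  "convenient_decomposition \<Lambda> \<nu> \<mu> \<rho> \<longleftrightarrow>
     (\<exists>h\<^sub>\<nu> h\<^sub>\<mu> h\<^sub>\<rho> :: real^'n \<Rightarrow> real.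
        (\<forall>h\<in>{h\<^sub>\<nu>, h\<^sub>\<mu>, h\<^sub>\<rho>}. continuous_on UNIV h \<and> (\<forall>y. 0 \<le> h y)) \<and>
        (\<forall>x. \<nu> x = density (\<Lambda> x) (\<lambda>y. ennreal (h\<^sub>\<nu> y))) \<and>
        (\<forall>x. \<mu> x = density (\<Lambda> x) (\<lambda>y. ennreal (h\<^sub>\<mu> y))) \<and>
        (\<forall>x. \<rho> x = density (\<Lambda> x) (\<lambda>y. ennreal (h\<^sub>\<rho> y)))) \<and>
     (\<forall>x. \<forall>B\<in>sets borel.
        emeasure (\<Lambda> x) B = emeasure (\<nu> x) B + emeasure (\<mu> x) B + emeasure (\<rho> x) B) \<and>
     (\<forall>x. emeasure (\<nu> x) UNIV < \<infinity>) \<and>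
     (\<forall>x. (\<integral>\<^sup>+y. ennreal (min 1 (norm y)) \<partial>\<mu> x) < \<infinity>) \<and>
     (\<forall>x. (\<integral>\<^sup>+y. ennreal (min (norm y) ((norm y)\<^sup>2)) \<partial>\<rho> x) < \<infinity>)"

definition a_decomp ::
    "(real^'n::finite \<Rightarrow> (real^'n) measure) \<Rightarrow> (real^'n \<Rightarrow> (real^'n) measure) \<Rightarrow>
     (real^'n \<Rightarrow> (real^'n) measure) \<Rightarrow> real^'n \<Rightarrow> real^'n" where
  "a_decomp \<nu> \<mu> \<rho> x =
     - (LINT y:{y. norm y < 1}|\<nu> x. y) - (LINT y:{y. norm y < 1}|\<mu> x. y)
     + (LINT y:{y. norm y \<ge> 1}|\<rho> x. y)"


section \<open>Polar decompositions and integrated tails\<close>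

definition polar_decomposition ::
    "(real^'n::finite) measure \<Rightarrow> (real^'n) measure \<Rightarrow> (real^'n \<Rightarrow> real measure) \<Rightarrow> bool" where
  "polar_decomposition Q Qo K \<longleftrightarrow>
     finite_measure Qo \<and> sets Qo = sets (restrict_space borel (sphere 0 1)) \<and>
     (\<forall>\<xi>\<in>sphere 0 1. sets (K \<xi>) = sets (restrict_space borel {0<..}) \<and>
        sigma_finite_measure (K \<xi>) \<and> 0 < emeasure (K \<xi>) {0<..}) \<and>
     (\<forall>B\<in>sets (restrict_space borel {0<..}). (\<lambda>\<xi>. emeasure (K \<xi>) B) \<in> borel_measurable Qo) \<and>
     (\<forall>B\<in>sets borel. emeasure Q B = (\<integral>\<^sup>+\<xi>. (\<integral>\<^sup>+r. indicator B (r *\<^sub>R \<xi>) \<partial>K \<xi>) \<partial>Qo))"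

definition int_tail ::
    "(real^'n::finite) measure \<Rightarrow> (real^'n \<Rightarrow> real measure) \<Rightarrow> (real^'n) measure" where
  "int_tail Qo K = measure_of UNIV (sets borel)
     (\<lambda>B. \<integral>\<^sup>+\<xi>. (\<integral>\<^sup>+z\<in>{0<..}. indicator B (z *\<^sub>R \<xi>) * emeasure (K \<xi>) {z<..} \<partial>lborel) \<partial>Qo)"

definition double_int_tail ::
    "(real^'n::finite) measure \<Rightarrow> (real^'n \<Rightarrow> real measure) \<Rightarrow> (real^'n) measure" where
  "double_int_tail Qo K = measure_of UNIV (sets borel)
     (\<lambda>B. \<integral>\<^sup>+\<xi>. (\<integral>\<^sup>+z2\<in>{0<..}. indicator B (z2 *\<^sub>R \<xi>) *
        (\<integral>\<^sup>+z1\<in>{z2<..}. emeasure (K \<xi>) {z1<..} \<partial>lborel) \<partial>lborel) \<partial>Qo)"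

text \<open>The tails do not depend on the polar decomposition that is chosen, as long as its radial
  parts satisfy the stated integrability condition.\<close>

definition integrated_tail :: "(real^'n::finite) measure \<Rightarrow> (real^'n) measure" where
  "integrated_tail Q = (SOME R. \<exists>Qo K. polar_decomposition Q Qo K \<and>
     (\<forall>\<xi>\<in>sphere 0 1. (\<integral>\<^sup>+r. ennreal (min 1 (r\<^sup>2)) \<partial>K \<xi>) < \<infinity>) \<and>
     R = int_tail Qo K)"

definition double_integrated_tail :: "(real^'n::finite) measure \<Rightarrow> (real^'n) measure" where
  "double_integrated_tail Q = (SOME R. \<exists>Qo K. polar_decomposition Q Qo K \<and>
     (\<forall>\<xi>\<in>sphere 0 1. (\<integral>\<^sup>+r. ennreal (min r (r\<^sup>2)) \<partial>K \<xi>) < \<infinity>) \<and>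
     R = double_int_tail Qo K)"


section \<open>The functionals of the distributional equation\<close>

definition weighted_fun ::
    "(real^'n::finite \<Rightarrow> real^'n) \<Rightarrow> (real^'n) measure \<Rightarrow> 'n \<Rightarrow> (real^'n \<Rightarrow> real) \<Rightarrow> real" where
  "weighted_fun c \<eta> i f = (\<integral>x. c x $ i * f x \<partial>\<eta>)"

definition diffusion_fun ::
    "(real^'n::finite \<Rightarrow> real^'n^'n) \<Rightarrow> (real^'n) measure \<Rightarrow> (real^'n \<Rightarrow> real) \<Rightarrow> real" where
  "diffusion_fun b \<eta> f = (\<integral>x. (1/2) * div_b_grad b f x \<partial>\<eta>)"

definition U_integrand ::
    "(real^'n::finite \<Rightarrow> (real^'n) measure) \<Rightarrow> (real^'n \<Rightarrow> real) \<Rightarrow> real^'n \<Rightarrow> real" where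
  "U_integrand \<nu> f x = (\<integral>y. f (x + y) \<partial>\<nu> x) - f x * measure (\<nu> x) UNIV"

definition V_integrand ::
    "(real^'n::finite \<Rightarrow> (real^'n) measure) \<Rightarrow> 'n \<Rightarrow> (real^'n \<Rightarrow> real) \<Rightarrow> real^'n \<Rightarrow> real" where
  "V_integrand \<mu> i f x = (\<integral>y. f (x + y) * (y $ i / norm y) \<partial>integrated_tail (\<mu> x))"

definition W_integrand ::
    "(real^'n::finite \<Rightarrow> (real^'n) measure) \<Rightarrow> 'n \<Rightarrow> 'n \<Rightarrow> (real^'n \<Rightarrow> real) \<Rightarrow> real^'n \<Rightarrow> real" where
  "W_integrand \<rho> i j f x =
     (\<integral>y. f (x + y) * (y $ i * y $ j / (norm y)\<^sup>2) \<partial>double_integrated_tail (\<rho> x))"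

definition U_fun ::
    "(real^'n::finite \<Rightarrow> (real^'n) measure) \<Rightarrow> (real^'n) measure \<Rightarrow> (real^'n \<Rightarrow> real) \<Rightarrow> real" where
  "U_fun \<nu> \<eta> f = (\<integral>x. U_integrand \<nu> f x \<partial>\<eta>)"

definition V_fun ::
    "(real^'n::finite \<Rightarrow> (real^'n) measure) \<Rightarrow> (real^'n) measure \<Rightarrow>
     'n \<Rightarrow> (real^'n \<Rightarrow> real) \<Rightarrow> real" where
  "V_fun \<mu> \<eta> i f = (\<integral>x. V_integrand \<mu> i f x \<partial>\<eta>)"

definition W_fun ::
    "(real^'n::finite \<Rightarrow> (real^'n) measure) \<Rightarrow> (real^'n) measure \<Rightarrow>
     'n \<Rightarrow> 'n \<Rightarrow> (real^'n \<Rightarrow> real) \<Rightarrow> real" where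
  "W_fun \<rho> \<eta> i j f = (\<integral>x. W_integrand \<rho> i j f x \<partial>\<eta>)"

text \<open>``Measure on the Euclidean space'' is read as Radon measure, i.e. a Borel measure finite on
  compact sets. Without local finiteness the equation can fail: for the flow \<open>X\<^sub>t = e\<^sup>-\<^sup>t x\<close> on the real
  line, \<open>dx / \<bar>x\<bar>\<close> is invariant, but \<open>x dx / \<bar>x\<bar>\<close> is not divergence-free.\<close>

definition radon_measure :: "(real^'n::finite) measure \<Rightarrow> bool" where
  "radon_measure \<eta> \<longleftrightarrow>
     sets \<eta> = sets borel \<and> (\<forall>K. compact K \<longrightarrow> emeasure \<eta> K < \<infinity>)"

text \<open>A functional defines a distribution if all integrals over \<open>\<eta>\<close> that occur in its values on test
  functions converge and it is linear and continuous. The inner integrals over \<open>y\<close> always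
  converge for test functions, by the conditions on a convenient decomposition.\<close>

definition M_space ::
    "(real^'n::finite \<Rightarrow> real^'n) \<Rightarrow> (real^'n \<Rightarrow> real^'n^'n) \<Rightarrow>
     (real^'n \<Rightarrow> (real^'n) measure) \<Rightarrow> (real^'n \<Rightarrow> (real^'n) measure) \<Rightarrow>
     (real^'n \<Rightarrow> (real^'n) measure) \<Rightarrow> (real^'n) measure set" where
  "M_space a b \<nu> \<mu> \<rho> = {\<eta>. radon_measure \<eta> \<and>
     (\<forall>f\<in>test_fun.
        (\<forall>i. integrable \<eta> (\<lambda>x. (a x + a_decomp \<nu> \<mu> \<rho> x) $ i * pd i f x)) \<and>
        integrable \<eta> (\<lambda>x. (1/2) * div_b_grad b f x) \<and>
        integrable \<eta> (U_integrand \<nu> f) \<and>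
        (\<forall>i. integrable \<eta> (V_integrand \<mu> i (pd i f))) \<and>
        (\<forall>i j. integrable \<eta> (W_integrand \<rho> i j (pd j (pd i f))))) \<and>
     distribution (dist_div (weighted_fun (\<lambda>x. a x + a_decomp \<nu> \<mu> \<rho> x) \<eta>)) \<and>
     distribution (diffusion_fun b \<eta>) \<and>
     distribution (U_fun \<nu> \<eta>) \<and>
     distribution (dist_div (V_fun \<mu> \<eta>)) \<and>
     distribution (dist_hess (W_fun \<rho> \<eta>))}"

text \<open>\<open>\<eta>\<close> solves \<open>- \<nabla>\<cdot>((a + a\<^sub>\<pi>)\<eta>) + 1/2 \<nabla>\<cdot>b\<nabla>\<eta> + U(\<eta>) - \<nabla>\<cdot>V(\<eta>) + H\<cdot>W(\<eta>) = 0\<close> as an identity of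
  distributions. Sign of the \<open>V\<close> term: with the usual \<open>\<langle>\<nabla>\<cdot>V, f\<rangle> = - \<Sum>\<^sub>i \<langle>V\<^sub>i, \<partial>\<^sub>i f\<rangle>\<close>, which is also the
  convention behind the drift term, integration along rays gives
  \<open>\<integral>\<integral>(f(x+y) - f(x)) \<mu>(x,dy) \<eta>(dx) = \<Sum>\<^sub>i \<langle>V\<^sub>i(\<eta>), \<partial>\<^sub>i f\<rangle> = - \<langle>\<nabla>\<cdot>V(\<eta>), f\<rangle>\<close>. A plus sign in front of
  \<open>\<nabla>\<cdot>V(\<eta>)\<close> is correct only if \<open>\<nabla>\<cdot>V(\<eta>)\<close> abbreviates \<open>f \<mapsto> \<Sum>\<^sub>i \<langle>V\<^sub>i(\<eta>), \<partial>\<^sub>i f\<rangle>\<close>.\<close>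

definition solves_dist_equation ::
    "(real^'n::finite \<Rightarrow> real^'n) \<Rightarrow> (real^'n \<Rightarrow> real^'n^'n) \<Rightarrow>
     (real^'n \<Rightarrow> (real^'n) measure) \<Rightarrow> (real^'n \<Rightarrow> (real^'n) measure) \<Rightarrow>
     (real^'n \<Rightarrow> (real^'n) measure) \<Rightarrow> (real^'n) measure \<Rightarrow> bool" where
  "solves_dist_equation a b \<nu> \<mu> \<rho> \<eta> \<longleftrightarrow> (\<forall>f\<in>test_fun.
     - dist_div (weighted_fun (\<lambda>x. a x + a_decomp \<nu> \<mu> \<rho> x) \<eta>) f
     + diffusion_fun b \<eta> f
     + U_fun \<nu> \<eta> f
     - dist_div (V_fun \<mu> \<eta>) f
     + dist_hess (W_fun \<rho> \<eta>) f = 0)"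

end

theory Submission
  imports Defs
begin

text \<open>
  Invariance gives \<open>\<integral> (P\<^sub>t f - f) / t d\<eta> = 0\<close>, and dominated convergence turns this into
  \<open>\<integral> \<A> f d\<eta> = 0\<close>. It remains to rewrite the jump part of \<open>\<A> f\<close> pointwise. Splitting
  \<open>\<Pi> = \<nu> + \<mu> + \<rho>\<close> moves the compensator into \<open>a\<^sub>\<pi>\<close>, and leaves \<open>f(x+y) - f(x)\<close> to be integrated against
  \<open>\<nu>\<close> and \<open>\<mu>\<close>, and \<open>f(x+y) - f(x) - \<nabla>f(x)\<cdot>y\<close> against \<open>\<rho>\<close>. With \<open>u = y / |y|\<close>, Taylor's formula along rays,
  \<open>f(x+y) - f(x) = \<integral>\<^sub>0\<^sup>|\<^sup>y\<^sup>| \<nabla>f(x+zu)\<cdot>u dz\<close> and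
  \<open>f(x+y) - f(x) - \<nabla>f(x)\<cdot>y = \<integral>\<^sub>0\<^sup>|\<^sup>y\<^sup>| (|y| - z) D\<^sup>2f(x+zu)[u,u] dz\<close>,
  expresses these as integrals against the once and twice integrated tails: for every polar
  decomposition, Tonelli's theorem identifies the tails of \<open>Q\<close> with the image of
  \<open>\<psi>(|y|, z) 1\<^bsub>0<z<|y|\<^esub> Q(dy) dz\<close> under \<open>(y, z) \<mapsto> z y / |y|\<close>, where \<open>\<psi>(r, z)\<close> is \<open>1\<close> or \<open>r - z\<close>.
  Since the tails are defined by choosing a polar decomposition, its existence has to be proved;
  it comes from disintegrating \<open>w(|y|) Q(dy)\<close> over the direction \<open>y / |y|\<close>, with a weight \<open>w\<close> that makes
  this measure finite.
\<close>

section \<open>Disintegration of a finite measure over a real coordinate\<close>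

text \<open>Both tails are defined by \<open>SOME\<close>: nothing is known about them before a
  polar decomposition with the prescribed radial integrability is exhibited, and afterwards only
  what holds for every such decomposition. This is why a description of the tails that mentions no
  polar decomposition is put in between. The weight is \<open>min 1 (r\<^sup>2)\<close> or
  \<open>min r (r\<^sup>2)\<close>, the radial condition of the two definitions, so that one
  function makes the measure finite and also delivers that condition. A tail can have infinite mass:
  the tail of \<open>\<mu>\<close> has the integral of |y| as its mass, while only the minimum of 1
  and |y| is known to be integrable. Compact support of the test function rescues convergence, as it
  cuts the rays at a finite radius. \<open>pd\<close> differentiates along coordinate lines only, so
  differentiability along rays has to be derived from continuity of the partial derivatives. Local
  finiteness of \<open>\<eta>\<close> makes test functions integrable, so that the integrals of
  \<open>P_t f\<close> and \<open>f\<close> are finite numbers that may be subtracted. Membership in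
  \<open>M_space\<close> makes the terms of the pointwise identity integrable one by one, so that it
  can be integrated term by term.\<close>

lemma AE_le_if_set_nn_integral_le:
  fixes f g :: "'a \<Rightarrow> ennreal"
  assumes [measurable]: "f \<in> borel_measurable M" "g \<in> borel_measurable M"
    and fin: "(\<integral>\<^sup>+x. f x \<partial>M) < \<infinity>"
    and le: "\<And>A. A \<in> sets M \<Longrightarrow> (\<integral>\<^sup>+x\<in>A. f x \<partial>M) \<le> (\<integral>\<^sup>+x\<in>A. g x \<partial>M)"
  shows "AE x in M. f x \<le> g x"
proof -
  \<comment> \<open>The set where the claim fails. Testing \<open>le\<close> on it leaves the
    nonnegative difference \<open>f - g\<close> with integral 0; the finite integral of
    \<open>f\<close> is what permits the subtraction in \<open>ennreal\<close>.\<close>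
  define A where "A = {x\<in>space M. g x < f x}"
  have A[measurable]: "A \<in> sets M" unfolding A_def by measurable
  have fA: "(\<integral>\<^sup>+x\<in>A. f x \<partial>M) < \<infinity>"
    by (rule le_less_trans[OF _ fin], rule nn_integral_mono) (auto split: split_indicator)
  have gA: "(\<integral>\<^sup>+x\<in>A. g x \<partial>M) \<le> (\<integral>\<^sup>+x\<in>A. f x \<partial>M)"
    by (rule nn_integral_mono) (auto simp: A_def split: split_indicator)
  have "(\<integral>\<^sup>+x. f x * indicator A x - g x * indicator A x \<partial>M)
      = (\<integral>\<^sup>+x\<in>A. f x \<partial>M) - (\<integral>\<^sup>+x\<in>A. g x \<partial>M)"
    using fA gA by (intro nn_integral_diff) (auto simp: A_def split: split_indicator)
  also have "\<dots> = 0"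
    using le[OF A] gA fA by (simp add: diff_eq_0_iff_ennreal)
  finally have "AE x in M. f x * indicator A x - g x * indicator A x = 0"
    by (subst (asm) nn_integral_0_iff_AE) auto
  then show ?thesis
    by (rule AE_mp, intro AE_I2 impI)
       (auto simp: A_def not_le[symmetric] diff_eq_0_iff_ennreal split: split_indicator_asm)
qed

text \<open>Each \<open>R \<xi>\<close> is a distribution function and generates a
  Lebesgue-Stieltjes measure. Measurability in \<open>\<xi>\<close> has to be checked on half-lines
  only, as these form an intersection-stable generator. Right continuity and the limits are phrased
  by strict inequalities because an infimum over rationals provides them in this form.\<close>

lemma cdf_family_kernel:
  fixes R :: "'a \<Rightarrow> real \<Rightarrow> ennreal"
  assumes [measurable]: "\<And>t. (\<lambda>\<xi>. R \<xi> t) \<in> borel_measurable N"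
    and le1: "\<And>\<xi> t. R \<xi> t \<le> 1"
    and mono: "\<And>\<xi> s t. s \<le> t \<Longrightarrow> R \<xi> s \<le> R \<xi> t"
    and rc: "\<And>\<xi> t e. R \<xi> t < e \<Longrightarrow> \<exists>s>t. R \<xi> s < e"
    and bot: "\<And>\<xi> e. 0 < e \<Longrightarrow> \<exists>t. R \<xi> t < e"
    and top: "\<And>\<xi> e. e < 1 \<Longrightarrow> \<exists>t. e < R \<xi> t"
  shows "\<exists>\<kappa>. \<kappa> \<in> N \<rightarrow>\<^sub>M prob_algebra borel \<and> (\<forall>\<xi> t. emeasure (\<kappa> \<xi>) {..t} = R \<xi> t)"
proof -
  define F where "F \<xi> t = enn2real (R \<xi> t)" for \<xi> t
  have fin: "R \<xi> t < \<infinity>" for \<xi> t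
    using le1[of \<xi> t] by (simp add: less_top[symmetric] top_unique) (metis ennreal_one_less_top leD)
  have F: "ennreal (F \<xi> t) = R \<xi> t" for \<xi> t
    using fin[of \<xi> t] by (simp add: F_def)
  have Fmono: "F \<xi> s \<le> F \<xi> t" if "s \<le> t" for \<xi> s t
    unfolding F_def using mono[OF that, of \<xi>] fin by (intro enn2real_mono) auto
  have F0: "0 \<le> F \<xi> t" for \<xi> t by (simp add: F_def)
  have F1: "F \<xi> t \<le> 1" for \<xi> t
    using le1[of \<xi> t] by (simp flip: F)
  have Frc: "continuous (at_right t) (F \<xi>)" for \<xi> t
  proof (subst continuous_at_right_real_increasing[OF Fmono], assumption, intro allI impI)
    fix e :: real assume "0 < e"
    then have "R \<xi> t < ennreal (F \<xi> t + e)"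
      by (metis F F0 add.commute add_le_same_cancel2 ennreal_less_iff less_add_same_cancel2)
    from rc[OF this] obtain s where s: "s > t" "R \<xi> s < ennreal (F \<xi> t + e)" by auto
    then have "F \<xi> s < F \<xi> t + e"
      by (metis F F0 ennreal_less_iff)
    with s(1) show "\<exists>d>0. F \<xi> (t + d) - F \<xi> t < e"
      by (intro exI[of _ "s - t"]) auto
  qed
  have Fbot: "(F \<xi> \<longlongrightarrow> 0) at_bot" for \<xi>
  proof (rule order_tendstoI)
    fix e :: real assume "0 < e"
    then obtain t where "R \<xi> t < ennreal e" using bot[of "ennreal e"] by auto
    then have "F \<xi> t < e" by (metis F F0 ennreal_less_iff)
    then show "\<forall>\<^sub>F x in at_bot. F \<xi> x < e"
      unfolding eventually_at_bot_linorder using Fmono by (intro exI[of _ t]) (metis le_less_trans)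
  next
    fix e :: real assume "e < 0"
    then show "\<forall>\<^sub>F x in at_bot. e < F \<xi> x" using F0 by (intro always_eventually) (metis less_le_trans)
  qed
  have Ftop: "(F \<xi> \<longlongrightarrow> 1) at_top" for \<xi>
  proof (rule order_tendstoI)
    fix e :: real assume "e < 1"
    then have "ennreal e < 1" by (metis ennreal_1 ennreal_less_iff ennreal_lessI zero_less_one)
    then obtain t where "ennreal e < R \<xi> t" using top[of "ennreal e"] by auto
    then have "e < F \<xi> t" by (metis F F0 ennreal_leI leI leD)
    then show "\<forall>\<^sub>F x in at_top. e < F \<xi> x"
      unfolding eventually_at_top_linorder using Fmono by (intro exI[of _ t]) (metis less_le_trans)
  next
    fix e :: real assume "1 < e"
    then show "\<forall>\<^sub>F x in at_top. F \<xi> x < e" using F1 by (intro always_eventually) (metis le_less_trans)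
  qed
  have Iic: "emeasure (interval_measure (F \<xi>)) {..t} = R \<xi> t" for \<xi> t
    using emeasure_interval_measure_Iic[OF Fmono Frc Fbot, of \<xi> t] F by simp
  have "(\<lambda>\<xi>. interval_measure (F \<xi>)) \<in> N \<rightarrow>\<^sub>M prob_algebra borel"
  proof (rule measurable_prob_algebra_generated[where \<Omega>=UNIV and G="range (\<lambda>t::real. {..t})"])
    show "sets borel = sigma_sets UNIV (range (\<lambda>t::real. {..t}))"
      by (simp add: borel_eq_atMost)
    show "Int_stable (range (\<lambda>t::real. {..t}))"
      by (auto simp: Int_stable_def)
    show "prob_space (interval_measure (F \<xi>))" for \<xi>
      using real_distribution_interval_measure[OF Fmono Frc Fbot Ftop, of \<xi>] real_distribution.axioms(1) by blast
  qed (auto simp: Iic)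
  with Iic show ?thesis by blast
qed

text \<open>The conditional distribution functions \<open>F t\<close> are Radon-Nikodym derivatives. Almost surely they have
  the properties of a distribution function along the rationals (the set \<open>G\<close>), and \<open>R\<close> is the
  right-continuous function that they determine.\<close>

lemma disintegration_real:
  fixes M :: "('a \<times> real) measure"
  assumes "finite_measure M" and sM: "sets M = sets (N \<Otimes>\<^sub>M borel)"
  shows "\<exists>\<kappa>. \<kappa> \<in> N \<rightarrow>\<^sub>M prob_algebra borel \<and>
    (\<forall>C\<in>sets (N \<Otimes>\<^sub>M borel). emeasure M C = (\<integral>\<^sup>+\<xi>. emeasure (\<kappa> \<xi>) (Pair \<xi> -` C) \<partial>distr M N fst))"
proof -
  interpret M: finite_measure M by fact
  note [measurable_cong] = sM
  have spM: "space M = space N \<times> UNIV"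
    using sets_eq_imp_space_eq[OF sM] by (simp add: space_pair_measure)
  define L where "L = distr M N fst"
  interpret L: finite_measure L
    unfolding L_def by (rule M.finite_measure_distr) measurable
  have sL[measurable_cong]: "sets L = sets N" by (simp add: L_def)
  have spL: "space L = space N" by (simp add: L_def)
  have rect: "A \<times> B \<in> sets M" if "A \<in> sets N" "B \<in> sets borel" for A B
    using that by (simp add: sM)
  have LA: "emeasure L A = emeasure M (A \<times> UNIV)" if [measurable]: "A \<in> sets N" for A
  proof -
    have "fst -` A \<inter> space M = A \<times> UNIV" using sets.sets_into_space[OF that] by (auto simp: spM)
    then show ?thesis unfolding L_def by (subst emeasure_distr) auto
  qed
  \<comment> \<open>As a measure in \<open>A\<close>, \<open>Q t\<close> is
    \<open>M (A \<times> {..t})\<close>. It is dominated by the marginal \<open>L\<close>, and its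
    density \<open>F t\<close> is the conditional probability that the second coordinate is at most
    \<open>t\<close>, determined up to an \<open>L\<close>-null set that depends on
    \<open>t\<close>.\<close>
  define Q where "Q t = distr (density M (indicator (space N \<times> {..t}))) N fst" for t
  have QA: "emeasure (Q t) A = emeasure M (A \<times> {..t})" if A[measurable]: "A \<in> sets N" for A t
  proof -
    have "fst -` A \<inter> space M = A \<times> UNIV" using sets.sets_into_space[OF that] by (auto simp: spM)
    then have "emeasure (Q t) A = (\<integral>\<^sup>+x. indicator (space N \<times> {..t}) x * indicator (A \<times> UNIV) x \<partial>M)"
      unfolding Q_def by (subst emeasure_distr) (auto simp: emeasure_density rect)
    also have "\<dots> = (\<integral>\<^sup>+x. indicator (A \<times> {..t}) x \<partial>M)"
      using sets.sets_into_space[OF that]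
      by (intro nn_integral_cong) (auto split: split_indicator)
    finally show ?thesis by (simp add: rect)
  qed
  have sQ: "sets (Q t) = sets N" for t by (simp add: Q_def)
  have ac: "absolutely_continuous L (Q t)" for t
  proof -
    have "emeasure M (A \<times> {..t}) \<le> emeasure M (A \<times> UNIV)" if "A \<in> sets N" for A
      using that by (intro emeasure_mono) (auto simp: rect)
    then show ?thesis
      using LA QA by (auto simp: absolutely_continuous_def null_sets_def sL sQ) (metis le_zero_eq)
  qed
  define F where "F t = RN_deriv L (Q t)" for t
  have [measurable]: "F t \<in> borel_measurable N" for t
    using borel_measurable_RN_deriv[of L "Q t"] unfolding F_def by simp
  have FA: "(\<integral>\<^sup>+\<xi>\<in>A. F t \<xi> \<partial>L) = emeasure M (A \<times> {..t})" if A[measurable]: "A \<in> sets N" for A t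
  proof -
    have "density L (F t) = Q t"
      unfolding F_def by (rule L.density_RN_deriv[OF ac]) (simp add: Q_def sL)
    then have "emeasure (density L (F t)) A = emeasure M (A \<times> {..t})"
      using QA[OF A] by simp
    then show ?thesis by (subst (asm) emeasure_density) auto
  qed
  have Ffin: "(\<integral>\<^sup>+\<xi>. F t \<xi> \<partial>L) < \<infinity>" for t
  proof -
    have "(\<integral>\<^sup>+\<xi>. F t \<xi> \<partial>L) = (\<integral>\<^sup>+\<xi>\<in>space N. F t \<xi> \<partial>L)"
      by (intro nn_integral_cong) (auto simp: spL)
    also have "\<dots> < \<infinity>" by (subst FA) (auto simp: less_top[symmetric])
    finally show ?thesis .
  qed
  have mono_AE: "AE \<xi> in L. F s \<xi> \<le> F t \<xi>" if "s \<le> t" for s t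
  proof (rule AE_le_if_set_nn_integral_le[OF _ _ Ffin])
    fix A assume "A \<in> sets L"
    then have A: "A \<in> sets N" by (simp add: sL)
    have "emeasure M (A \<times> {..s}) \<le> emeasure M (A \<times> {..t})"
      using A that by (intro emeasure_mono) (auto simp: rect)
    then show "(\<integral>\<^sup>+\<xi>\<in>A. F s \<xi> \<partial>L) \<le> (\<integral>\<^sup>+\<xi>\<in>A. F t \<xi> \<partial>L)"
      by (simp add: FA[OF A])
  qed measurable
  have le1_AE: "AE \<xi> in L. F t \<xi> \<le> 1" for t
  proof (rule AE_le_if_set_nn_integral_le[OF _ _ Ffin])
    fix A assume "A \<in> sets L"
    then have A: "A \<in> sets N" by (simp add: sL)
    have "emeasure M (A \<times> {..t}) \<le> emeasure M (A \<times> UNIV)"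
      using A by (intro emeasure_mono) (auto simp: rect)
    then show "(\<integral>\<^sup>+\<xi>\<in>A. F t \<xi> \<partial>L) \<le> (\<integral>\<^sup>+\<xi>\<in>A. 1 \<partial>L)"
      using A by (simp add: FA[OF A] LA sL)
  qed measurable
  \<comment> \<open>At plus infinity the reason is continuity of \<open>M\<close> from below along
    \<open>A \<times> {..n}\<close>, tested on every \<open>A\<close>. At minus infinity, in
    \<open>bot_AE\<close>, a single integral suffices: the infimum is nonnegative and its integral
    is bounded by masses that decrease to 0.\<close>
  have top_AE: "AE \<xi> in L. 1 \<le> (SUP n::nat. F (real n) \<xi>)"
  proof (rule AE_le_if_set_nn_integral_le)
    fix A assume "A \<in> sets L"
    then have A[measurable]: "A \<in> sets N" by (simp add: sL)
    have "(\<integral>\<^sup>+\<xi>\<in>A. 1 \<partial>L) = emeasure M (\<Union>n::nat. A \<times> {..real n})"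
    proof -
      have "(\<Union>n::nat. A \<times> {..real n}) = A \<times> UNIV" by (auto simp: real_arch_simple)
      then show ?thesis using A by (simp add: LA sL)
    qed
    also have "\<dots> = (SUP n::nat. emeasure M (A \<times> {..real n}))"
      using A by (intro SUP_emeasure_incseq[symmetric]) (auto simp: rect incseq_def)
    also have "\<dots> = (SUP n::nat. \<integral>\<^sup>+\<xi>\<in>A. F (real n) \<xi> \<partial>L)"
      by (simp add: FA)
    also have "\<dots> \<le> (\<integral>\<^sup>+\<xi>\<in>A. (SUP n::nat. F (real n) \<xi>) \<partial>L)"
      by (intro SUP_least nn_integral_mono mult_right_mono SUP_upper) auto
    finally show "(\<integral>\<^sup>+\<xi>\<in>A. 1 \<partial>L) \<le> (\<integral>\<^sup>+\<xi>\<in>A. (SUP n::nat. F (real n) \<xi>) \<partial>L)" .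
  qed (auto simp: less_top[symmetric])
  have bot_AE: "AE \<xi> in L. (INF n::nat. F (- real n) \<xi>) = 0"
  proof -
    have "(\<integral>\<^sup>+\<xi>. (INF n::nat. F (- real n) \<xi>) \<partial>L) \<le> emeasure M (space N \<times> {..- real n})" for n
    proof -
      have "(\<integral>\<^sup>+\<xi>. (INF n::nat. F (- real n) \<xi>) \<partial>L) \<le> (\<integral>\<^sup>+\<xi>\<in>space N. F (- real n) \<xi> \<partial>L)"
        by (intro nn_integral_mono) (auto simp: spL intro!: INF_lower)
      then show ?thesis by (simp add: FA)
    qed
    moreover have "(\<lambda>n. emeasure M (space N \<times> {..- real n})) \<longlonglongrightarrow> emeasure M (\<Inter>n. space N \<times> {..- real n})"
      by (rule Lim_emeasure_decseq) (auto simp: rect decseq_def)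
    moreover have "(\<Inter>n. space N \<times> {..- real n}) = {}"
    proof -
      have "\<exists>n::nat. \<not> b \<le> - real n" for b
        using reals_Archimedean2[of "- b"] by (auto simp: not_le minus_less_iff)
      then show ?thesis by blast
    qed
    ultimately have "(\<integral>\<^sup>+\<xi>. (INF n::nat. F (- real n) \<xi>) \<partial>L) \<le> 0"
      by (intro LIMSEQ_le_const) auto
    then show ?thesis by (subst (asm) le_zero_eq, subst (asm) nn_integral_0_iff_AE) auto
  qed
  define G where "G = {\<xi>\<in>space N. (\<forall>p\<in>\<rat>. \<forall>q\<in>\<rat>. p \<le> q \<longrightarrow> F p \<xi> \<le> F q \<xi>) \<and> (\<forall>p\<in>\<rat>. F p \<xi> \<le> 1) \<and>
     1 \<le> (SUP n::nat. F (real n) \<xi>) \<and> (INF n::nat. F (- real n) \<xi>) = 0}"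
  have G[measurable]: "G \<in> sets N"
  proof -
    have [measurable]: "Measurable.pred N (\<lambda>\<xi>. \<forall>p\<in>\<rat>. \<forall>q\<in>\<rat>. p \<le> q \<longrightarrow> F p \<xi> \<le> F q \<xi>)"
      unfolding Rats_def ball_simps ball_UNIV by measurable
    have [measurable]: "Measurable.pred N (\<lambda>\<xi>. \<forall>p\<in>\<rat>. F p \<xi> \<le> 1)"
      unfolding Rats_def ball_simps ball_UNIV by measurable
    show ?thesis unfolding G_def by measurable
  qed
  have G_AE: "AE \<xi> in L. \<xi> \<in> G"
  proof -
    have "AE \<xi> in L. \<forall>p\<in>\<rat>. \<forall>q\<in>\<rat>. p \<le> q \<longrightarrow> F p \<xi> \<le> F q \<xi>"
      using mono_AE by (auto simp: AE_ball_countable countable_rat)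
    moreover have "AE \<xi> in L. \<forall>p\<in>\<rat>. F p \<xi> \<le> 1"
      using le1_AE by (auto simp: AE_ball_countable countable_rat)
    ultimately show ?thesis
      using top_AE bot_AE AE_space by eventually_elim (auto simp: G_def spL)
  qed
  \<comment> \<open>Off \<open>G\<close> the distribution function of the unit mass at 0 is
    substituted, so that \<open>R \<xi>\<close> is a distribution function for every
    \<open>\<xi>\<close> and not only for almost every one.\<close>
  define H where "H \<xi> q = (if \<xi> \<in> G then F q \<xi> else if q < 0 then 0 else 1)" for \<xi> q
  define R where "R \<xi> t = (INF q\<in>{q\<in>\<rat>. t < q}. H \<xi> q)" for \<xi> t
  have cnt: "countable {q\<in>\<rat>. t < q}" for t :: real
    by (rule countable_subset[OF _ countable_rat]) auto
  have Hmono: "H \<xi> p \<le> H \<xi> q" if "p \<in> \<rat>" "q \<in> \<rat>" "p \<le> q" for \<xi> p q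
    using that by (auto simp: H_def G_def)
  have H1: "H \<xi> p \<le> 1" if "p \<in> \<rat>" for \<xi> p
    using that by (auto simp: H_def G_def)
  have "\<exists>\<kappa>. \<kappa> \<in> N \<rightarrow>\<^sub>M prob_algebra borel \<and> (\<forall>\<xi> t. emeasure (\<kappa> \<xi>) {..t} = R \<xi> t)"
  proof (rule cdf_family_kernel)
    show "(\<lambda>\<xi>. R \<xi> t) \<in> borel_measurable N" for t
      unfolding R_def H_def by (intro borel_measurable_INF cnt) measurable
    show "R \<xi> t \<le> 1" for \<xi> t
    proof -
      obtain q where "q \<in> \<rat>" "t < q" "q < t + 1" using Rats_dense_in_real[of t "t+1"] by auto
      then show ?thesis unfolding R_def by (intro INF_lower2[of q]) (auto simp: H1)
    qed
    show "R \<xi> s \<le> R \<xi> t" if "s \<le> t" for \<xi> s t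
      unfolding R_def using that by (intro INF_superset_mono) auto
    show "\<exists>s>t. R \<xi> s < e" if less: "R \<xi> t < e" for \<xi> t e
    proof -
      \<comment> \<open>The witness is the midpoint of \<open>t\<close> and \<open>q\<close>: it
        lies to the right of \<open>t\<close>, and \<open>q\<close> is still admissible in the
        infimum that defines \<open>R\<close> there.\<close>
      obtain q where q: "q \<in> \<rat>" "t < q" "H \<xi> q < e" using less by (auto simp: R_def INF_less_iff)
      have "R \<xi> ((t + q) / 2) \<le> H \<xi> q"
        unfolding R_def using q by (intro INF_lower) auto
      with q show ?thesis by (intro exI[of _ "(t + q) / 2"]) auto
    qed
    show "\<exists>t. R \<xi> t < e" if "0 < e" for \<xi> e
    proof -
      have "\<exists>q\<in>\<rat>. H \<xi> q < e"
      proof (cases "\<xi> \<in> G")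
        case True
        then have "(INF n::nat. F (- real n) \<xi>) < e" using that by (auto simp: G_def)
        then obtain n :: nat where "F (- real n) \<xi> < e" by (auto simp: INF_less_iff)
        then show ?thesis using True by (intro bexI[of _ "- real n"]) (auto simp: H_def)
      qed (use that in \<open>auto simp: H_def intro!: bexI[of _ "-1"]\<close>)
      then obtain q where q: "q \<in> \<rat>" "H \<xi> q < e" by auto
      \<comment> \<open>The value of \<open>R\<close> at a point involves only rationals strictly
        above it, so the argument has to be moved below \<open>q\<close>; the shift by 1 is
        arbitrary.\<close>
      have "R \<xi> (q - 1) \<le> H \<xi> q"
        unfolding R_def using q by (intro INF_lower) auto
      then show ?thesis using q by (intro exI[of _ "q - 1"]) auto
    qed
    show "\<exists>t. e < R \<xi> t" if "e < 1" for \<xi> e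
    proof -
      have "\<exists>q\<in>\<rat>. e < H \<xi> q"
      proof (cases "\<xi> \<in> G")
        case True
        then have "e < (SUP n::nat. F (real n) \<xi>)" using that by (auto simp: G_def)
        then obtain n :: nat where "e < F (real n) \<xi>" by (auto simp: less_SUP_iff)
        then show ?thesis using True by (intro bexI[of _ "real n"]) (auto simp: H_def)
      qed (use that in \<open>auto simp: H_def intro!: bexI[of _ "1"]\<close>)
      then obtain q where q: "q \<in> \<rat>" "e < H \<xi> q" by auto
      have "H \<xi> q \<le> R \<xi> q"
        unfolding R_def using q by (intro INF_greatest Hmono) auto
      then show ?thesis using q by (intro exI[of _ q]) auto
    qed
  qed
  then obtain \<kappa> where \<kappa>[measurable]: "\<kappa> \<in> N \<rightarrow>\<^sub>M prob_algebra borel"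
    and \<kappa>R: "\<And>\<xi> t. emeasure (\<kappa> \<xi>) {..t} = R \<xi> t" by blast
  \<comment> \<open>Taking right limits does not change the integrals. From above,
    \<open>R \<xi> t\<close> is at most \<open>F q \<xi>\<close> for a rational \<open>q\<close>
    between \<open>t\<close> and \<open>t + 1 / Suc n\<close>, and \<open>M\<close> is continuous
    from above as \<open>n\<close> grows. From below, \<open>F t \<le> F q\<close> holds almost
    surely for all of the countably many rational \<open>q > t\<close> at once, hence also for the
    infimum.\<close>
  have RA: "(\<integral>\<^sup>+\<xi>\<in>A. R \<xi> t \<partial>L) = emeasure M (A \<times> {..t})" if A[measurable]: "A \<in> sets N" for A t
  proof (rule antisym)
    have "(\<integral>\<^sup>+\<xi>\<in>A. R \<xi> t \<partial>L) \<le> emeasure M (A \<times> {..t + 1 / Suc n})" for n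
    proof -
      obtain q where q: "q \<in> \<rat>" "t < q" "q < t + 1 / Suc n"
        using Rats_dense_in_real[of t "t + 1 / Suc n"] by auto
      have "(\<integral>\<^sup>+\<xi>\<in>A. R \<xi> t \<partial>L) \<le> (\<integral>\<^sup>+\<xi>\<in>A. F q \<xi> \<partial>L)"
        using G_AE
      proof (intro nn_integral_mono_AE, eventually_elim)
        fix \<xi> assume "\<xi> \<in> G"
        then have "R \<xi> t \<le> F q \<xi>" using q unfolding R_def by (intro INF_lower2[of q]) (auto simp: H_def)
        then show "R \<xi> t * indicator A \<xi> \<le> F q \<xi> * indicator A \<xi>" by (rule mult_right_mono) simp
      qed
      also have "\<dots> \<le> emeasure M (A \<times> {..t + 1 / Suc n})"
        unfolding FA[OF A] using q by (intro emeasure_mono) (auto simp: rect)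
      finally show ?thesis .
    qed
    moreover have "(\<lambda>n. emeasure M (A \<times> {..t + 1 / Suc n})) \<longlonglongrightarrow> emeasure M (\<Inter>n. A \<times> {..t + 1 / Suc n})"
      by (rule Lim_emeasure_decseq) (auto simp: rect decseq_def frac_le intro: order_trans)
    moreover have "(\<Inter>n. A \<times> {..t + 1 / Suc n}) = A \<times> {..t}"
    proof -
      have "s \<le> t" if "\<And>n. s \<le> t + 1 / Suc n" for s
        by (rule LIMSEQ_le_const[where X="\<lambda>n. t + 1 / Suc n"])
           (use that LIMSEQ_inverse_real_of_nat_add[of t] in \<open>auto simp: inverse_eq_divide\<close>)
      moreover have "s \<le> t + 1 / Suc n" if "s \<le> t" for s n
        using that by (simp add: add_increasing2)
      ultimately show ?thesis by (fastforce simp del: of_nat_Suc)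
    qed
    ultimately show "(\<integral>\<^sup>+\<xi>\<in>A. R \<xi> t \<partial>L) \<le> emeasure M (A \<times> {..t})"
      by (intro LIMSEQ_le_const) auto
    have "AE \<xi> in L. \<forall>q\<in>{q\<in>\<rat>. t < q}. F t \<xi> \<le> F q \<xi>"
      using mono_AE by (intro AE_ball_countable' cnt) auto
    with G_AE have "AE \<xi> in L. F t \<xi> * indicator A \<xi> \<le> R \<xi> t * indicator A \<xi>"
    proof eventually_elim
      fix \<xi> assume "\<xi> \<in> G" "\<forall>q\<in>{q\<in>\<rat>. t < q}. F t \<xi> \<le> F q \<xi>"
      then have "F t \<xi> \<le> R \<xi> t" unfolding R_def H_def by (intro INF_greatest) auto
      then show "F t \<xi> * indicator A \<xi> \<le> R \<xi> t * indicator A \<xi>" by (rule mult_right_mono) simp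
    qed
    from nn_integral_mono_AE[OF this] show "emeasure M (A \<times> {..t}) \<le> (\<integral>\<^sup>+\<xi>\<in>A. R \<xi> t \<partial>L)"
      by (simp add: FA)
  qed
  have main: "emeasure M C = (\<integral>\<^sup>+\<xi>. emeasure (\<kappa> \<xi>) (Pair \<xi> -` C) \<partial>L)" if C: "C \<in> sets (N \<Otimes>\<^sub>M borel)" for C
  \<comment> \<open>\<open>bind\<close> over an empty space forgets the target sigma-algebra, so
    this trivial case is separated.\<close>
  proof (cases "space N = {}")
    case True
    then have "space M = {}" by (simp add: spM)
    then have "C = {}" using C sets.sets_into_space by (force simp: sM[symmetric])
    then show ?thesis by simp
  next
    case False
    \<comment> \<open>\<open>J\<close> is the measure with first marginal \<open>L\<close> and
      conditional laws \<open>\<kappa>\<close>. The claim becomes \<open>M = J\<close>, and on the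
      generating rectangles \<open>A \<times> {..t}\<close> this is \<open>RA\<close>.\<close>
    define J where "J = L \<bind> (\<lambda>\<xi>. distr (\<kappa> \<xi>) (N \<Otimes>\<^sub>M borel) (Pair \<xi>))"
    have K[measurable]: "(\<lambda>\<xi>. distr (\<kappa> \<xi>) (N \<Otimes>\<^sub>M borel) (Pair \<xi>)) \<in> N \<rightarrow>\<^sub>M subprob_algebra (N \<Otimes>\<^sub>M borel)"
      by (rule measurable_distr2[where M=borel]) (auto intro!: measurable_prob_algebraD)
    have s\<kappa>: "sets (\<kappa> \<xi>) = sets borel" if "\<xi> \<in> space N" for \<xi>
      using measurable_space[OF \<kappa> that] by (simp add: space_prob_algebra)
    have J: "emeasure J C = (\<integral>\<^sup>+\<xi>. emeasure (\<kappa> \<xi>) (Pair \<xi> -` C) \<partial>L)" if C: "C \<in> sets (N \<Otimes>\<^sub>M borel)" for C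
    proof -
      have "emeasure J C = (\<integral>\<^sup>+\<xi>. emeasure (distr (\<kappa> \<xi>) (N \<Otimes>\<^sub>M borel) (Pair \<xi>)) C \<partial>L)"
        unfolding J_def using False C by (intro emeasure_bind[where N="N \<Otimes>\<^sub>M borel"]) (auto simp: spL sL)
      also have "\<dots> = (\<integral>\<^sup>+\<xi>. emeasure (\<kappa> \<xi>) (Pair \<xi> -` C) \<partial>L)"
      proof (rule nn_integral_cong)
        fix \<xi> assume "\<xi> \<in> space L"
        then have \<xi>: "\<xi> \<in> space N" by (simp add: spL)
        note [measurable_cong] = s\<kappa>[OF \<xi>]
        have "Pair \<xi> \<in> \<kappa> \<xi> \<rightarrow>\<^sub>M N \<Otimes>\<^sub>M borel" using \<xi> by measurable
        then show "emeasure (distr (\<kappa> \<xi>) (N \<Otimes>\<^sub>M borel) (Pair \<xi>)) C = emeasure (\<kappa> \<xi>) (Pair \<xi> -` C)"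
          using C sets_eq_imp_space_eq[OF s\<kappa>[OF \<xi>]] by (simp add: emeasure_distr)
      qed
      finally show ?thesis .
    qed
    have sub: "{a \<times> b |a b. a \<in> sets N \<and> b \<in> range (\<lambda>t::real. {..t})} \<subseteq> Pow (space N \<times> UNIV)"
      by (auto dest: sets.sets_into_space)
    have sN: "sets N = sigma_sets (space N) (sets N)" by (simp add: sets.sigma_sets_eq)
    have sb: "sets borel = sigma_sets (space borel) (range (\<lambda>t::real. {..t}))"
      by (simp add: borel_eq_atMost)
    have "sets (N \<Otimes>\<^sub>M borel) = sets (sigma (space N \<times> space borel) {a \<times> b |a b. a \<in> sets N \<and> b \<in> range (\<lambda>t::real. {..t})})"
    proof (rule sets_pair_eq[OF sets.space_closed sN _ _ _ _ sb])
      show "countable {space N}" "{space N} \<subseteq> sets N" "\<Union>{space N} = space N" by auto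
      show "countable (range (\<lambda>n::nat. {..real n}))" by simp
      show "\<Union>(range (\<lambda>n::nat. {..real n})) = space borel" by (auto simp: real_arch_simple)
    qed auto
    then have gen: "sets (N \<Otimes>\<^sub>M borel) = sigma_sets (space N \<times> UNIV) {a \<times> b |a b. a \<in> sets N \<and> b \<in> range (\<lambda>t::real. {..t})}"
      using sub by (subst (asm) sets_measure_of) simp_all
    have "M = J"
    proof (rule measure_eqI_generator_eq[where A="\<lambda>n. space N \<times> {..real n}"])
      show "Int_stable {a \<times> b |a b. a \<in> sets N \<and> b \<in> range (\<lambda>t::real. {..t})}"
      proof (rule Int_stableI)
        fix X Y assume "X \<in> {a \<times> b |a b. a \<in> sets N \<and> b \<in> range (\<lambda>t::real. {..t})}"
          "Y \<in> {a \<times> b |a b. a \<in> sets N \<and> b \<in> range (\<lambda>t::real. {..t})}"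
        then obtain A s B t where "X = A \<times> {..s}" "Y = B \<times> {..t}" "A \<in> sets N" "B \<in> sets N" by blast
        then have "X \<inter> Y = (A \<inter> B) \<times> {..min s t}" "A \<inter> B \<in> sets N" by auto
        then show "X \<inter> Y \<in> {a \<times> b |a b. a \<in> sets N \<and> b \<in> range (\<lambda>t::real. {..t})}" by blast
      qed
      show "{a \<times> b |a b. a \<in> sets N \<and> b \<in> range (\<lambda>t::real. {..t})} \<subseteq> Pow (space N \<times> UNIV)"
        by (rule sub)
      show "sets M = sigma_sets (space N \<times> UNIV) {a \<times> b |a b. a \<in> sets N \<and> b \<in> range (\<lambda>t::real. {..t})}"
        using gen sM by simp
      have "sets J = sets (N \<Otimes>\<^sub>M borel)"
        unfolding J_def using False by (subst sets_bind[where N="N \<Otimes>\<^sub>M borel"]) (auto simp: spL)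
      then show "sets J = sigma_sets (space N \<times> UNIV) {a \<times> b |a b. a \<in> sets N \<and> b \<in> range (\<lambda>t::real. {..t})}"
        using gen by simp
      show "(\<Union>i. space N \<times> {..real i}) = space N \<times> UNIV" by (auto simp: real_arch_simple)
      fix X assume "X \<in> {a \<times> b |a b. a \<in> sets N \<and> b \<in> range (\<lambda>t::real. {..t})}"
      then obtain A t where X: "X = A \<times> {..t}" and A: "A \<in> sets N" by auto
      have "emeasure J X = (\<integral>\<^sup>+\<xi>\<in>A. R \<xi> t \<partial>L)"
        unfolding X using A by (subst J) (auto simp: \<kappa>R intro!: nn_integral_cong split: split_indicator)
      then show "emeasure M X = emeasure J X" using RA[OF A] by (simp add: X)
    qed (auto simp: less_top[symmetric])
    then show ?thesis using J[OF C] by simp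
  qed
  show ?thesis using \<kappa> main unfolding L_def by blast
qed

section \<open>Existence of polar decompositions\<close>

text \<open>The case of indicators is \<open>eq\<close>, and simple functions and monotone limits
  follow. That \<open>\<kappa>\<close> is a measurable subprobability kernel makes the inner
  integrals measurable in \<open>\<xi>\<close>, so that sums and limits pass through the outer
  integral.\<close>

lemma nn_integral_disintegration:
  fixes M :: "('a \<times> 'b) measure"
  assumes sM: "sets M = sets (N \<Otimes>\<^sub>M L)" and sO: "sets O' = sets N"
    and \<kappa>[measurable]: "\<kappa> \<in> N \<rightarrow>\<^sub>M subprob_algebra L"
    and eq: "\<And>C. C \<in> sets (N \<Otimes>\<^sub>M L) \<Longrightarrow> emeasure M C = (\<integral>\<^sup>+\<xi>. emeasure (\<kappa> \<xi>) (Pair \<xi> -` C) \<partial>O')"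
    and f[measurable]: "f \<in> borel_measurable (N \<Otimes>\<^sub>M L)"
  shows "(\<integral>\<^sup>+p. f p \<partial>M) = (\<integral>\<^sup>+\<xi>. (\<integral>\<^sup>+r. f (\<xi>, r) \<partial>\<kappa> \<xi>) \<partial>O')"
  using f
proof (induction rule: borel_measurable_induct)
  note [measurable_cong] = sM sO
  have sp: "space O' = space N" by (rule sets_eq_imp_space_eq[OF sO])
  have s\<kappa>: "sets (\<kappa> \<xi>) = sets L" if "\<xi> \<in> space N" for \<xi>
    using measurable_space[OF \<kappa> that] by (simp add: space_subprob_algebra)
  {
    fix f :: "'a \<times> 'b \<Rightarrow> ennreal" and \<xi> assume "f \<in> borel_measurable (N \<Otimes>\<^sub>M L)" "\<xi> \<in> space N"
    then have "(\<lambda>r. f (\<xi>, r)) \<in> borel_measurable (\<kappa> \<xi>)"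
      using measurable_cong_sets[OF s\<kappa> refl, of \<xi> borel] by (simp add: measurable_Pair2)
  } note sec = this
  have kint: "(\<lambda>\<xi>. \<integral>\<^sup>+r. f (\<xi>, r) \<partial>\<kappa> \<xi>) \<in> borel_measurable O'" if [measurable]: "f \<in> borel_measurable (N \<Otimes>\<^sub>M L)" for f
    by (rule nn_integral_measurable_subprob_algebra2[where N=L]) (auto simp: measurable_cong_sets[OF sO refl])
  { case (cong f g)
    have "(\<integral>\<^sup>+p. f p \<partial>M) = (\<integral>\<^sup>+p. g p \<partial>M)"
      using cong sets_eq_imp_space_eq[OF sM] by (intro nn_integral_cong) auto
    moreover have "(\<integral>\<^sup>+\<xi>. (\<integral>\<^sup>+r. f (\<xi>, r) \<partial>\<kappa> \<xi>) \<partial>O') = (\<integral>\<^sup>+\<xi>. (\<integral>\<^sup>+r. g (\<xi>, r) \<partial>\<kappa> \<xi>) \<partial>O')"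
      using cong by (intro nn_integral_cong) (auto simp: sp space_pair_measure sets_eq_imp_space_eq[OF s\<kappa>])
    ultimately show ?case using cong by simp }
  { case (set A)
    have "emeasure (\<kappa> \<xi>) (Pair \<xi> -` A) = (\<integral>\<^sup>+r. indicator A (\<xi>, r) \<partial>\<kappa> \<xi>)" if "\<xi> \<in> space N" for \<xi>
    proof -
      have "Pair \<xi> -` A \<in> sets (\<kappa> \<xi>)" using set that by (simp add: s\<kappa> sets_Pair1)
      then have "emeasure (\<kappa> \<xi>) (Pair \<xi> -` A) = (\<integral>\<^sup>+r. indicator (Pair \<xi> -` A) r \<partial>\<kappa> \<xi>)" by simp
      also have "\<dots> = (\<integral>\<^sup>+r. indicator A (\<xi>, r) \<partial>\<kappa> \<xi>)"
        by (intro nn_integral_cong) (auto split: split_indicator)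
      finally show ?thesis .
    qed
    then show ?case using set eq[OF set] by (auto simp: sM sp intro!: nn_integral_cong) }
  { case (mult u c)
    have "(\<integral>\<^sup>+\<xi>. (\<integral>\<^sup>+r. c * u (\<xi>, r) \<partial>\<kappa> \<xi>) \<partial>O') = (\<integral>\<^sup>+\<xi>. c * (\<integral>\<^sup>+r. u (\<xi>, r) \<partial>\<kappa> \<xi>) \<partial>O')"
      using mult by (intro nn_integral_cong nn_integral_cmult sec) (auto simp: sp)
    with mult kint[OF mult(2)] show ?case
      by (simp add: nn_integral_cmult measurable_cong_sets[OF sM refl]) }
  { case (add u v)
    have "(\<integral>\<^sup>+\<xi>. (\<integral>\<^sup>+r. v (\<xi>, r) + u (\<xi>, r) \<partial>\<kappa> \<xi>) \<partial>O')
        = (\<integral>\<^sup>+\<xi>. (\<integral>\<^sup>+r. v (\<xi>, r) \<partial>\<kappa> \<xi>) + (\<integral>\<^sup>+r. u (\<xi>, r) \<partial>\<kappa> \<xi>) \<partial>O')"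
      using add by (intro nn_integral_cong nn_integral_add sec) (auto simp: sp)
    with add kint[OF add(1)] kint[OF add(3)] show ?case
      by (simp add: nn_integral_add measurable_cong_sets[OF sM refl]) }
  { case (seq U)
    have "(\<integral>\<^sup>+p. (SUP i. U i) p \<partial>M) = (SUP i. \<integral>\<^sup>+p. U i p \<partial>M)"
      unfolding Sup_apply image_image using seq
      by (intro nn_integral_monotone_convergence_SUP) (auto simp: measurable_cong_sets[OF sM refl])
    also have "\<dots> = (SUP i. \<integral>\<^sup>+\<xi>. (\<integral>\<^sup>+r. U i (\<xi>, r) \<partial>\<kappa> \<xi>) \<partial>O')" using seq by simp
    also have "\<dots> = (\<integral>\<^sup>+\<xi>. (SUP i. \<integral>\<^sup>+r. U i (\<xi>, r) \<partial>\<kappa> \<xi>) \<partial>O')"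
      using seq by (intro nn_integral_monotone_convergence_SUP[symmetric] kint)
        (auto simp: incseq_def le_fun_def intro!: nn_integral_mono)
    also have "\<dots> = (\<integral>\<^sup>+\<xi>. (\<integral>\<^sup>+r. (SUP i. U i (\<xi>, r)) \<partial>\<kappa> \<xi>) \<partial>O')"
      using seq by (intro nn_integral_cong nn_integral_monotone_convergence_SUP[symmetric])
        (auto simp: incseq_def le_fun_def sp intro!: sec)
    finally show ?case using seq by (simp add: Sup_apply image_image) }
qed

lemma finite_measure_density:
  assumes [measurable]: "f \<in> borel_measurable M" and "(\<integral>\<^sup>+x. f x \<partial>M) < \<infinity>"
  shows "finite_measure (density M f)"
proof (rule finite_measureI)
  have "emeasure (density M f) (space M) = (\<integral>\<^sup>+x. f x \<partial>M)"
    by (subst emeasure_density) (auto intro!: nn_integral_cong)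
  then show "emeasure (density M f) (space (density M f)) \<noteq> \<infinity>" using assms by simp
qed

text \<open>The density \<open>w\<close> turns \<open>M\<close> into a finite measure, from which
  \<open>M\<close> is recovered by the density \<open>1 / w\<close>. A density with finite values
  preserves sigma-finiteness.\<close>

lemma sigma_finite_if_nn_integral_finite:
  assumes w[measurable]: "w \<in> borel_measurable M" and fin: "(\<integral>\<^sup>+x. ennreal (w x) \<partial>M) < \<infinity>"
    and pos: "AE x in M. 0 < w x"
  shows "sigma_finite_measure M"
proof -
  define D where "D = density M (\<lambda>x. ennreal (w x))"
  interpret D: finite_measure D
    using fin unfolding D_def by (intro finite_measure_density) auto
  have "density D (\<lambda>x. ennreal (1 / w x)) = density M (\<lambda>x. ennreal (w x) * ennreal (1 / w x))"
    unfolding D_def by (rule density_density_eq) auto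
  also have "\<dots> = density M (\<lambda>x. 1)"
    using pos by (intro density_cong) (auto simp: ennreal_mult'[symmetric] elim!: eventually_mono)
  also have "\<dots> = M" by (rule density_1)
  finally have M: "density D (\<lambda>x. ennreal (1 / w x)) = M" .
  have "sigma_finite_measure (density D (\<lambda>x. ennreal (1 / w x)))"
    by (subst D.sigma_finite_iff_density_finite) (auto simp: D_def)
  then show ?thesis by (simp add: M)
qed

text \<open>Dividing the conditional laws of the radius by \<open>w\<close> undoes the weight, so
  the integral of \<open>w\<close> over each \<open>K \<xi>\<close> is the mass of a probability
  measure, namely 1. This gives the radial integrability, sigma-finiteness and nonzero mass of
  \<open>K \<xi>\<close> in every direction, as the definition demands, and not only in almost every
  one.\<close>

lemma polar_decomposition_exists:
  fixes Q :: "(real^'n::finite) measure" and w :: "real \<Rightarrow> real"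
  assumes sQ[measurable_cong]: "sets Q = sets borel" and Q0: "emeasure Q {0} = 0"
    and w[measurable]: "w \<in> borel_measurable borel" and wpos: "\<And>r. 0 < r \<Longrightarrow> 0 < w r"
    and fin: "(\<integral>\<^sup>+y. ennreal (w (norm y)) \<partial>Q) < \<infinity>"
  shows "\<exists>Qo K. polar_decomposition Q Qo K \<and> (\<forall>\<xi>\<in>sphere 0 1. (\<integral>\<^sup>+r. ennreal (w r) \<partial>K \<xi>) < \<infinity>)"
proof -
  define N :: "(real^'n) measure" where "N = restrict_space borel (sphere 0 1)"
  have spN: "space N = sphere 0 1" by (simp add: N_def space_restrict_space)
  have idN: "(\<lambda>\<xi>. \<xi>) \<in> N \<rightarrow>\<^sub>M borel" unfolding N_def by (rule measurable_restrict_space1) simp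
  have AE0: "AE y in Q. y \<noteq> 0" 
    using Q0 by (intro AE_I[where N="{0}"]) auto
  have wQ[measurable]: "(\<lambda>y. ennreal (w (norm y))) \<in> borel_measurable Q"
    unfolding measurable_cong_sets[OF sQ refl] by measurable
  define D where "D = density Q (\<lambda>y. ennreal (w (norm y)))"
  have sD[measurable_cong]: "sets D = sets borel" by (simp add: D_def sQ)
  interpret D: finite_measure D
    using fin unfolding D_def by (rule finite_measure_density[OF wQ])
  have wi: "ennreal (w r) * ennreal (1 / w r) = 1" "ennreal (1 / w r) * ennreal (w r) = 1" if "0 < r" for r
    using wpos[OF that] by (subst ennreal_mult[symmetric]; simp)+
  obtain e :: "real^'n" where e: "norm e = 1"
    using vector_choose_size[of 1] by auto
  \<comment> \<open>The direction of \<open>0\<close> is irrelevant, but has to lie on the sphere.\<close>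
  define u where "u y = (if y = 0 then e else y /\<^sub>R norm y)" for y :: "real^'n"
  have u[measurable]: "u \<in> borel \<rightarrow>\<^sub>M N"
    unfolding N_def u_def by (rule measurable_restrict_space2) (auto simp: e, measurable)
  have uD: "(\<lambda>y. (u y, norm y)) \<in> D \<rightarrow>\<^sub>M N \<Otimes>\<^sub>M borel"
    unfolding measurable_cong_sets[OF sD refl] by measurable
  define M where "M = distr D (N \<Otimes>\<^sub>M borel) (\<lambda>y. (u y, norm y))"
  interpret M: finite_measure M unfolding M_def by (rule D.finite_measure_distr[OF uD])
  have sM: "sets M = sets (N \<Otimes>\<^sub>M borel)" by (simp add: M_def)
  define Qo where "Qo = distr M N fst"
  have sQo[measurable_cong]: "sets Qo = sets N" by (simp add: Qo_def)
  obtain \<kappa>0 where \<kappa>0[measurable]: "\<kappa>0 \<in> N \<rightarrow>\<^sub>M prob_algebra borel"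
    and M0: "\<And>C. C \<in> sets (N \<Otimes>\<^sub>M borel) \<Longrightarrow> emeasure M C = (\<integral>\<^sup>+\<xi>. emeasure (\<kappa>0 \<xi>) (Pair \<xi> -` C) \<partial>Qo)"
    using disintegration_real[OF M.finite_measure_axioms sM] unfolding Qo_def by blast
  have [measurable]: "\<kappa>0 \<in> N \<rightarrow>\<^sub>M subprob_algebra borel" by (rule measurable_prob_algebraD) measurable
  \<comment> \<open>The directions whose conditional law charges positive radii only. They have full
    measure: a nonpositive norm occurs at the origin alone, which \<open>Q\<close> does not
    charge.\<close>
  define B where "B = {\<xi>\<in>space N. emeasure (\<kappa>0 \<xi>) {..0} = 0}"
  have [measurable]: "B \<in> sets N" unfolding B_def by measurable
  have "AE \<xi> in Qo. \<xi> \<in> B"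
  proof -
    have C: "space N \<times> {..0::real} \<in> sets (N \<Otimes>\<^sub>M borel)" by simp
    have "emeasure M (space N \<times> {..0::real}) = emeasure D ((\<lambda>y. (u y, norm y)) -` (space N \<times> {..0::real}) \<inter> space D)"
      unfolding M_def by (rule emeasure_distr[OF uD C])
    also have "(\<lambda>y. (u y, norm y)) -` (space N \<times> {..0::real}) \<inter> space D = {0}"
      by (auto simp: sets_eq_imp_space_eq[OF sD] spN u_def e)
    also have "emeasure D {0} = 0"
      unfolding D_def using AE0 Q0 sQ by (subst emeasure_density) (auto simp: nn_integral_0_iff_AE)
    finally have "(\<integral>\<^sup>+\<xi>. emeasure (\<kappa>0 \<xi>) (Pair \<xi> -` (space N \<times> {..0::real})) \<partial>Qo) = 0"
      using M0[OF C] by simp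
    moreover have "(\<integral>\<^sup>+\<xi>. emeasure (\<kappa>0 \<xi>) (Pair \<xi> -` (space N \<times> {..0::real})) \<partial>Qo) = (\<integral>\<^sup>+\<xi>. emeasure (\<kappa>0 \<xi>) {..0} \<partial>Qo)"
      by (intro nn_integral_cong) (auto simp: sets_eq_imp_space_eq[OF sQo] intro!: arg_cong2[where f=emeasure])
    ultimately have "(\<integral>\<^sup>+\<xi>. emeasure (\<kappa>0 \<xi>) {..0} \<partial>Qo) = 0" by metis
    then have "AE \<xi> in Qo. emeasure (\<kappa>0 \<xi>) {..0} = 0"
      by (subst (asm) nn_integral_0_iff_AE) auto
    with AE_space show ?thesis
      by eventually_elim (auto simp: B_def sets_eq_imp_space_eq[OF sQo])
  qed
  \<comment> \<open>The unit mass at radius 1 is a default value for the exceptional directions: it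
    is a probability measure on positive radii, so the requirements on every direction
    survive.\<close>
  define \<kappa> where "\<kappa> \<xi> = (if \<xi> \<in> B then \<kappa>0 \<xi> else return borel 1)" for \<xi>
  have \<kappa>P: "\<kappa> \<in> N \<rightarrow>\<^sub>M prob_algebra borel" unfolding \<kappa>_def
    by (rule measurable_If_set) (auto simp: space_prob_algebra prob_space_return)
  then have \<kappa>[measurable]: "\<kappa> \<in> N \<rightarrow>\<^sub>M subprob_algebra borel" by (rule measurable_prob_algebraD)
  have s\<kappa>: "sets (\<kappa> \<xi>) = sets borel" and p\<kappa>: "prob_space (\<kappa> \<xi>)" if "\<xi> \<in> sphere 0 1" for \<xi>
    using measurable_space[OF \<kappa>P, of \<xi>] that by (auto simp: space_prob_algebra spN)
  have pos: "AE r in \<kappa> \<xi>. 0 < r" if "\<xi> \<in> sphere 0 1" for \<xi>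
  proof (cases "\<xi> \<in> B")
    case True
    then show ?thesis using s\<kappa>[OF that]
      by (intro AE_I[where N="{..0}"]) (auto simp: \<kappa>_def B_def)
  next
    case False
    then have "\<kappa> \<xi> = return borel 1" by (simp add: \<kappa>_def)
    moreover have "AE r in return borel (1::real). 0 < r" by (subst AE_return) auto
    ultimately show ?thesis by metis
  qed
  have M\<kappa>: "(\<integral>\<^sup>+p. f p \<partial>M) = (\<integral>\<^sup>+\<xi>. (\<integral>\<^sup>+r. f (\<xi>, r) \<partial>\<kappa> \<xi>) \<partial>Qo)"
    if "f \<in> borel_measurable (N \<Otimes>\<^sub>M borel)" for f
  proof (rule nn_integral_disintegration[OF sM sQo \<kappa> _ that])
    fix C assume "C \<in> sets (N \<Otimes>\<^sub>M (borel :: real measure))"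
    from M0[OF this] show "emeasure M C = (\<integral>\<^sup>+\<xi>. emeasure (\<kappa> \<xi>) (Pair \<xi> -` C) \<partial>Qo)"
      using \<open>AE \<xi> in Qo. \<xi> \<in> B\<close> by (auto simp: \<kappa>_def intro!: nn_integral_cong_AE elim!: eventually_mono)
  qed
  \<comment> \<open>The radial parts must live on the open half-line. Restricting to it loses no
    mass, since \<open>\<kappa> \<xi>\<close> is concentrated there, and there \<open>w\<close> is
    positive, so that \<open>1 / w\<close> cancels it.\<close>
  define K where "K \<xi> = restrict_space (density (\<kappa> \<xi>) (\<lambda>r. ennreal (1 / w r))) {0<..}" for \<xi>
  have sK: "sets (K \<xi>) = sets (restrict_space borel {0<..})" if "\<xi> \<in> sphere 0 1" for \<xi>
    unfolding K_def using s\<kappa>[OF that] by (intro sets_restrict_space_cong) simp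
  have KI: "(\<integral>\<^sup>+r. f r \<partial>K \<xi>) = (\<integral>\<^sup>+r. ennreal (1 / w r) * f r \<partial>\<kappa> \<xi>)"
    if \<xi>: "\<xi> \<in> sphere 0 1" and [measurable]: "f \<in> borel_measurable borel" for f :: "real \<Rightarrow> ennreal" and \<xi>
  proof -
    have m: "g \<in> borel_measurable (\<kappa> \<xi>)" if "g \<in> borel_measurable borel" for g :: "real \<Rightarrow> ennreal"
      using that measurable_cong_sets[OF s\<kappa>[OF \<xi>] refl] by blast
    have "(\<integral>\<^sup>+r. f r \<partial>K \<xi>) = (\<integral>\<^sup>+r. ennreal (1 / w r) * (f r * indicator {0<..} r) \<partial>\<kappa> \<xi>)"
      unfolding K_def by (subst nn_integral_restrict_space) (auto simp: s\<kappa>[OF \<xi>] intro!: nn_integral_density m)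
    also have "\<dots> = (\<integral>\<^sup>+r. ennreal (1 / w r) * f r \<partial>\<kappa> \<xi>)"
      using pos[OF \<xi>] by (intro nn_integral_cong_AE) (auto elim!: eventually_mono)
    finally show ?thesis .
  qed
  have w\<kappa>: "(\<integral>\<^sup>+r. ennreal (w r) \<partial>K \<xi>) = 1" if \<xi>: "\<xi> \<in> sphere 0 1" for \<xi>
  proof -
    have "(\<integral>\<^sup>+r. ennreal (w r) \<partial>K \<xi>) = (\<integral>\<^sup>+r. 1 \<partial>\<kappa> \<xi>)"
      unfolding KI[OF \<xi> measurable_compose[OF w measurable_ennreal]] using pos[OF \<xi>]
      by (intro nn_integral_cong_AE)
         (auto elim!: eventually_mono simp: wi)
    then show ?thesis using prob_space.emeasure_space_1[OF p\<kappa>[OF \<xi>]] by simp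
  qed
  have "polar_decomposition Q Qo K"
    unfolding polar_decomposition_def
  proof (intro conjI ballI)
    show "finite_measure Qo" unfolding Qo_def by (rule M.finite_measure_distr) (simp add: measurable_cong_sets[OF sM refl])
    show "sets Qo = sets (restrict_space borel (sphere 0 1))" using sQo by (simp add: N_def)
    fix \<xi> :: "real^'n" assume \<xi>: "\<xi> \<in> sphere 0 1"
    show "sets (K \<xi>) = sets (restrict_space borel {0<..})" by (rule sK[OF \<xi>])
    have spK: "space (K \<xi>) = {0<..}" using sets_eq_imp_space_eq[OF sK[OF \<xi>]] by (simp add: space_restrict_space)
    have wK: "w \<in> borel_measurable (K \<xi>)"
      unfolding measurable_cong_sets[OF sK[OF \<xi>] refl] by (rule measurable_restrict_space1) measurable
    show "sigma_finite_measure (K \<xi>)"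
      by (rule sigma_finite_if_nn_integral_finite[OF wK]) (auto simp: w\<kappa>[OF \<xi>] spK wpos intro!: AE_I2)
    show "0 < emeasure (K \<xi>) {0<..}"
    proof (rule ccontr)
      assume "\<not> 0 < emeasure (K \<xi>) {0<..}"
      then have "emeasure (K \<xi>) (space (K \<xi>)) = 0" by (simp add: spK)
      then have "AE r in K \<xi>. False" by (simp add: AE_iff_null null_sets_def)
      then have "(\<integral>\<^sup>+r. ennreal (w r) \<partial>K \<xi>) = (\<integral>\<^sup>+r. 0 \<partial>K \<xi>)"
        by (intro nn_integral_cong_AE) auto
      then show False using w\<kappa>[OF \<xi>] by simp
    qed
  next
    fix B :: "real set" assume "B \<in> sets (restrict_space borel {0<..})"
    then have B[measurable]: "B \<in> sets borel" and B0: "B \<subseteq> {0<..}"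
      by (auto simp: sets_restrict_space_iff)
    have "emeasure (K \<xi>) B = (\<integral>\<^sup>+r. ennreal (1 / w r) * indicator B r \<partial>\<kappa> \<xi>)" if "\<xi> \<in> space N" for \<xi>
      using that B0 KI[of \<xi> "indicator B"] sK[of \<xi>] \<open>B \<in> sets (restrict_space borel {0<..})\<close> by (simp add: spN)
    moreover have "(\<lambda>\<xi>. \<integral>\<^sup>+r. ennreal (1 / w r) * indicator B r \<partial>\<kappa> \<xi>) \<in> borel_measurable Qo"
      by measurable
    ultimately show "(\<lambda>\<xi>. emeasure (K \<xi>) B) \<in> borel_measurable Qo"
      by (subst measurable_cong) (auto simp: sets_eq_imp_space_eq[OF sQo])
  next
    fix B :: "(real^'n) set" assume B[measurable]: "B \<in> sets borel"
    have [measurable]: "fst \<in> N \<Otimes>\<^sub>M borel \<rightarrow>\<^sub>M borel"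
      by (rule measurable_compose[OF measurable_fst idN])
    have fB[measurable]: "(\<lambda>p. ennreal (1 / w (snd p)) * indicator B (snd p *\<^sub>R fst p)) \<in> borel_measurable (N \<Otimes>\<^sub>M borel)"
      by measurable
    have [measurable]: "(\<lambda>y. ennreal (1 / w (norm y)) * indicator B (norm y *\<^sub>R u y)) \<in> borel_measurable borel"
      using measurable_compose[OF uD fB] measurable_cong_sets[OF sD refl] by simp
    have "emeasure Q B = (\<integral>\<^sup>+y. indicator B y \<partial>Q)" by (simp add: sQ)
    also have "\<dots> = (\<integral>\<^sup>+y. ennreal (w (norm y)) * (ennreal (1 / w (norm y)) * indicator B (norm y *\<^sub>R u y)) \<partial>Q)"
    proof (rule nn_integral_cong_AE, use AE0 in eventually_elim)
      fix y :: "real^'n" assume "y \<noteq> 0"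
      then show "indicator B y = ennreal (w (norm y)) * (ennreal (1 / w (norm y)) * indicator B (norm y *\<^sub>R u y))"
        by (simp add: u_def wi mult.assoc[symmetric])
    qed
    also have "\<dots> = (\<integral>\<^sup>+y. ennreal (1 / w (norm y)) * indicator B (norm y *\<^sub>R u y) \<partial>D)"
      unfolding D_def by (subst nn_integral_density) (auto simp: measurable_cong_sets[OF sQ refl])
    also have "\<dots> = (\<integral>\<^sup>+p. ennreal (1 / w (snd p)) * indicator B (snd p *\<^sub>R fst p) \<partial>M)"
      unfolding M_def by (subst nn_integral_distr[OF uD]) auto
    also have "\<dots> = (\<integral>\<^sup>+\<xi>. (\<integral>\<^sup>+r. ennreal (1 / w r) * indicator B (r *\<^sub>R \<xi>) \<partial>\<kappa> \<xi>) \<partial>Qo)"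
      by (subst M\<kappa>) auto
    also have "\<dots> = (\<integral>\<^sup>+\<xi>. (\<integral>\<^sup>+r. indicator B (r *\<^sub>R \<xi>) \<partial>K \<xi>) \<partial>Qo)"
      by (intro nn_integral_cong) (auto simp: KI sets_eq_imp_space_eq[OF sQo] spN)
    finally show "emeasure Q B = (\<integral>\<^sup>+\<xi>. (\<integral>\<^sup>+r. indicator B (r *\<^sub>R \<xi>) \<partial>K \<xi>) \<partial>Qo)" .
  qed
  then show ?thesis using w\<kappa> by (intro exI[of _ Qo] exI[of _ K]) auto
qed

section \<open>Integration in polar coordinates\<close>

text \<open>The direction enters twice, through the measure \<open>K \<xi>\<close> and through the
  integrand. A polar decomposition grants measurability only for fixed sets of radii, and
  \<open>K \<xi>\<close> may have infinite mass. Weighting by \<open>w\<close> and dividing by the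
  total mass \<open>c \<xi>\<close>, which is finite by \<open>fin\<close> and positive because
  \<open>K \<xi>\<close> is nonzero, gives a probability kernel, against which jointly measurable
  integrands have measurable integrals. Multiplying by \<open>c \<xi>\<close> and dividing by
  \<open>w\<close> restores the original integral.\<close>

lemma polar_kernel_measurable:
  fixes Q :: "(real^'n::finite) measure" and w :: "real \<Rightarrow> real" and F :: "real^'n \<Rightarrow> ennreal"
  assumes pd: "polar_decomposition Q Qo K"
    and w[measurable]: "w \<in> borel_measurable borel" and wpos: "\<And>r. 0 < r \<Longrightarrow> 0 < w r"
    and fin: "\<And>\<xi>. \<xi> \<in> sphere 0 1 \<Longrightarrow> (\<integral>\<^sup>+r. ennreal (w r) \<partial>K \<xi>) < \<infinity>"
    and F[measurable]: "F \<in> borel_measurable borel"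
  shows "(\<lambda>\<xi>. \<integral>\<^sup>+r. F (r *\<^sub>R \<xi>) \<partial>K \<xi>) \<in> borel_measurable Qo"
proof -
  define R where "R = restrict_space (borel :: real measure) {0<..}"
  have spR: "space R = {0<..}" by (simp add: R_def space_restrict_space)
  have idR: "(\<lambda>r. r) \<in> R \<rightarrow>\<^sub>M borel" unfolding R_def by (rule measurable_restrict_space1) simp
  have sQo: "sets Qo = sets (restrict_space borel (sphere 0 1))"
    using pd by (simp add: polar_decomposition_def)
  have spQo: "space Qo = sphere 0 1" using sets_eq_imp_space_eq[OF sQo] by (simp add: space_restrict_space)
  have idQo: "(\<lambda>\<xi>. \<xi>) \<in> Qo \<rightarrow>\<^sub>M borel"
    unfolding measurable_cong_sets[OF sQo refl] by (rule measurable_restrict_space1) simp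
  have sK: "sets (K \<xi>) = sets R" if "\<xi> \<in> sphere 0 1" for \<xi>
    using pd that by (simp add: polar_decomposition_def R_def)
  have mK: "g \<in> borel_measurable (K \<xi>)" if "g \<in> borel_measurable R" "\<xi> \<in> sphere 0 1" for g :: "real \<Rightarrow> ennreal" and \<xi>
    using that measurable_cong_sets[OF sK refl] by blast
  have posK: "emeasure (K \<xi>) {0<..} > 0" if "\<xi> \<in> sphere 0 1" for \<xi>
    using pd that by (simp add: polar_decomposition_def)
  have K_meas: "(\<lambda>\<xi>. emeasure (K \<xi>) A) \<in> borel_measurable Qo" if "A \<in> sets R" for A
    using pd that unfolding polar_decomposition_def R_def by blast
  have mc: "f \<in> borel_measurable Qo" if "\<And>\<xi>. \<xi> \<in> space Qo \<Longrightarrow> f \<xi> = g \<xi>" "g \<in> borel_measurable Qo"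
    for f g :: "real^'n \<Rightarrow> ennreal"
    using that measurable_cong[of Qo f g borel] by blast
  have int: "(\<lambda>\<xi>. \<integral>\<^sup>+r. g r \<partial>K \<xi>) \<in> borel_measurable Qo" if "g \<in> borel_measurable R" for g
    using that
  proof (induction rule: borel_measurable_induct)
    case (cong f g)
    have eq: "(\<integral>\<^sup>+r. f r \<partial>K \<xi>) = (\<integral>\<^sup>+r. g r \<partial>K \<xi>)" if "\<xi> \<in> space Qo" for \<xi>
      using cong that by (intro nn_integral_cong) (auto simp: spQo sets_eq_imp_space_eq[OF sK])
    show ?case by (rule mc, erule eq) (rule cong.IH)
  next
    case (set A)
    have eq: "(\<integral>\<^sup>+r. indicator A r \<partial>K \<xi>) = emeasure (K \<xi>) A" if "\<xi> \<in> space Qo" for \<xi>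
      using set that by (simp add: spQo sK)
    show ?case by (rule mc, erule eq) (rule K_meas[OF set])
  next
    case (mult u c)
    have eq: "(\<integral>\<^sup>+r. c * u r \<partial>K \<xi>) = c * (\<integral>\<^sup>+r. u r \<partial>K \<xi>)" if "\<xi> \<in> space Qo" for \<xi>
      using mult that by (intro nn_integral_cmult mK) (auto simp: spQo)
    show ?case by (rule mc, erule eq) (intro borel_measurable_times_ennreal borel_measurable_const mult.IH)
  next
    case (add u v)
    have eq: "(\<integral>\<^sup>+r. v r + u r \<partial>K \<xi>) = (\<integral>\<^sup>+r. v r \<partial>K \<xi>) + (\<integral>\<^sup>+r. u r \<partial>K \<xi>)" if "\<xi> \<in> space Qo" for \<xi>
      using add that by (intro nn_integral_add mK) (auto simp: spQo)
    show ?case by (rule mc, erule eq) (intro borel_measurable_add add.IH)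
  next
    case (seq U)
    have eq: "(\<integral>\<^sup>+r. (SUP i. U i) r \<partial>K \<xi>) = (SUP i. \<integral>\<^sup>+r. U i r \<partial>K \<xi>)" if "\<xi> \<in> space Qo" for \<xi>
      unfolding Sup_apply image_image using seq that
      by (intro nn_integral_monotone_convergence_SUP mK) (auto simp: spQo)
    show ?case by (rule mc, erule eq) (intro borel_measurable_SUP countableI_type seq.IH)
  qed
  have wR: "(\<lambda>r. ennreal (w r)) \<in> borel_measurable R"
    using measurable_compose[OF idR w] by simp
  define c where "c \<xi> = enn2real (\<integral>\<^sup>+r. ennreal (w r) \<partial>K \<xi>)" for \<xi>
  have [measurable]: "c \<in> borel_measurable Qo" unfolding c_def using int[OF wR] by simp
  have c: "(\<integral>\<^sup>+r. ennreal (w r) \<partial>K \<xi>) = ennreal (c \<xi>)" "0 < c \<xi>" if \<xi>: "\<xi> \<in> sphere 0 1" for \<xi>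
  proof -
    show eq: "(\<integral>\<^sup>+r. ennreal (w r) \<partial>K \<xi>) = ennreal (c \<xi>)"
      unfolding c_def using fin[OF \<xi>] by simp
    have "(\<integral>\<^sup>+r. ennreal (w r) \<partial>K \<xi>) \<noteq> 0"
    proof
      assume "(\<integral>\<^sup>+r. ennreal (w r) \<partial>K \<xi>) = 0"
      then have "AE r in K \<xi>. ennreal (w r) = 0"
        using mK[OF wR \<xi>] by (simp add: nn_integral_0_iff_AE)
      then have "AE r in K \<xi>. False"
        using AE_space by eventually_elim (use wpos in \<open>force simp: sets_eq_imp_space_eq[OF sK[OF \<xi>]] spR ennreal_eq_0_iff\<close>)
      then have "emeasure (K \<xi>) (space (K \<xi>)) = 0" by (simp add: AE_iff_null null_sets_def)
      then show False using posK[OF \<xi>] by (simp add: sets_eq_imp_space_eq[OF sK[OF \<xi>]] spR)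
    qed
    then show "0 < c \<xi>" unfolding eq by (simp add: ennreal_eq_0_iff)
  qed
  define \<kappa> where "\<kappa> \<xi> = density (K \<xi>) (\<lambda>r. ennreal (1 / c \<xi>) * ennreal (w r))" for \<xi>
  have \<kappa>A: "emeasure (\<kappa> \<xi>) A = ennreal (1 / c \<xi>) * (\<integral>\<^sup>+r. ennreal (w r) * indicator A r \<partial>K \<xi>)"
    if \<xi>: "\<xi> \<in> sphere 0 1" and A: "A \<in> sets R" for \<xi> A
  proof -
    have mw: "(\<lambda>r. ennreal (w r)) \<in> borel_measurable (K \<xi>)" by (rule mK[OF wR \<xi>])
    have "emeasure (\<kappa> \<xi>) A = (\<integral>\<^sup>+r. ennreal (1 / c \<xi>) * (ennreal (w r) * indicator A r) \<partial>K \<xi>)"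
      unfolding \<kappa>_def using A mw by (subst emeasure_density) (auto simp: sK[OF \<xi>] mult.assoc)
    also have "\<dots> = ennreal (1 / c \<xi>) * (\<integral>\<^sup>+r. ennreal (w r) * indicator A r \<partial>K \<xi>)"
      using A wR by (intro nn_integral_cmult mK[OF _ \<xi>]) auto
    finally show ?thesis .
  qed
  have \<kappa>: "\<kappa> \<in> Qo \<rightarrow>\<^sub>M subprob_algebra R"
  proof (rule measurable_subprob_algebra)
    fix \<xi> assume "\<xi> \<in> space Qo"
    then have \<xi>: "\<xi> \<in> sphere 0 1" by (simp add: spQo)
    show s: "sets (\<kappa> \<xi>) = sets R" by (simp add: \<kappa>_def sK[OF \<xi>])
    have "(\<integral>\<^sup>+r. ennreal (w r) * indicator {0<..} r \<partial>K \<xi>) = ennreal (c \<xi>)"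
      unfolding c(1)[OF \<xi>, symmetric]
      by (intro nn_integral_cong) (auto simp: sets_eq_imp_space_eq[OF sK[OF \<xi>]] spR)
    then have "emeasure (\<kappa> \<xi>) {0<..} = ennreal (1 / c \<xi>) * ennreal (c \<xi>)"
      using sets.top[of R] by (subst \<kappa>A[OF \<xi>]) (auto simp: spR)
    also have "\<dots> = 1" using c(2)[OF \<xi>] by (subst ennreal_mult[symmetric]) auto
    finally show "subprob_space (\<kappa> \<xi>)"
      by (intro subprob_spaceI) (auto simp: sets_eq_imp_space_eq[OF s] spR)
  next
    fix A assume A: "A \<in> sets R"
    have m: "(\<lambda>\<xi>. ennreal (1 / c \<xi>) * (\<integral>\<^sup>+r. ennreal (w r) * indicator A r \<partial>K \<xi>)) \<in> borel_measurable Qo"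
      using A wR by (intro borel_measurable_times_ennreal int) auto
    have eq: "emeasure (\<kappa> \<xi>) A = ennreal (1 / c \<xi>) * (\<integral>\<^sup>+r. ennreal (w r) * indicator A r \<partial>K \<xi>)" if "\<xi> \<in> space Qo" for \<xi>
      using \<kappa>A[OF _ A] that unfolding spQo by blast
    show "(\<lambda>\<xi>. emeasure (\<kappa> \<xi>) A) \<in> borel_measurable Qo"
      by (rule mc, erule eq, rule m)
  qed
  have m1: "(\<lambda>r. F (r *\<^sub>R \<xi>)) \<in> borel_measurable R" "(\<lambda>r. ennreal (1 / w r) * F (r *\<^sub>R \<xi>)) \<in> borel_measurable R" for \<xi>
    by (rule measurable_compose[OF idR], measurable)+
  have eq: "(\<integral>\<^sup>+r. F (r *\<^sub>R \<xi>) \<partial>K \<xi>) = ennreal (c \<xi>) * (\<integral>\<^sup>+r. ennreal (1 / w r) * F (r *\<^sub>R \<xi>) \<partial>\<kappa> \<xi>)"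
    if \<xi>: "\<xi> \<in> sphere 0 1" for \<xi>
  proof -
    have "ennreal (c \<xi>) * (\<integral>\<^sup>+r. ennreal (1 / w r) * F (r *\<^sub>R \<xi>) \<partial>\<kappa> \<xi>)
        = ennreal (c \<xi>) * (\<integral>\<^sup>+r. (ennreal (1 / c \<xi>) * ennreal (w r)) * (ennreal (1 / w r) * F (r *\<^sub>R \<xi>)) \<partial>K \<xi>)"
      unfolding \<kappa>_def using wR by (subst nn_integral_density) (auto intro!: mK[OF _ \<xi>] m1)
    also have "\<dots> = (\<integral>\<^sup>+r. ennreal (c \<xi>) * ((ennreal (1 / c \<xi>) * ennreal (w r)) * (ennreal (1 / w r) * F (r *\<^sub>R \<xi>))) \<partial>K \<xi>)"
      using wR m1 by (intro nn_integral_cmult[symmetric] mK[OF _ \<xi>]) auto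
    also have "\<dots> = (\<integral>\<^sup>+r. F (r *\<^sub>R \<xi>) \<partial>K \<xi>)"
    proof (rule nn_integral_cong)
      fix r assume "r \<in> space (K \<xi>)"
      then have "0 < w r" by (intro wpos) (simp add: sets_eq_imp_space_eq[OF sK[OF \<xi>]] spR)
      then have "ennreal (c \<xi>) * ennreal (1 / c \<xi>) = 1" "ennreal (w r) * ennreal (1 / w r) = 1"
        using c(2)[OF \<xi>] by (auto simp flip: ennreal_mult)
      then show "ennreal (c \<xi>) * ((ennreal (1 / c \<xi>) * ennreal (w r)) * (ennreal (1 / w r) * F (r *\<^sub>R \<xi>))) = F (r *\<^sub>R \<xi>)"
        by (simp only: mult.assoc[symmetric] mult_1_left)
    qed
    finally show ?thesis by simp
  qed
  have m: "(\<lambda>\<xi>. \<integral>\<^sup>+r. ennreal (1 / w r) * F (r *\<^sub>R \<xi>) \<partial>\<kappa> \<xi>) \<in> borel_measurable Qo"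
  proof (rule nn_integral_measurable_subprob_algebra2[OF _ \<kappa>])
    have m2: "(\<lambda>p. ennreal (1 / w (snd p)) * F (snd p *\<^sub>R fst p)) \<in> borel_measurable (borel \<Otimes>\<^sub>M borel)"
      by measurable
    have "(\<lambda>p. (fst p, snd p)) \<in> Qo \<Otimes>\<^sub>M R \<rightarrow>\<^sub>M borel \<Otimes>\<^sub>M borel"
      by (intro measurable_Pair measurable_compose[OF measurable_fst idQo] measurable_compose[OF measurable_snd idR])
    from measurable_compose[OF this m2]
    show "(\<lambda>(\<xi>, r). ennreal (1 / w r) * F (r *\<^sub>R \<xi>)) \<in> borel_measurable (Qo \<Otimes>\<^sub>M R)"
      by (simp add: split_beta')
  qed
  show ?thesis
    by (rule mc, rule eq) (use m in \<open>simp_all add: spQo\<close>)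
qed

text \<open>For indicators this is the defining identity of a polar decomposition. The weight
  \<open>w\<close> serves to make the inner integrals measurable in the direction, which additivity
  and monotone convergence over \<open>Qo\<close> require.\<close>

lemma polar_nn_integral:
  fixes Q :: "(real^'n::finite) measure" and w :: "real \<Rightarrow> real" and F :: "real^'n \<Rightarrow> ennreal"
  assumes pd: "polar_decomposition Q Qo K" and sQ: "sets Q = sets borel"
    and w[measurable]: "w \<in> borel_measurable borel" and wpos: "\<And>r. 0 < r \<Longrightarrow> 0 < w r"
    and fin: "\<And>\<xi>. \<xi> \<in> sphere 0 1 \<Longrightarrow> (\<integral>\<^sup>+r. ennreal (w r) \<partial>K \<xi>) < \<infinity>"
    and F: "F \<in> borel_measurable borel"
  shows "(\<integral>\<^sup>+y. F y \<partial>Q) = (\<integral>\<^sup>+\<xi>. (\<integral>\<^sup>+r. F (r *\<^sub>R \<xi>) \<partial>K \<xi>) \<partial>Qo)"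
  using F
proof (induction rule: borel_measurable_induct)
  have sQo: "sets Qo = sets (restrict_space borel (sphere 0 1))"
    using pd by (simp add: polar_decomposition_def)
  have spQo: "space Qo = sphere 0 1" using sets_eq_imp_space_eq[OF sQo] by (simp add: space_restrict_space)
  note mQo = polar_kernel_measurable[OF pd w wpos fin]
  have mK: "(\<lambda>r. f (r *\<^sub>R \<xi>)) \<in> borel_measurable (K \<xi>)"
    if [measurable]: "f \<in> borel_measurable borel" and "\<xi> \<in> space Qo" for f :: "real^'n \<Rightarrow> ennreal" and \<xi>
  proof -
    have sK: "sets (K \<xi>) = sets (restrict_space borel {0<..})"
      using pd that by (simp add: polar_decomposition_def spQo)
    show ?thesis unfolding measurable_cong_sets[OF sK refl]
      by (rule measurable_restrict_space1) measurable
  qed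
  have mQ: "f \<in> borel_measurable Q" if "f \<in> borel_measurable borel" for f :: "real^'n \<Rightarrow> ennreal"
    using that measurable_cong_sets[OF sQ refl] by blast
  {
    case (cong f g)
    then have "f = g" by auto
    with cong show ?case by simp
  next
    case (set A)
    then show ?case using pd by (simp add: polar_decomposition_def sQ)
  next
    case (mult u c)
    have "(\<integral>\<^sup>+\<xi>. (\<integral>\<^sup>+r. c * u (r *\<^sub>R \<xi>) \<partial>K \<xi>) \<partial>Qo) = (\<integral>\<^sup>+\<xi>. c * (\<integral>\<^sup>+r. u (r *\<^sub>R \<xi>) \<partial>K \<xi>) \<partial>Qo)"
      using mult by (intro nn_integral_cong nn_integral_cmult mK)
    with mult mQo[OF _ _ mult(2)] show ?case
      by (simp add: nn_integral_cmult mQ)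
  next
    case (add u v)
    have "(\<integral>\<^sup>+\<xi>. (\<integral>\<^sup>+r. v (r *\<^sub>R \<xi>) + u (r *\<^sub>R \<xi>) \<partial>K \<xi>) \<partial>Qo)
        = (\<integral>\<^sup>+\<xi>. (\<integral>\<^sup>+r. v (r *\<^sub>R \<xi>) \<partial>K \<xi>) + (\<integral>\<^sup>+r. u (r *\<^sub>R \<xi>) \<partial>K \<xi>) \<partial>Qo)"
      using add by (intro nn_integral_cong nn_integral_add mK)
    with add mQo[OF _ _ add(1)] mQo[OF _ _ add(3)] show ?case
      by (simp add: nn_integral_add mQ)
  next
    case (seq U)
    have "(\<integral>\<^sup>+p. (SUP i. U i) p \<partial>Q) = (SUP i. \<integral>\<^sup>+p. U i p \<partial>Q)"
      unfolding Sup_apply image_image using seq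
      by (intro nn_integral_monotone_convergence_SUP) (auto simp: mQ)
    also have "\<dots> = (SUP i. \<integral>\<^sup>+\<xi>. (\<integral>\<^sup>+r. U i (r *\<^sub>R \<xi>) \<partial>K \<xi>) \<partial>Qo)" using seq by simp
    also have "\<dots> = (\<integral>\<^sup>+\<xi>. (SUP i. \<integral>\<^sup>+r. U i (r *\<^sub>R \<xi>) \<partial>K \<xi>) \<partial>Qo)"
      using seq by (intro nn_integral_monotone_convergence_SUP[symmetric] mQo)
        (auto simp: incseq_def le_fun_def intro!: nn_integral_mono)
    also have "\<dots> = (\<integral>\<^sup>+\<xi>. (\<integral>\<^sup>+r. (SUP i. U i (r *\<^sub>R \<xi>)) \<partial>K \<xi>) \<partial>Qo)"
      using seq by (intro nn_integral_cong nn_integral_monotone_convergence_SUP[symmetric])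
        (auto simp: incseq_def le_fun_def intro!: mK)
    finally show ?case using seq by (simp add: Sup_apply image_image)
  }
qed

section \<open>Integrated tails\<close>

text \<open>The weight \<open>\<psi> = 1\<close> gives the integrated tail, \<open>\<psi> r z = r - z\<close> the double-integrated one.\<close>

definition ray_measure :: "(real \<Rightarrow> real \<Rightarrow> ennreal) \<Rightarrow> (real^'n::finite) measure \<Rightarrow> (real^'n) measure" where
  "ray_measure \<psi> Q = distr
     (density (Q \<Otimes>\<^sub>M lborel) (\<lambda>p. \<psi> (norm (fst p)) (snd p) * indicator {0<..<norm (fst p)} (snd p)))
     borel (\<lambda>p. snd p *\<^sub>R sgn (fst p))"

lemma borel_measurable_sgn_vec[measurable]:
  "(sgn :: real^'n::finite \<Rightarrow> real^'n) \<in> borel_measurable borel"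
  unfolding sgn_div_norm[abs_def] by measurable

text \<open>Lets measurability be proved automatically for indicators of intervals whose endpoints
  vary with the argument, as in \<open>ray_measure\<close>.\<close>

lemma pred_greaterThanLessThan[measurable (raw)]:
  fixes f g h :: "'a \<Rightarrow> real"
  assumes [measurable]: "f \<in> borel_measurable M" "g \<in> borel_measurable M" "h \<in> borel_measurable M"
  shows "Measurable.pred M (\<lambda>x. f x \<in> {g x<..<h x})"
  by simp

text \<open>Change of variables followed by Tonelli's theorem. The Lebesgue coordinate is the inner
  one, so sigma-finiteness of \<open>lborel\<close> is enough and \<open>Q\<close> may be any Borel
  measure.\<close>

lemma nn_integral_ray_measure:
  fixes Q :: "(real^'n::finite) measure"
  assumes sQ: "sets Q = sets borel"
    and \<psi>: "(\<lambda>p. \<psi> (fst p) (snd p)) \<in> borel_measurable (borel \<Otimes>\<^sub>M borel)"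
    and f: "f \<in> borel_measurable borel"
  shows "(\<integral>\<^sup>+y. f y \<partial>ray_measure \<psi> Q)
    = (\<integral>\<^sup>+y. (\<integral>\<^sup>+z. \<psi> (norm y) z * indicator {0<..<norm y} z * f (z *\<^sub>R sgn y) \<partial>lborel) \<partial>Q)"
proof -
  have s: "sets (Q \<Otimes>\<^sub>M (lborel :: real measure)) = sets (borel \<Otimes>\<^sub>M borel)" using sQ by (intro sets_pair_measure_cong) auto
  have m: "g \<in> borel_measurable (Q \<Otimes>\<^sub>M lborel)" if "g \<in> borel_measurable (borel \<Otimes>\<^sub>M borel)" for g :: "(real^'n) \<times> real \<Rightarrow> ennreal"
    using that measurable_cong_sets[OF s refl] by blast
  have [measurable]: "(\<lambda>p. \<psi> (norm (fst p :: real^'n)) (snd p)) \<in> borel_measurable (borel \<Otimes>\<^sub>M borel)"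
  proof -
    have "(\<lambda>p. (norm (fst p :: real^'n), snd p)) \<in> borel \<Otimes>\<^sub>M borel \<rightarrow>\<^sub>M borel \<Otimes>\<^sub>M borel" by measurable
    from measurable_compose[OF this \<psi>] show ?thesis by simp
  qed
  note f[measurable]
  have T: "(\<lambda>p. snd p *\<^sub>R sgn (fst p)) \<in> Q \<Otimes>\<^sub>M lborel \<rightarrow>\<^sub>M (borel :: (real^'n) measure)"
    unfolding measurable_cong_sets[OF s refl] by measurable
  have mw: "(\<lambda>p. \<psi> (norm (fst p :: real^'n)) (snd p) * indicator {0<..<norm (fst p)} (snd p)) \<in> borel_measurable (Q \<Otimes>\<^sub>M lborel)"
    by (rule m) measurable
  have mwf: "(\<lambda>p. \<psi> (norm (fst p :: real^'n)) (snd p) * indicator {0<..<norm (fst p)} (snd p) * f (snd p *\<^sub>R sgn (fst p))) \<in> borel_measurable (Q \<Otimes>\<^sub>M lborel)"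
    by (rule m) measurable
  have "(\<integral>\<^sup>+y. f y \<partial>ray_measure \<psi> Q)
      = (\<integral>\<^sup>+p. \<psi> (norm (fst p)) (snd p) * indicator {0<..<norm (fst p)} (snd p) * f (snd p *\<^sub>R sgn (fst p)) \<partial>(Q \<Otimes>\<^sub>M lborel))"
    unfolding ray_measure_def using T mw measurable_compose[OF T f]
    by (subst nn_integral_distr) (auto simp: nn_integral_density f)
  also have "\<dots> = (\<integral>\<^sup>+y. (\<integral>\<^sup>+z. \<psi> (norm y) z * indicator {0<..<norm y} z * f (z *\<^sub>R sgn y) \<partial>lborel) \<partial>Q)"
    using lborel.nn_integral_fst[OF mwf] by simp
  finally show ?thesis .
qed

lemma sets_ray_measure[simp]: "sets (ray_measure \<psi> Q) = sets borel"
  and space_ray_measure[simp]: "space (ray_measure \<psi> Q) = UNIV"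
  by (simp_all add: ray_measure_def)

text \<open>The left-hand side knows nothing of \<open>Qo\<close> and \<open>K\<close>, so the
  formula contains the independence of the tails from the choice. At
  \<open>y = r *\<^sub>R \<xi>\<close> the condition on the height is \<open>0 < z < r\<close>;
  after exchanging the integrals over \<open>r\<close> and \<open>z\<close>, its first half
  restricts the outer integral and its second half becomes the tail \<open>{z<..}\<close>.\<close>

lemma emeasure_ray_measure_polar:
  fixes Q :: "(real^'n::finite) measure" and w :: "real \<Rightarrow> real"
  assumes pd: "polar_decomposition Q Qo K" and sQ: "sets Q = sets borel"
    and w[measurable]: "w \<in> borel_measurable borel" and wpos: "\<And>r. 0 < r \<Longrightarrow> 0 < w r"
    and fin: "\<And>\<xi>. \<xi> \<in> sphere 0 1 \<Longrightarrow> (\<integral>\<^sup>+r. ennreal (w r) \<partial>K \<xi>) < \<infinity>"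
    and \<psi>[measurable]: "(\<lambda>p. \<psi> (fst p) (snd p)) \<in> borel_measurable (borel \<Otimes>\<^sub>M borel)"
    and B[measurable]: "B \<in> sets borel"
  shows "emeasure (ray_measure \<psi> Q) B = (\<integral>\<^sup>+\<xi>. (\<integral>\<^sup>+z\<in>{0<..}. indicator B (z *\<^sub>R \<xi>)
            * (\<integral>\<^sup>+r. \<psi> r z * indicator {z<..} r \<partial>K \<xi>) \<partial>lborel) \<partial>Qo)"
proof -
  have sQo: "sets Qo = sets (restrict_space borel (sphere 0 1))"
    using pd by (simp add: polar_decomposition_def)
  have spQo: "space Qo = sphere 0 1" using sets_eq_imp_space_eq[OF sQo] by (simp add: space_restrict_space)
  define F where "F y = (\<integral>\<^sup>+z. \<psi> (norm y) z * indicator {0<..<norm y} z * indicator B (z *\<^sub>R sgn y) \<partial>lborel)" for y :: "real^'n"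
  have [measurable]: "(\<lambda>p. \<psi> (norm (fst p :: real^'n)) (snd p)) \<in> borel_measurable (borel \<Otimes>\<^sub>M borel)"
  proof -
    have "(\<lambda>p. (norm (fst p :: real^'n), snd p)) \<in> borel \<Otimes>\<^sub>M borel \<rightarrow>\<^sub>M borel \<Otimes>\<^sub>M borel" by measurable
    from measurable_compose[OF this \<psi>] show ?thesis by simp
  qed
  have mF: "F \<in> borel_measurable borel"
  proof -
    have "(\<lambda>p. \<psi> (norm (fst p :: real^'n)) (snd p) * indicator {0<..<norm (fst p)} (snd p) * indicator B (snd p *\<^sub>R sgn (fst p)))
      \<in> borel_measurable (borel \<Otimes>\<^sub>M lborel)"
      unfolding measurable_cong_sets[OF sets_pair_measure_cong[OF refl sets_lborel] refl] by measurable
    from lborel.borel_measurable_nn_integral_fst[OF this] show ?thesis by (simp add: F_def[abs_def])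
  qed
  have "emeasure (ray_measure \<psi> Q) B = (\<integral>\<^sup>+y. indicator B y \<partial>ray_measure \<psi> Q)" by simp
  also have "\<dots> = (\<integral>\<^sup>+y. F y \<partial>Q)"
    unfolding F_def by (rule nn_integral_ray_measure[OF sQ \<psi>]) simp
  also have "\<dots> = (\<integral>\<^sup>+\<xi>. (\<integral>\<^sup>+r. F (r *\<^sub>R \<xi>) \<partial>K \<xi>) \<partial>Qo)"
    by (rule polar_nn_integral[OF pd sQ w wpos fin mF])
  also have "\<dots> = (\<integral>\<^sup>+\<xi>. (\<integral>\<^sup>+z\<in>{0<..}. indicator B (z *\<^sub>R \<xi>)
            * (\<integral>\<^sup>+r. \<psi> r z * indicator {z<..} r \<partial>K \<xi>) \<partial>lborel) \<partial>Qo)"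
  proof (rule nn_integral_cong)
    fix \<xi> assume "\<xi> \<in> space Qo"
    then have \<xi>: "\<xi> \<in> sphere 0 1" "norm \<xi> = 1" by (auto simp: spQo)
    have sK: "sets (K \<xi>) = sets (restrict_space borel {0<..})" and "sigma_finite_measure (K \<xi>)"
      using pd \<xi> by (auto simp: polar_decomposition_def)
    then interpret K: sigma_finite_measure "K \<xi>" by simp
    interpret pair_sigma_finite "K \<xi>" lborel ..
    have spK: "space (K \<xi>) = {0<..}" using sets_eq_imp_space_eq[OF sK] by (simp add: space_restrict_space)
    have idK: "(\<lambda>r. r) \<in> K \<xi> \<rightarrow>\<^sub>M borel"
      unfolding measurable_cong_sets[OF sK refl] by (rule measurable_restrict_space1) simp
    have snd: "snd \<in> K \<xi> \<Otimes>\<^sub>M lborel \<rightarrow>\<^sub>M (borel :: real measure)"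
      using measurable_snd[of "K \<xi>" lborel] by (simp add: measurable_cong_sets[OF refl sets_lborel])
    have G0: "(\<lambda>p. \<psi> (fst p) (snd p) * indicator {0<..<fst p} (snd p) * indicator B (snd p *\<^sub>R \<xi>)) \<in> borel_measurable (borel \<Otimes>\<^sub>M borel)"
      by measurable
    have "(\<lambda>p. (fst p, snd p)) \<in> K \<xi> \<Otimes>\<^sub>M (lborel :: real measure) \<rightarrow>\<^sub>M borel \<Otimes>\<^sub>M borel"
      by (intro measurable_Pair measurable_compose[OF measurable_fst idK] snd)
    from measurable_compose[OF this G0]
    have G: "(\<lambda>(r, z). \<psi> r z * indicator {0<..<r} z * indicator B (z *\<^sub>R \<xi>)) \<in> borel_measurable (K \<xi> \<Otimes>\<^sub>M lborel)"
      by (simp add: split_beta')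
    have mr: "(\<lambda>r. \<psi> r z * indicator {z<..} r) \<in> borel_measurable (K \<xi>)" for z
    proof -
      have "(\<lambda>r. \<psi> r z) \<in> borel_measurable borel"
        using measurable_compose[OF _ \<psi>, of "\<lambda>r. (r, z)" borel] by simp
      then have "(\<lambda>r. \<psi> r z * indicator {z<..} r) \<in> borel_measurable borel" by measurable
      from measurable_compose[OF idK this] show ?thesis by simp
    qed
    have "(\<integral>\<^sup>+r. F (r *\<^sub>R \<xi>) \<partial>K \<xi>) = (\<integral>\<^sup>+r. (\<integral>\<^sup>+z. \<psi> r z * indicator {0<..<r} z * indicator B (z *\<^sub>R \<xi>) \<partial>lborel) \<partial>K \<xi>)"
      by (intro nn_integral_cong) (simp add: F_def spK sgn_div_norm \<xi>(2))
    also have "\<dots> = (\<integral>\<^sup>+z. (\<integral>\<^sup>+r. \<psi> r z * indicator {0<..<r} z * indicator B (z *\<^sub>R \<xi>) \<partial>K \<xi>) \<partial>lborel)"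
      by (rule Fubini'[OF G, symmetric])
    also have "\<dots> = (\<integral>\<^sup>+z\<in>{0<..}. indicator B (z *\<^sub>R \<xi>) * (\<integral>\<^sup>+r. \<psi> r z * indicator {z<..} r \<partial>K \<xi>) \<partial>lborel)"
    proof (rule nn_integral_cong)
      fix z :: real
      have "(\<integral>\<^sup>+r. \<psi> r z * indicator {0<..<r} z * indicator B (z *\<^sub>R \<xi>) \<partial>K \<xi>)
        = (\<integral>\<^sup>+r. (indicator B (z *\<^sub>R \<xi>) * indicator {0<..} z) * (\<psi> r z * indicator {z<..} r) \<partial>K \<xi>)"
        by (intro nn_integral_cong) (auto split: split_indicator)
      also have "\<dots> = (indicator B (z *\<^sub>R \<xi>) * indicator {0<..} z) * (\<integral>\<^sup>+r. \<psi> r z * indicator {z<..} r \<partial>K \<xi>)"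
        by (rule nn_integral_cmult[OF mr])
      finally show "(\<integral>\<^sup>+r. \<psi> r z * indicator {0<..<r} z * indicator B (z *\<^sub>R \<xi>) \<partial>K \<xi>)
        = indicator B (z *\<^sub>R \<xi>) * (\<integral>\<^sup>+r. \<psi> r z * indicator {z<..} r \<partial>K \<xi>) * indicator {0<..} z"
        by (simp add: mult_ac)
    qed
    finally show "(\<integral>\<^sup>+r. F (r *\<^sub>R \<xi>) \<partial>K \<xi>) = \<dots>" .
  qed
  finally show ?thesis .
qed

text \<open>\<open>measure_of\<close> falls back to the zero measure unless its set function is
  countably additive. Exhibiting a measure \<open>R\<close> with the same values supplies the
  additivity, so it need not be verified for the iterated integrals that define the tails.\<close>

lemma measure_of_eqI:
  assumes "space R = \<Omega>" "sets R = S" "\<And>B. B \<in> S \<Longrightarrow> emeasure R B = \<mu> B"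
  shows "measure_of \<Omega> S \<mu> = R"
proof -
  have "measure_of \<Omega> S \<mu> = measure_of (space R) (sets R) (emeasure R)"
    unfolding assms(1)[symmetric] assms(2)[symmetric]
    by (rule measure_of_eq[OF sets.space_closed]) (use assms sets.sigma_sets_eq[of R] in auto)
  then show ?thesis by (simp add: measure_of_of_measure)
qed

text \<open>Existence with the weight \<open>min 1 (r\<^sup>2)\<close> makes the choice meaningful.
  Whichever decomposition is chosen, its radial condition is the hypothesis on the weight under
  which ray measures are computed in polar coordinates.\<close>

lemma integrated_tail_eq:
  fixes Q :: "(real^'n::finite) measure"
  assumes sQ: "sets Q = sets borel" and Q0: "emeasure Q {0} = 0"
    and fin: "(\<integral>\<^sup>+y. ennreal (min 1 ((norm y)\<^sup>2)) \<partial>Q) < \<infinity>"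
  shows "integrated_tail Q = ray_measure (\<lambda>_ _. 1) Q"
proof -
  let ?P = "\<lambda>R. \<exists>Qo K. polar_decomposition Q Qo K \<and>
     (\<forall>\<xi>\<in>sphere 0 1. (\<integral>\<^sup>+r. ennreal (min 1 (r\<^sup>2)) \<partial>K \<xi>) < \<infinity>) \<and> R = int_tail Qo K"
  have "\<exists>R. ?P R"
    using polar_decomposition_exists[OF sQ Q0, of "\<lambda>r. min 1 (r\<^sup>2)"] fin by fastforce
  then have "?P (integrated_tail Q)" unfolding integrated_tail_def by (rule someI_ex)
  then obtain Qo K where pd: "polar_decomposition Q Qo K"
    and f: "\<And>\<xi>. \<xi> \<in> sphere 0 1 \<Longrightarrow> (\<integral>\<^sup>+r. ennreal (min 1 (r\<^sup>2)) \<partial>K \<xi>) < \<infinity>"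
    and R: "integrated_tail Q = int_tail Qo K" by blast
  have spQo: "space Qo = sphere 0 1"
    using pd sets_eq_imp_space_eq[of Qo "restrict_space borel (sphere 0 1)"]
    by (simp add: polar_decomposition_def space_restrict_space)
  have sK: "sets (K \<xi>) = sets (restrict_space borel {0<..})" if "\<xi> \<in> sphere 0 1" for \<xi>
    using pd that by (simp add: polar_decomposition_def)
  show ?thesis
    unfolding R int_tail_def
  proof (rule measure_of_eqI)
    fix B :: "(real^'n) set" assume B: "B \<in> sets borel"
    have "emeasure (ray_measure (\<lambda>_ _. 1) Q) B = (\<integral>\<^sup>+\<xi>. (\<integral>\<^sup>+z\<in>{0<..}. indicator B (z *\<^sub>R \<xi>)
            * (\<integral>\<^sup>+r. 1 * indicator {z<..} r \<partial>K \<xi>) \<partial>lborel) \<partial>Qo)"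
      by (rule emeasure_ray_measure_polar[OF pd sQ _ _ f _ B]) auto
    also have "\<dots> = (\<integral>\<^sup>+\<xi>. (\<integral>\<^sup>+z\<in>{0<..}. indicator B (z *\<^sub>R \<xi>) * emeasure (K \<xi>) {z<..} \<partial>lborel) \<partial>Qo)"
    proof (intro nn_integral_cong)
      fix \<xi> z assume "\<xi> \<in> space Qo"
      \<comment> \<open>The space of \<open>K \<xi>\<close> is the positive half-line, so for
        negative \<open>z\<close> this set is not measurable; such \<open>z\<close> are removed by
        the factor \<open>indicator {0<..} z\<close>.\<close>
      then have "{z<..} \<in> sets (K \<xi>)" if "0 < z"
        using that by (simp add: sK spQo sets_restrict_space_iff subset_eq)
      then show "indicator B (z *\<^sub>R \<xi>) * (\<integral>\<^sup>+r. 1 * indicator {z<..} r \<partial>K \<xi>) * indicator {0<..} z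
        = indicator B (z *\<^sub>R \<xi>) * emeasure (K \<xi>) {z<..} * indicator {0<..} z"
        by (auto split: split_indicator)
    qed
    finally show "emeasure (ray_measure (\<lambda>_ _. 1) Q) B = \<dots>" .
  qed auto
qed

text \<open>The scheme of the single tail, with the weight \<open>min r (r\<^sup>2)\<close>. What is
  new is that two successive tails have to collapse into the single weight
  \<open>r - z\<close>.\<close>

lemma double_integrated_tail_eq:
  fixes Q :: "(real^'n::finite) measure"
  assumes sQ: "sets Q = sets borel" and Q0: "emeasure Q {0} = 0"
    and fin: "(\<integral>\<^sup>+y. ennreal (min (norm y) ((norm y)\<^sup>2)) \<partial>Q) < \<infinity>"
  shows "double_integrated_tail Q = ray_measure (\<lambda>r z. ennreal (r - z)) Q"
proof -
  let ?P = "\<lambda>R. \<exists>Qo K. polar_decomposition Q Qo K \<and>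
     (\<forall>\<xi>\<in>sphere 0 1. (\<integral>\<^sup>+r. ennreal (min r (r\<^sup>2)) \<partial>K \<xi>) < \<infinity>) \<and> R = double_int_tail Qo K"
  have "\<exists>R. ?P R"
    using polar_decomposition_exists[OF sQ Q0, of "\<lambda>r. min r (r\<^sup>2)"] fin by fastforce
  then have "?P (double_integrated_tail Q)" unfolding double_integrated_tail_def by (rule someI_ex)
  then obtain Qo K where pd: "polar_decomposition Q Qo K"
    and f: "\<And>\<xi>. \<xi> \<in> sphere 0 1 \<Longrightarrow> (\<integral>\<^sup>+r. ennreal (min r (r\<^sup>2)) \<partial>K \<xi>) < \<infinity>"
    and R: "double_integrated_tail Q = double_int_tail Qo K" by blast
  have spQo: "space Qo = sphere 0 1"
    using pd sets_eq_imp_space_eq[of Qo "restrict_space borel (sphere 0 1)"]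
    by (simp add: polar_decomposition_def space_restrict_space)
  have sK: "sets (K \<xi>) = sets (restrict_space borel {0<..})" and sfK: "sigma_finite_measure (K \<xi>)"
    if "\<xi> \<in> sphere 0 1" for \<xi>
    using pd that by (auto simp: polar_decomposition_def)
  \<comment> \<open>By Tonelli's theorem, \<open>r - z\<close> arises as the length of the set of
    all \<open>z1\<close> with \<open>z < z1 < r\<close>.\<close>
  have tail: "(\<integral>\<^sup>+z1\<in>{z<..}. emeasure (K \<xi>) {z1<..} \<partial>lborel) = (\<integral>\<^sup>+r. ennreal (r - z) * indicator {z<..} r \<partial>K \<xi>)"
    if \<xi>: "\<xi> \<in> sphere 0 1" and z: "0 < z" for \<xi> z
  proof -
    interpret K: sigma_finite_measure "K \<xi>" by (rule sfK[OF \<xi>])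
    interpret pair_sigma_finite "K \<xi>" lborel ..
    have idK: "(\<lambda>r. r) \<in> K \<xi> \<rightarrow>\<^sub>M borel"
      unfolding measurable_cong_sets[OF sK[OF \<xi>] refl] by (rule measurable_restrict_space1) simp
    have snd: "snd \<in> K \<xi> \<Otimes>\<^sub>M lborel \<rightarrow>\<^sub>M (borel :: real measure)"
      using measurable_snd[of "K \<xi>" lborel] by (simp add: measurable_cong_sets[OF refl sets_lborel])
    have G0: "(\<lambda>p::real\<times>real. if z < snd p \<and> snd p < fst p then 1 else 0 :: ennreal) \<in> borel_measurable (borel \<Otimes>\<^sub>M borel)"
      by measurable
    have "(\<lambda>p. (fst p, snd p)) \<in> K \<xi> \<Otimes>\<^sub>M (lborel :: real measure) \<rightarrow>\<^sub>M borel \<Otimes>\<^sub>M borel"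
      by (intro measurable_Pair measurable_compose[OF measurable_fst idK] snd)
    from measurable_compose[OF this G0]
    have G: "(\<lambda>(r, z1). if z < z1 \<and> z1 < r then 1 else 0 :: ennreal) \<in> borel_measurable (K \<xi> \<Otimes>\<^sub>M lborel)"
      by (simp add: split_beta')
    have "(\<integral>\<^sup>+z1\<in>{z<..}. emeasure (K \<xi>) {z1<..} \<partial>lborel) = (\<integral>\<^sup>+z1. (\<integral>\<^sup>+r. (if z < z1 \<and> z1 < r then 1 else 0) \<partial>K \<xi>) \<partial>lborel)"
    proof (rule nn_integral_cong)
      fix z1 :: real
      have "(\<integral>\<^sup>+r. (if z < z1 \<and> z1 < r then 1 else 0) \<partial>K \<xi>) = (\<integral>\<^sup>+r. indicator {z1<..} r \<partial>K \<xi>)" if "z < z1"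
        using that by (intro nn_integral_cong) (auto split: split_indicator)
      moreover have "{z1<..} \<in> sets (K \<xi>)" if "z < z1"
        using that z \<xi> by (simp add: sK sets_restrict_space_iff subset_eq)
      ultimately show "emeasure (K \<xi>) {z1<..} * indicator {z<..} z1 = (\<integral>\<^sup>+r. (if z < z1 \<and> z1 < r then 1 else 0) \<partial>K \<xi>)"
        by (cases "z < z1") auto
    qed
    also have "\<dots> = (\<integral>\<^sup>+r. (\<integral>\<^sup>+z1. (if z < z1 \<and> z1 < r then 1 else 0) \<partial>lborel) \<partial>K \<xi>)"
      by (rule Fubini'[OF G])
    also have "\<dots> = (\<integral>\<^sup>+r. ennreal (r - z) * indicator {z<..} r \<partial>K \<xi>)"
    proof (rule nn_integral_cong)
      fix r
      have "(\<integral>\<^sup>+z1. (if z < z1 \<and> z1 < r then 1 else 0) \<partial>lborel) = (\<integral>\<^sup>+z1. indicator {z<..<r} z1 \<partial>lborel)"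
        by (intro nn_integral_cong) (auto split: split_indicator)
      then show "(\<integral>\<^sup>+z1. (if z < z1 \<and> z1 < r then 1 else 0) \<partial>lborel) = ennreal (r - z) * indicator {z<..} r"
        by (cases "z < r") auto
    qed
    finally show ?thesis .
  qed
  show ?thesis
    unfolding R double_int_tail_def
  proof (rule measure_of_eqI)
    fix B :: "(real^'n) set" assume B: "B \<in> sets borel"
    have "emeasure (ray_measure (\<lambda>r z. ennreal (r - z)) Q) B = (\<integral>\<^sup>+\<xi>. (\<integral>\<^sup>+z\<in>{0<..}. indicator B (z *\<^sub>R \<xi>)
            * (\<integral>\<^sup>+r. ennreal (r - z) * indicator {z<..} r \<partial>K \<xi>) \<partial>lborel) \<partial>Qo)"
      by (rule emeasure_ray_measure_polar[OF pd sQ _ _ f _ B]) auto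
    also have "\<dots> = (\<integral>\<^sup>+\<xi>. (\<integral>\<^sup>+z2\<in>{0<..}. indicator B (z2 *\<^sub>R \<xi>) *
        (\<integral>\<^sup>+z1\<in>{z2<..}. emeasure (K \<xi>) {z1<..} \<partial>lborel) \<partial>lborel) \<partial>Qo)"
      by (intro nn_integral_cong) (auto simp: tail spQo split: split_indicator)
    finally show "emeasure (ray_measure (\<lambda>r z. ennreal (r - z)) Q) B = \<dots>" .
  qed auto
qed

text \<open>Fubini's theorem for signed integrands, hence sigma-finiteness of \<open>Q\<close>.
  Since the ray measure may have infinite mass far from the origin, boundedness of \<open>f\<close>
  is not enough: its vanishing beyond radius \<open>R\<close> allows the integrability condition
  \<open>fin\<close> to be truncated to heights up to \<open>R\<close>.\<close>

lemma integral_ray_measure: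
  fixes Q :: "(real^'n::finite) measure" and \<psi> :: "real \<Rightarrow> real \<Rightarrow> real" and f :: "real^'n \<Rightarrow> real"
  assumes sQ: "sets Q = sets borel" and sf: "sigma_finite_measure Q"
    and \<psi>: "(\<lambda>p. \<psi> (fst p) (snd p)) \<in> borel_measurable (borel \<Otimes>\<^sub>M borel)"
    and \<psi>0: "\<And>r z. 0 < z \<Longrightarrow> z < r \<Longrightarrow> 0 \<le> \<psi> r z"
    and f[measurable]: "f \<in> borel_measurable borel"
    and bd: "\<And>y. \<bar>f y\<bar> \<le> C" and supp: "\<And>y. R < norm y \<Longrightarrow> f y = 0"
    and fin: "(\<integral>\<^sup>+y. (\<integral>\<^sup>+z. ennreal (\<psi> (norm y) z) * indicator ({0<..<norm y} \<inter> {..R}) z \<partial>lborel) \<partial>Q) < \<infinity>"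
  shows "integrable (ray_measure (\<lambda>r z. ennreal (\<psi> r z)) Q) f"
    and "integrable Q (\<lambda>y. \<integral>z. indicator {0<..<norm y} z * (\<psi> (norm y) z * f (z *\<^sub>R sgn y)) \<partial>lborel)"
    and "(\<integral>y. f y \<partial>ray_measure (\<lambda>r z. ennreal (\<psi> r z)) Q)
       = (\<integral>y. (\<integral>z. indicator {0<..<norm y} z * (\<psi> (norm y) z * f (z *\<^sub>R sgn y)) \<partial>lborel) \<partial>Q)"
proof -
  interpret Q: sigma_finite_measure Q by fact
  interpret pair_sigma_finite Q lborel ..
  let ?M = "Q \<Otimes>\<^sub>M (lborel :: real measure)"
  have s: "sets ?M = sets (borel \<Otimes>\<^sub>M borel)" using sQ by (intro sets_pair_measure_cong) auto
  have m: "g \<in> borel_measurable ?M" if "g \<in> borel_measurable (borel \<Otimes>\<^sub>M borel)"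
    for g :: "(real^'n) \<times> real \<Rightarrow> 'b::topological_space"
    using that measurable_cong_sets[OF s refl] by blast
  have [measurable]: "(\<lambda>p. \<psi> (norm (fst p :: real^'n)) (snd p)) \<in> borel_measurable (borel \<Otimes>\<^sub>M borel)"
  proof -
    have "(\<lambda>p. (norm (fst p :: real^'n), snd p)) \<in> borel \<Otimes>\<^sub>M borel \<rightarrow>\<^sub>M borel \<Otimes>\<^sub>M borel" by measurable
    from measurable_compose[OF this \<psi>] show ?thesis by simp
  qed
  have T: "(\<lambda>p. snd p *\<^sub>R sgn (fst p)) \<in> ?M \<rightarrow>\<^sub>M (borel :: (real^'n) measure)"
    unfolding measurable_cong_sets[OF s refl] by measurable
  define d where "d p = \<psi> (norm (fst p)) (snd p) * indicator {0<..<norm (fst p)} (snd p)" for p :: "(real^'n) \<times> real"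
  have d0: "0 \<le> d p" for p
    by (auto simp: d_def \<psi>0 split: split_indicator)
  have d[measurable]: "d \<in> borel_measurable (borel \<Otimes>\<^sub>M borel)"
    unfolding d_def[abs_def] by measurable
  have ray: "ray_measure (\<lambda>r z. ennreal (\<psi> r z)) Q = distr (density ?M (\<lambda>p. ennreal (d p))) borel (\<lambda>p. snd p *\<^sub>R sgn (fst p))"
    unfolding ray_measure_def d_def
    by (intro arg_cong2[where f="\<lambda>a b. distr (density ?M a) borel b"] ext) (auto split: split_indicator)
  define G where "G p = d p * f (snd p *\<^sub>R sgn (fst p))" for p
  have G[measurable]: "G \<in> borel_measurable (borel \<Otimes>\<^sub>M borel)"
    unfolding G_def[abs_def] by measurable
  have C: "0 \<le> C" using bd[of 0] by linarith
  have Gint: "integrable ?M G"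
  proof (rule integrableI_bounded)
    show "G \<in> borel_measurable ?M" by (rule m) measurable
    have mI: "(\<lambda>p. ennreal (\<psi> (norm (fst p)) (snd p)) * indicator ({0<..<norm (fst p)} \<inter> {..R}) (snd p)) \<in> borel_measurable ?M"
      by (rule m) measurable
    have "(\<integral>\<^sup>+p. ennreal (norm (G p)) \<partial>?M)
      \<le> (\<integral>\<^sup>+p. ennreal C * (ennreal (\<psi> (norm (fst p)) (snd p)) * indicator ({0<..<norm (fst p)} \<inter> {..R}) (snd p)) \<partial>?M)"
    proof (rule nn_integral_mono)
      fix p :: "(real^'n) \<times> real"
      obtain y z where p: "p = (y, z)" by (cases p)
      show "ennreal (norm (G p)) \<le> ennreal C * (ennreal (\<psi> (norm (fst p)) (snd p)) * indicator ({0<..<norm (fst p)} \<inter> {..R}) (snd p))"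
      proof (cases "0 < z \<and> z < norm y")
        case True
        \<comment> \<open>The point at height \<open>z\<close> on a ray has norm \<open>z\<close>,
          so the support of \<open>f\<close> turns into the cut \<open>z \<le> R\<close>.\<close>
        then have "norm (z *\<^sub>R sgn y) = z" by (auto simp: norm_sgn)
        then have "f (z *\<^sub>R sgn y) = 0" if "\<not> z \<le> R" using supp that by auto
        moreover have "\<bar>\<psi> (norm y) z * f (z *\<^sub>R sgn y)\<bar> \<le> C * \<psi> (norm y) z"
          using bd[of "z *\<^sub>R sgn y"] \<psi>0[of z "norm y"] True by (simp add: abs_mult mult.commute[of C] mult_left_mono)
        ultimately show ?thesis using True \<psi>0[of z "norm y"] C
          by (cases "z \<le> R") (auto simp: p G_def d_def simp flip: ennreal_mult intro!: ennreal_leI)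
      qed (auto simp: p G_def d_def)
    qed
    also have "\<dots> = ennreal C * (\<integral>\<^sup>+p. ennreal (\<psi> (norm (fst p)) (snd p)) * indicator ({0<..<norm (fst p)} \<inter> {..R}) (snd p) \<partial>?M)"
      by (rule nn_integral_cmult[OF mI])
    also have "\<dots> = ennreal C * (\<integral>\<^sup>+y. (\<integral>\<^sup>+z. ennreal (\<psi> (norm y) z) * indicator ({0<..<norm y} \<inter> {..R}) z \<partial>lborel) \<partial>Q)"
      using lborel.nn_integral_fst[OF mI] by simp
    also have "\<dots> < \<infinity>" using fin by (simp add: ennreal_mult_less_top)
    finally show "(\<integral>\<^sup>+p. ennreal (norm (G p)) \<partial>?M) < \<infinity>" .
  qed
  have dM: "d \<in> borel_measurable ?M" by (rule m) measurable
  have fM: "(\<lambda>p. f (snd p *\<^sub>R sgn (fst p))) \<in> borel_measurable ?M" by (rule m) measurable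
  show "integrable (ray_measure (\<lambda>r z. ennreal (\<psi> r z)) Q) f"
    unfolding ray using T fM dM d0 Gint
    by (subst integrable_distr_eq) (auto simp: integrable_density G_def[abs_def])
  have Gs: "(\<lambda>(y, z). indicator {0<..<norm y} z * (\<psi> (norm y) z * f (z *\<^sub>R sgn y))) = G"
    by (auto simp: fun_eq_iff G_def d_def)
  show "integrable Q (\<lambda>y. \<integral>z. indicator {0<..<norm y} z * (\<psi> (norm y) z * f (z *\<^sub>R sgn y)) \<partial>lborel)"
    by (rule integrable_fst) (simp add: Gs Gint)
  have "(\<integral>y. f y \<partial>ray_measure (\<lambda>r z. ennreal (\<psi> r z)) Q) = integral\<^sup>L ?M G"
    unfolding ray using T fM dM d0
    by (subst integral_distr) (auto simp: integral_density G_def[abs_def])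
  also have "\<dots> = (\<integral>y. (\<integral>z. indicator {0<..<norm y} z * (\<psi> (norm y) z * f (z *\<^sub>R sgn y)) \<partial>lborel) \<partial>Q)"
    by (subst integral_fst) (simp_all add: Gs Gint)
  finally show "(\<integral>y. f y \<partial>ray_measure (\<lambda>r z. ennreal (\<psi> r z)) Q) = \<dots>" .
qed

section \<open>Test functions along rays\<close>

text \<open>\<open>pd\<close> records a derivative at parameter 0 only; moving the base point along
  the line reaches every parameter.\<close>

lemma has_real_derivative_coordinate_line:
  assumes "\<And>x. has_pd i f x"
  shows "((\<lambda>s. f (y + s *\<^sub>R axis i 1)) has_real_derivative pd i f (y + s *\<^sub>R axis i 1)) (at s)"
proof -
  let ?g = "\<lambda>t. f (y + s *\<^sub>R axis i 1 + t *\<^sub>R axis i 1)"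
  have "(?g has_real_derivative pd i f (y + s *\<^sub>R axis i 1)) (at 0)"
    using assms[of "y + s *\<^sub>R axis i 1"] unfolding has_pd_def pd_def
    by (simp add: DERIV_deriv_iff_real_differentiable)
  then have "((\<lambda>t. f (y + (t + s) *\<^sub>R axis i 1)) has_real_derivative pd i f (y + s *\<^sub>R axis i 1)) (at 0)"
    by (simp add: algebra_simps)
  then have "((\<lambda>t. f (y + t *\<^sub>R axis i 1)) has_real_derivative pd i f (y + s *\<^sub>R axis i 1)) (at (0 + s))"
    by (subst DERIV_shift)
  then show ?thesis by simp
qed

text \<open>By induction on the set of coordinates along which the line moves.\<close>

lemma has_real_derivative_line:
  fixes f :: "real^'n::finite \<Rightarrow> real"
  assumes pd: "\<And>i x. has_pd i f x" and cont: "\<And>i. continuous_on UNIV (pd i f)"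
  shows "((\<lambda>t. f (x + t *\<^sub>R u)) has_real_derivative grad f (x + t *\<^sub>R u) \<bullet> u) (at t)"
proof -
  define v where "v S = (\<Sum>i\<in>S. u $ i *\<^sub>R axis i (1::real))" for S :: "'n set"
  have "((\<lambda>t. f (x + t *\<^sub>R v S)) has_real_derivative (\<Sum>i\<in>S. u $ i * pd i f (x + t *\<^sub>R v S))) (at t)"
    if "finite S" for S x t
    using that
  proof (induction S arbitrary: x t rule: finite_induct)
    case empty
    then show ?case by (simp add: v_def)
  next
    case (insert j S)
    \<comment> \<open>The line for \<open>insert j S\<close> is the diagonal of \<open>F\<close>:
      the first argument moves along \<open>S\<close>, where the induction hypothesis applies, and
      the second along axis \<open>j\<close>. A partial derivative in the first argument at the
      point and a continuous one in the second give joint differentiability there, and the chain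
      rule along the diagonal adds the two contributions.\<close>
    define F where "F t s = f (x + t *\<^sub>R v S + (s * u $ j) *\<^sub>R axis j 1)" for t s :: real
    define D where "D t s = u $ j * pd j f (x + t *\<^sub>R v S + (s * u $ j) *\<^sub>R axis j 1)" for t s :: real
    have eq: "x + t *\<^sub>R v (insert j S) = x + t *\<^sub>R v S + (t * u $ j) *\<^sub>R axis j 1" for t
      using insert by (simp add: v_def algebra_simps)
    have Fx: "((\<lambda>t. F t s) has_real_derivative (\<Sum>i\<in>S. u $ i * pd i f (x + t *\<^sub>R v S + (s * u $ j) *\<^sub>R axis j 1))) (at t)" for t s
      using insert.IH[of "x + (s * u $ j) *\<^sub>R axis j 1" t] by (simp add: F_def add_ac)
    have Fy: "(F t has_real_derivative D t s) (at s)" for t s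
    proof -
      have "((\<lambda>s. s * u $ j) has_real_derivative u $ j) (at s)"
        by (auto intro!: derivative_eq_intros)
      from DERIV_chain2[where g="\<lambda>s. s * u $ j", OF has_real_derivative_coordinate_line[OF pd, of "x + t *\<^sub>R v S" j "s * u $ j"] this]
      show ?thesis by (simp add: F_def[abs_def] D_def mult.commute)
    qed
    have "((\<lambda>(t, s). F t s) has_derivative (\<lambda>(dt, ds). (\<Sum>i\<in>S. u $ i * pd i f (x + t *\<^sub>R v S + (t * u $ j) *\<^sub>R axis j 1)) * dt
        + blinfun_apply (D t t *\<^sub>R id_blinfun) ds)) (at (t, t) within UNIV \<times> UNIV)"
    proof (rule has_derivative_partialsI[where f=F and x=t and y=t and X=UNIV and Y=UNIV
          and fy="\<lambda>a b. D a b *\<^sub>R id_blinfun" and fx="(*) (\<Sum>i\<in>S. u $ i * pd i f (x + t *\<^sub>R v S + (t * u $ j) *\<^sub>R axis j 1))"])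
      show "((\<lambda>s. F s t) has_derivative (*) (\<Sum>i\<in>S. u $ i * pd i f (x + t *\<^sub>R v S + (t * u $ j) *\<^sub>R axis j 1))) (at t)"
        using Fx[of t t] by (simp add: has_field_derivative_def)
      show "(F a has_derivative blinfun_apply (D a b *\<^sub>R id_blinfun)) (at b)" for a b
        using Fy[of a b] by (simp add: has_field_derivative_def scaleR_blinfun.rep_eq)
      have "continuous_on UNIV (\<lambda>p. D (fst p) (snd p) *\<^sub>R (id_blinfun :: real \<Rightarrow>\<^sub>L real))"
        unfolding D_def by (intro continuous_intros continuous_on_compose2[OF cont]) auto
      then show "continuous (at (t, t) within UNIV \<times> UNIV) (\<lambda>(x, y). D x y *\<^sub>R (id_blinfun :: real \<Rightarrow>\<^sub>L real))"
        by (simp add: continuous_on_eq_continuous_within split_beta')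
    qed auto
    then have "((\<lambda>(t, s). F t s) has_derivative (\<lambda>(dt, ds). (\<Sum>i\<in>S. u $ i * pd i f (x + t *\<^sub>R v S + (t * u $ j) *\<^sub>R axis j 1)) * dt
        + D t t * ds)) (at (t, t))"
      by (simp add: scaleR_blinfun.rep_eq)
    from has_derivative_compose[OF has_derivative_Pair[OF has_derivative_ident has_derivative_ident] this]
    have "((\<lambda>t. F t t) has_derivative (\<lambda>h. (\<Sum>i\<in>S. u $ i * pd i f (x + t *\<^sub>R v S + (t * u $ j) *\<^sub>R axis j 1)) * h + D t t * h)) (at t)"
      by simp
    moreover have "(\<lambda>t. F t t) = (\<lambda>t. f (x + t *\<^sub>R v (insert j S)))"
      by (simp add: F_def eq)
    moreover have "(\<lambda>h. (\<Sum>i\<in>S. u $ i * pd i f (x + t *\<^sub>R v S + (t * u $ j) *\<^sub>R axis j 1)) * h + D t t * h)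
        = (*) (\<Sum>i\<in>insert j S. u $ i * pd i f (x + t *\<^sub>R v (insert j S)))"
      using insert.hyps by (simp add: fun_eq_iff eq D_def distrib_right)
    ultimately show ?case by (simp only: has_field_derivative_def)
  qed
  from this[of UNIV] have *: "((\<lambda>t. f (x + t *\<^sub>R v UNIV)) has_real_derivative (\<Sum>i\<in>UNIV. u $ i * pd i f (x + t *\<^sub>R v UNIV))) (at t)"
    by simp
  have "v UNIV = u"
    using basis_expansion[of u] by (simp add: v_def scalar_mult_eq_scaleR)
  with * show ?thesis by (simp add: grad_def inner_vec_def mult.commute)
qed

lemma iter_pd_snoc: "iter_pd is (pd i f) = iter_pd (is @ [i]) f"
  by (induction "is") auto

lemma test_funD:
  assumes "f \<in> test_fun"
  shows "has_pd i (iter_pd is f) x" and "continuous_on UNIV (iter_pd is f)"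
proof -
  have "C_k (Suc (length is)) f" using assms by (simp add: test_fun_def)
  then show "has_pd i (iter_pd is f) x" "continuous_on UNIV (iter_pd is f)"
    unfolding C_k_def by auto
qed

lemma test_fun_has_pd: "f \<in> test_fun \<Longrightarrow> has_pd i f x"
  and test_fun_continuous: "f \<in> test_fun \<Longrightarrow> continuous_on UNIV f"
  using test_funD(1)[of f i "[]" x] test_funD(2)[of f "[]"] by auto

lemma test_fun_pd:
  fixes f :: "real^'n::finite \<Rightarrow> real"
  assumes "f \<in> test_fun"
  shows "pd i f \<in> test_fun"
proof -
  have "C_k k (pd i f)" for k
    unfolding C_k_def iter_pd_snoc using test_funD[OF assms] by auto
  moreover have "{x. pd i f x \<noteq> 0} \<subseteq> closure {x. f x \<noteq> 0}"
  proof (safe, rule ccontr)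
    fix x assume x: "pd i f x \<noteq> 0" "x \<notin> closure {x. f x \<noteq> 0}"
    have "\<forall>\<^sub>F t in nhds 0. x + t *\<^sub>R axis i 1 \<in> - closure {x. f x \<noteq> 0}"
    proof (rule topological_tendstoD)
      show "((\<lambda>t::real. x + t *\<^sub>R axis i 1) \<longlongrightarrow> x) (nhds 0)"
        by (rule tendsto_eq_intros refl filterlim_ident | simp)+
    qed (use x in auto)
    then have "\<forall>\<^sub>F t in nhds 0. f (x + t *\<^sub>R axis i 1) = 0"
      by (rule eventually_mono) (use closure_subset[of "{x. f x \<noteq> 0}"] in auto)
    then have "deriv (\<lambda>t. f (x + t *\<^sub>R axis i 1)) 0 = deriv (\<lambda>t. 0) 0"
      by (intro deriv_cong_ev) auto
    with x(1) show False by (simp add: pd_def)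
  qed
  then have "closure {x. f x \<noteq> 0} \<inter> closure {x. pd i f x \<noteq> 0} = closure {x. pd i f x \<noteq> 0}"
    using closure_minimal by blast
  moreover have "compact (closure {x. f x \<noteq> 0} \<inter> closure {x. pd i f x \<noteq> 0})"
    using assms by (intro compact_Int_closed) (auto simp: test_fun_def)
  ultimately show ?thesis by (simp add: test_fun_def)
qed

lemma test_fun_bounds:
  fixes f :: "real^'n::finite \<Rightarrow> real"
  assumes "f \<in> test_fun"
  obtains C R where "0 \<le> C" "0 \<le> R" "\<And>x. \<bar>f x\<bar> \<le> C" "\<And>x. R < norm x \<Longrightarrow> f x = 0"
proof -
  let ?S = "closure {x. f x \<noteq> 0}"
  have S: "compact ?S" using assms by (simp add: test_fun_def)
  have "compact (f ` ?S)"
    by (rule compact_continuous_image[OF continuous_on_subset[OF test_fun_continuous[OF assms]] S]) simp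
  then obtain C where C: "\<And>x. x \<in> ?S \<Longrightarrow> \<bar>f x\<bar> \<le> C"
    using compact_imp_bounded bounded_iff by (metis imageI real_norm_def)
  obtain R where R: "\<And>x. x \<in> ?S \<Longrightarrow> norm x \<le> R"
    using compact_imp_bounded[OF S] bounded_iff by metis
  have out: "f x = 0" if "x \<notin> ?S" for x using that closure_subset[of "{x. f x \<noteq> 0}"] by auto
  show ?thesis
  \<comment> \<open>The maxima with 0 matter when the support is empty, since \<open>C\<close> and
    \<open>R\<close> are then unconstrained.\<close>
  proof (rule that[of "max C 0" "max R 0"])
    show "\<bar>f x\<bar> \<le> max C 0" for x using C[of x] out[of x] by (cases "x \<in> ?S") auto
    show "f x = 0" if "max R 0 < norm x" for x using R[of x] out[of x] that by (cases "x \<in> ?S") auto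
  qed auto
qed

lemma integral_indicator_Ioo_eq:
  fixes F g :: "real \<Rightarrow> real"
  assumes "0 \<le> r" and F: "\<And>z. (F has_real_derivative g z) (at z)" and g: "continuous_on UNIV g"
  shows "(\<integral>z. indicator {0<..<r} z * g z \<partial>lborel) = F r - F 0"
proof -
  have [measurable]: "g \<in> borel_measurable borel" by (rule borel_measurable_continuous_onI[OF g])
  have "(\<integral>z. indicator {0<..<r} z * g z \<partial>lborel) = (\<integral>z. indicator {0..r} z *\<^sub>R g z \<partial>lborel)"
  proof (rule integral_cong_AE)
    show "AE z in lborel. indicator {0<..<r} z * g z = indicator {0..r} z *\<^sub>R g z"
      using AE_lborel_singleton[of 0] AE_lborel_singleton[of r]
      by eventually_elim (auto split: split_indicator)
  qed auto
  also have "\<dots> = F r - F 0"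
    using assms by (intro integral_FTC_atLeastAtMost)
      (auto simp: has_real_derivative_iff_has_vector_derivative[symmetric] intro: has_field_derivative_at_within continuous_on_subset)
  finally show ?thesis .
qed

lemma first_order_ray_formula:
  fixes f :: "real^'n::finite \<Rightarrow> real"
  assumes f: "f \<in> test_fun" and "0 \<le> r"
  shows "(\<integral>z. indicator {0<..<r} z * (grad f (x + z *\<^sub>R u) \<bullet> u) \<partial>lborel) = f (x + r *\<^sub>R u) - f x"
proof -
  have "(\<integral>z. indicator {0<..<r} z * (grad f (x + z *\<^sub>R u) \<bullet> u) \<partial>lborel) = f (x + r *\<^sub>R u) - f (x + 0 *\<^sub>R u)"
  proof (rule integral_indicator_Ioo_eq[OF \<open>0 \<le> r\<close>])
    show "((\<lambda>z. f (x + z *\<^sub>R u)) has_real_derivative grad f (x + z *\<^sub>R u) \<bullet> u) (at z)" for z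
      by (rule has_real_derivative_line) (auto intro: test_fun_has_pd[OF f] test_fun_continuous[OF test_fun_pd[OF f]])
    show "continuous_on UNIV (\<lambda>z. grad f (x + z *\<^sub>R u) \<bullet> u)"
      unfolding grad_def inner_vec_def
      by (auto intro!: continuous_intros continuous_on_compose2[OF test_fun_continuous[OF test_fun_pd[OF f]]])
  qed
  then show ?thesis by simp
qed

lemma second_order_ray_formula:
  fixes f :: "real^'n::finite \<Rightarrow> real"
  assumes f: "f \<in> test_fun" and "0 \<le> r"
  shows "(\<integral>z. indicator {0<..<r} z * ((r - z) * (\<Sum>i\<in>UNIV. \<Sum>j\<in>UNIV. pd j (pd i f) (x + z *\<^sub>R u) * (u $ i * u $ j))) \<partial>lborel)
    = f (x + r *\<^sub>R u) - f x - grad f x \<bullet> (r *\<^sub>R u)"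
proof -
  define H where "H z = (\<Sum>i\<in>UNIV. \<Sum>j\<in>UNIV. pd j (pd i f) (x + z *\<^sub>R u) * (u $ i * u $ j))" for z
  note tf = test_fun_has_pd test_fun_continuous test_fun_pd f
  have D0: "((\<lambda>z. f (x + z *\<^sub>R u)) has_real_derivative grad f (x + z *\<^sub>R u) \<bullet> u) (at z)" for z
    by (rule has_real_derivative_line) (auto intro: tf)
  have "((\<lambda>z. pd i f (x + z *\<^sub>R u)) has_real_derivative grad (pd i f) (x + z *\<^sub>R u) \<bullet> u) (at z)" for z i
    by (rule has_real_derivative_line) (auto intro: tf)
  then have "((\<lambda>z. \<Sum>i\<in>UNIV. pd i f (x + z *\<^sub>R u) * u $ i) has_real_derivative
      (\<Sum>i\<in>UNIV. (grad (pd i f) (x + z *\<^sub>R u) \<bullet> u) * u $ i)) (at z)" for z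
    by (intro DERIV_sum DERIV_cmult_right)
  then have D1: "((\<lambda>z. grad f (x + z *\<^sub>R u) \<bullet> u) has_real_derivative H z) (at z)" for z
    by (simp add: H_def grad_def inner_vec_def sum_distrib_right sum_distrib_left mult_ac)
  \<comment> \<open>With \<open>\<phi>(z) = f(x + z u)\<close> this is
    \<open>(r - z) \<phi>' + \<phi>\<close>. Its derivative is \<open>(r - z) \<phi>''\<close>, as
    the two first-order terms cancel; at \<open>z = r\<close> only \<open>f(x + r u)\<close>
    survives, and at \<open>z = 0\<close> the first-order Taylor polynomial remains.\<close>
  define F where "F z = (r - z) * (grad f (x + z *\<^sub>R u) \<bullet> u) + f (x + z *\<^sub>R u)" for z
  have "(\<integral>z. indicator {0<..<r} z * ((r - z) * H z) \<partial>lborel) = F r - F 0"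
  proof (rule integral_indicator_Ioo_eq[OF \<open>0 \<le> r\<close>])
    show "(F has_real_derivative (r - z) * H z) (at z)" for z
      unfolding F_def by (auto intro!: derivative_eq_intros D0 D1)
    show "continuous_on UNIV (\<lambda>z. (r - z) * H z)"
      unfolding H_def
      by (intro continuous_intros continuous_on_compose2[OF test_fun_continuous[OF test_fun_pd[OF test_fun_pd[OF f]]]]) auto
  qed
  then show ?thesis by (simp add: F_def H_def)
qed

section \<open>Integrated tails applied to derivatives of test functions\<close>

lemma test_fun_measurable: "f \<in> test_fun \<Longrightarrow> f \<in> borel_measurable borel"
  by (rule borel_measurable_continuous_onI) (rule test_fun_continuous)

lemma norm_scaleR_sgn: "norm y *\<^sub>R sgn y = (y :: 'a :: real_normed_vector)"
  by (cases "y = 0") (simp_all add: sgn_div_norm)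

lemma abs_component_div_norm_le: "\<bar>(y :: real^'n::finite) $ i / norm y\<bar> \<le> 1"
  using component_le_norm_cart[of y i] by (cases "y = 0") (auto simp: divide_le_eq)

text \<open>The length is at most \<open>min r R\<close>, hence at most \<open>r\<close> if
  \<open>r \<le> 1\<close> and at most \<open>R\<close> otherwise; the factor \<open>1 + R\<close>
  covers both cases. Without the cut at \<open>R\<close> the length would be \<open>r\<close>, which
  no multiple of \<open>min 1 r\<close> bounds.\<close>

lemma nn_integral_first_order_weight_le:
  assumes "0 \<le> r" "0 \<le> R"
  shows "(\<integral>\<^sup>+z. indicator ({0<..<r} \<inter> {..R}) z \<partial>lborel) \<le> ennreal (1 + R) * ennreal (min 1 r)"
proof -
  have "(\<integral>\<^sup>+z. indicator ({0<..<r} \<inter> {..R}) z \<partial>lborel) \<le> (\<integral>\<^sup>+z. indicator {0..min r R} z \<partial>lborel)"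
    by (intro nn_integral_mono) (auto split: split_indicator)
  also have "\<dots> = ennreal (min r R)" using assms by simp
  also have "min r R \<le> (1 + R) * min 1 r"
    using assms mult_right_mono[of 1 "1 + R" r] by (auto simp: min_def)
  finally show ?thesis using assms by (simp add: ennreal_mult ennreal_leI)
qed

text \<open>Bounding \<open>r - z\<close> by \<open>r\<close> reduces this to the first-order
  weight, and \<open>r * min 1 r = min r (r\<^sup>2)\<close>.\<close>

lemma nn_integral_second_order_weight_le:
  assumes "0 \<le> r" "0 \<le> R"
  shows "(\<integral>\<^sup>+z. ennreal (r - z) * indicator ({0<..<r} \<inter> {..R}) z \<partial>lborel) \<le> ennreal (1 + R) * ennreal (min r (r\<^sup>2))"
proof -
  have "(\<integral>\<^sup>+z. ennreal (r - z) * indicator ({0<..<r} \<inter> {..R}) z \<partial>lborel)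
      \<le> (\<integral>\<^sup>+z. ennreal r * indicator ({0<..<r} \<inter> {..R}) z \<partial>lborel)"
    by (intro nn_integral_mono) (auto split: split_indicator intro: ennreal_leI)
  also have "\<dots> = ennreal r * (\<integral>\<^sup>+z. indicator ({0<..<r} \<inter> {..R}) z \<partial>lborel)"
    by (rule nn_integral_cmult) simp
  also have "\<dots> \<le> ennreal r * (ennreal (1 + R) * ennreal (min 1 r))"
    by (intro mult_left_mono nn_integral_first_order_weight_le assms) simp
  also have "\<dots> = ennreal (1 + R) * ennreal (min r (r\<^sup>2))"
  proof -
    have "r * min 1 r = min r (r\<^sup>2)" using assms by (auto simp: min_def power2_eq_square mult_le_cancel_left1 mult_le_cancel_left2)
    then have "ennreal r * ennreal (min 1 r) = ennreal (min r (r\<^sup>2))" using assms by (simp flip: ennreal_mult)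
    then show ?thesis by (metis mult.left_commute)
  qed
  finally show ?thesis .
qed

text \<open>On a ray, the factors \<open>y $ i / norm y\<close> are the components of its direction,
  so the sum over \<open>i\<close> is the derivative of \<open>f\<close> along the ray, and
  integration over the height telescopes to an increment. Each component is integrable against the
  tail by itself, which permits exchanging sum and integral.\<close>

lemma integrated_tail_test_fun:
  fixes Q :: "(real^'n::finite) measure"
  assumes sQ: "sets Q = sets borel" and Q0: "emeasure Q {0} = 0"
    and fin: "(\<integral>\<^sup>+y. ennreal (min 1 (norm y)) \<partial>Q) < \<infinity>"
    and f: "f \<in> test_fun"
  shows "integrable Q (\<lambda>y. f (x + y) - f x)"
    and "(\<Sum>i\<in>UNIV. \<integral>y. pd i f (x + y) * (y $ i / norm y) \<partial>integrated_tail Q) = (\<integral>y. f (x + y) - f x \<partial>Q)"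
proof -
  have mQ: "g \<in> borel_measurable Q" if "g \<in> borel_measurable borel" for g :: "real^'n \<Rightarrow> 'b::topological_space"
    using that measurable_cong_sets[OF sQ refl] by blast
  have sf: "sigma_finite_measure Q"
  proof (rule sigma_finite_if_nn_integral_finite[OF _ fin])
    show "(\<lambda>y. min 1 (norm y)) \<in> borel_measurable Q" by (rule mQ) measurable
    show "AE y in Q. 0 < min 1 (norm y)" using Q0 sQ by (intro AE_I[where N="{0}"]) auto
  qed
  have "(\<integral>\<^sup>+y. ennreal (min 1 ((norm y)\<^sup>2)) \<partial>Q) \<le> (\<integral>\<^sup>+y. ennreal (min 1 (norm y)) \<partial>Q)"
  proof (intro nn_integral_mono ennreal_leI)
    fix y :: "real^'n"
    show "min 1 ((norm y)\<^sup>2) \<le> min 1 (norm y)"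
      using power_decreasing[of 1 2 "norm y"] by (cases "norm y \<le> 1") auto
  qed
  then have tail: "integrated_tail Q = ray_measure (\<lambda>r z. ennreal 1) Q"
    using integrated_tail_eq[OF sQ Q0] fin by (simp add: le_less_trans)
  have "\<forall>i. \<exists>C R. 0 \<le> C \<and> 0 \<le> R \<and> (\<forall>y. \<bar>pd i f y\<bar> \<le> C) \<and> (\<forall>y. R < norm y \<longrightarrow> pd i f y = 0)"
    using test_fun_bounds[OF test_fun_pd[OF f]] by metis
  then obtain C R where CR: "\<And>i. 0 \<le> C i" "\<And>i. 0 \<le> R i" "\<And>i y. \<bar>pd i f y\<bar> \<le> C i"
      "\<And>i y. R i < norm y \<Longrightarrow> pd i f y = 0" by metis
  \<comment> \<open>One radius for all \<open>i\<close>: if \<open>norm y > R'\<close>, then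
    \<open>norm (x + y)\<close> exceeds each \<open>R i\<close>, so all partial derivatives vanish
    at \<open>x + y\<close>. The sum stands in for a maximum.\<close>
  define R' where "R' = (\<Sum>i\<in>UNIV. R i) + norm x"
  have R': "0 \<le> R'" unfolding R'_def using CR by (intro add_nonneg_nonneg sum_nonneg) auto
  define g where "g i y = pd i f (x + y) * (y $ i / norm y)" for i y
  have gm[measurable]: "g i \<in> borel_measurable borel" for i
  proof -
    have [measurable]: "pd i f \<in> borel_measurable borel" by (rule test_fun_measurable[OF test_fun_pd[OF f]])
    show ?thesis unfolding g_def[abs_def] by measurable
  qed
  have gC: "\<bar>g i y\<bar> \<le> C i" for i y
    unfolding g_def abs_mult using mult_mono[OF CR(3)[of i "x + y"] abs_component_div_norm_le[of y i]] CR(1) by simp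
  have g0: "g i y = 0" if "R' < norm y" for i y
  proof -
    have "R i \<le> (\<Sum>i\<in>UNIV. R i)" using CR(2) by (intro member_le_sum) auto
    then have "R i < norm (x + y)" using that norm_triangle_ineq4[of "x + y" x] by (simp add: R'_def)
    then show ?thesis by (simp add: g_def CR(4))
  qed
  have "(\<integral>\<^sup>+y. (\<integral>\<^sup>+z. ennreal 1 * indicator ({0<..<norm y} \<inter> {..R'}) z \<partial>lborel) \<partial>Q)
      \<le> (\<integral>\<^sup>+y. ennreal (1 + R') * ennreal (min 1 (norm y)) \<partial>Q)"
    using nn_integral_first_order_weight_le[OF norm_ge_zero R'] by (intro nn_integral_mono) simp
  also have "\<dots> = ennreal (1 + R') * (\<integral>\<^sup>+y. ennreal (min 1 (norm y)) \<partial>Q)"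
    by (intro nn_integral_cmult mQ) measurable
  also have "\<dots> < \<infinity>" using fin by (simp add: ennreal_mult_less_top)
  finally have wfin: "(\<integral>\<^sup>+y. (\<integral>\<^sup>+z. ennreal 1 * indicator ({0<..<norm y} \<inter> {..R'}) z \<partial>lborel) \<partial>Q) < \<infinity>" .
  have gi: "integrable (ray_measure (\<lambda>r z. ennreal 1) Q) (g i)" for i
    by (rule integral_ray_measure(1)[OF sQ sf _ _ gm gC g0 wfin]) auto
  have inner: "(\<integral>z. indicator {0<..<norm y} z * (1 * (\<Sum>i\<in>UNIV. g i (z *\<^sub>R sgn y))) \<partial>lborel) = f (x + y) - f x" for y
  proof -
    have "(\<Sum>i\<in>UNIV. g i (z *\<^sub>R sgn y)) = grad f (x + z *\<^sub>R sgn y) \<bullet> sgn y" if "0 < z" "z < norm y" for z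
    proof -
      have "norm (sgn y) = 1" using that by (auto simp: norm_sgn)
      then show ?thesis using that by (simp add: g_def grad_def inner_vec_def)
    qed
    then have "(\<integral>z. indicator {0<..<norm y} z * (1 * (\<Sum>i\<in>UNIV. g i (z *\<^sub>R sgn y))) \<partial>lborel)
       = (\<integral>z. indicator {0<..<norm y} z * (grad f (x + z *\<^sub>R sgn y) \<bullet> sgn y) \<partial>lborel)"
      by (intro Bochner_Integration.integral_cong) (auto split: split_indicator)
    also have "\<dots> = f (x + y) - f x"
      using first_order_ray_formula[OF f, of "norm y" x "sgn y"] by (simp add: norm_scaleR_sgn)
    finally show ?thesis .
  qed
  have sm: "(\<lambda>y. \<Sum>i\<in>UNIV. g i y) \<in> borel_measurable borel" by measurable
  have sC: "\<bar>\<Sum>i\<in>UNIV. g i y\<bar> \<le> (\<Sum>i\<in>UNIV. C i)" for y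
    by (rule order_trans[OF sum_abs sum_mono[OF gC]])
  have s0: "(\<Sum>i\<in>UNIV. g i y) = 0" if "R' < norm y" for y using g0[OF that] by simp
  note ray = integral_ray_measure[OF sQ sf _ _ sm sC s0 wfin, unfolded inner]
  show "integrable Q (\<lambda>y. f (x + y) - f x)" by (rule ray(2)) auto
  have "(\<Sum>i\<in>UNIV. \<integral>y. pd i f (x + y) * (y $ i / norm y) \<partial>integrated_tail Q) = (\<Sum>i\<in>UNIV. \<integral>y. g i y \<partial>ray_measure (\<lambda>r z. ennreal 1) Q)"
    unfolding tail g_def ..
  also have "\<dots> = (\<integral>y. (\<Sum>i\<in>UNIV. g i y) \<partial>ray_measure (\<lambda>r z. ennreal 1) Q)"
    by (rule Bochner_Integration.integral_sum[symmetric]) (rule gi)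
  also have "\<dots> = (\<integral>y. f (x + y) - f x \<partial>Q)" by (rule ray(3)) auto
  finally show "(\<Sum>i\<in>UNIV. \<integral>y. pd i f (x + y) * (y $ i / norm y) \<partial>integrated_tail Q) = (\<integral>y. f (x + y) - f x \<partial>Q)" .
qed

text \<open>The sum over \<open>i\<close> and \<open>j\<close> is the second derivative of
  \<open>f\<close> along the ray, and the weight \<open>r - z\<close> of the double tail is exactly
  the kernel of Taylor's integral remainder. This is why the first-order term is subtracted on the
  right-hand side.\<close>

lemma double_integrated_tail_test_fun:
  fixes Q :: "(real^'n::finite) measure"
  assumes sQ: "sets Q = sets borel" and Q0: "emeasure Q {0} = 0"
    and fin: "(\<integral>\<^sup>+y. ennreal (min (norm y) ((norm y)\<^sup>2)) \<partial>Q) < \<infinity>"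
    and f: "f \<in> test_fun"
  shows "integrable Q (\<lambda>y. f (x + y) - f x - grad f x \<bullet> y)"
    and "(\<Sum>i\<in>UNIV. \<Sum>j\<in>UNIV. \<integral>y. pd j (pd i f) (x + y) * (y $ i * y $ j / (norm y)\<^sup>2) \<partial>double_integrated_tail Q)
      = (\<integral>y. f (x + y) - f x - grad f x \<bullet> y \<partial>Q)"
proof -
  have mQ: "g \<in> borel_measurable Q" if "g \<in> borel_measurable borel" for g :: "real^'n \<Rightarrow> 'b::topological_space"
    using that measurable_cong_sets[OF sQ refl] by blast
  have sf: "sigma_finite_measure Q"
  proof (rule sigma_finite_if_nn_integral_finite[OF _ fin])
    show "(\<lambda>y. min (norm y) ((norm y)\<^sup>2)) \<in> borel_measurable Q" by (rule mQ) measurable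
    show "AE y in Q. 0 < min (norm y) ((norm y)\<^sup>2)" using Q0 sQ by (intro AE_I[where N="{0}"]) auto
  qed
  have tail: "double_integrated_tail Q = ray_measure (\<lambda>r z. ennreal (r - z)) Q"
    by (rule double_integrated_tail_eq[OF sQ Q0 fin])
  have tf: "pd j (pd i f) \<in> test_fun" for i j by (intro test_fun_pd f)
  have "\<forall>i j. \<exists>C R. 0 \<le> C \<and> 0 \<le> R \<and> (\<forall>y. \<bar>pd j (pd i f) y\<bar> \<le> C) \<and> (\<forall>y. R < norm y \<longrightarrow> pd j (pd i f) y = 0)"
    using test_fun_bounds[OF tf] by metis
  then obtain C R where CR: "\<And>i j. 0 \<le> C i j" "\<And>i j. 0 \<le> R i j" "\<And>i j y. \<bar>pd j (pd i f) y\<bar> \<le> C i j"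
      "\<And>i j y. R i j < norm y \<Longrightarrow> pd j (pd i f) y = 0" by metis
  define R' where "R' = (\<Sum>i\<in>UNIV. \<Sum>j\<in>UNIV. R i j) + norm x"
  have R': "0 \<le> R'" unfolding R'_def using CR by (intro add_nonneg_nonneg sum_nonneg) auto
  define g where "g i j y = pd j (pd i f) (x + y) * (y $ i * y $ j / (norm y)\<^sup>2)" for i j y
  have gm[measurable]: "g i j \<in> borel_measurable borel" for i j
  proof -
    have [measurable]: "pd j (pd i f) \<in> borel_measurable borel" by (rule test_fun_measurable[OF tf])
    show ?thesis unfolding g_def[abs_def] by measurable
  qed
  have gC: "\<bar>g i j y\<bar> \<le> C i j" for i j y
  proof -
    have "\<bar>y $ i * y $ j / (norm y)\<^sup>2\<bar> = \<bar>y $ i / norm y\<bar> * \<bar>y $ j / norm y\<bar>"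
      by (simp add: abs_mult power2_eq_square)
    also have "\<dots> \<le> 1 * 1" by (intro mult_mono abs_component_div_norm_le) auto
    finally have *: "\<bar>y $ i * y $ j / (norm y)\<^sup>2\<bar> \<le> 1" by simp
    show ?thesis
      unfolding g_def abs_mult[of "pd j (pd i f) (x + y)"] using mult_mono[OF CR(3)[of j i "x + y"] *] CR(1)[of i j] by simp
  qed
  have g0: "g i j y = 0" if "R' < norm y" for i j y
  proof -
    have "R i j \<le> (\<Sum>j\<in>UNIV. R i j)" using CR(2) by (intro member_le_sum) auto
    also have "\<dots> \<le> (\<Sum>i\<in>UNIV. \<Sum>j\<in>UNIV. R i j)"
      using CR(2) by (intro member_le_sum[where f="\<lambda>i. \<Sum>j\<in>UNIV. R i j"] sum_nonneg) auto
    finally have "R i j < norm (x + y)" using that norm_triangle_ineq4[of "x + y" x] by (simp add: R'_def)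
    then show ?thesis by (simp add: g_def CR(4))
  qed
  have "(\<integral>\<^sup>+y. (\<integral>\<^sup>+z. ennreal (norm y - z) * indicator ({0<..<norm y} \<inter> {..R'}) z \<partial>lborel) \<partial>Q)
      \<le> (\<integral>\<^sup>+y. ennreal (1 + R') * ennreal (min (norm y) ((norm y)\<^sup>2)) \<partial>Q)"
    using R' by (intro nn_integral_mono nn_integral_second_order_weight_le) auto
  also have "\<dots> = ennreal (1 + R') * (\<integral>\<^sup>+y. ennreal (min (norm y) ((norm y)\<^sup>2)) \<partial>Q)"
    by (intro nn_integral_cmult mQ) measurable
  also have "\<dots> < \<infinity>" using fin by (simp add: ennreal_mult_less_top)
  finally have wfin: "(\<integral>\<^sup>+y. (\<integral>\<^sup>+z. ennreal (norm y - z) * indicator ({0<..<norm y} \<inter> {..R'}) z \<partial>lborel) \<partial>Q) < \<infinity>" .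
  have gi: "integrable (ray_measure (\<lambda>r z. ennreal (r - z)) Q) (g i j)" for i j
    by (rule integral_ray_measure(1)[OF sQ sf _ _ gm gC g0 wfin]) auto
  have inner: "(\<integral>z. indicator {0<..<norm y} z * ((norm y - z) * (\<Sum>i\<in>UNIV. \<Sum>j\<in>UNIV. g i j (z *\<^sub>R sgn y))) \<partial>lborel)
      = f (x + y) - f x - grad f x \<bullet> y" for y
  proof -
    have "(\<Sum>i\<in>UNIV. \<Sum>j\<in>UNIV. g i j (z *\<^sub>R sgn y))
        = (\<Sum>i\<in>UNIV. \<Sum>j\<in>UNIV. pd j (pd i f) (x + z *\<^sub>R sgn y) * (sgn y $ i * sgn y $ j))" if "0 < z" "z < norm y" for z
    proof -
      have "norm (sgn y) = 1" using that by (auto simp: norm_sgn)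
      then show ?thesis using that by (simp add: g_def power2_eq_square)
    qed
    then have "(\<integral>z. indicator {0<..<norm y} z * ((norm y - z) * (\<Sum>i\<in>UNIV. \<Sum>j\<in>UNIV. g i j (z *\<^sub>R sgn y))) \<partial>lborel)
       = (\<integral>z. indicator {0<..<norm y} z * ((norm y - z) * (\<Sum>i\<in>UNIV. \<Sum>j\<in>UNIV. pd j (pd i f) (x + z *\<^sub>R sgn y) * (sgn y $ i * sgn y $ j))) \<partial>lborel)"
      by (intro Bochner_Integration.integral_cong) (auto split: split_indicator)
    also have "\<dots> = f (x + y) - f x - grad f x \<bullet> y"
      using second_order_ray_formula[OF f, of "norm y" x "sgn y"] by (simp only: norm_scaleR_sgn norm_ge_zero)
    finally show ?thesis .
  qed
  have sm: "(\<lambda>y. \<Sum>i\<in>UNIV. \<Sum>j\<in>UNIV. g i j y) \<in> borel_measurable borel" by measurable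
  have sC: "\<bar>\<Sum>i\<in>UNIV. \<Sum>j\<in>UNIV. g i j y\<bar> \<le> (\<Sum>i\<in>UNIV. \<Sum>j\<in>UNIV. C i j)" for y
    by (intro order_trans[OF sum_abs sum_mono] gC)
  have s0: "(\<Sum>i\<in>UNIV. \<Sum>j\<in>UNIV. g i j y) = 0" if "R' < norm y" for y using g0[OF that] by simp
  note ray = integral_ray_measure[OF sQ sf _ _ sm sC s0 wfin, unfolded inner]
  show "integrable Q (\<lambda>y. f (x + y) - f x - grad f x \<bullet> y)" by (rule ray(2)) auto
  have "(\<Sum>i\<in>UNIV. \<Sum>j\<in>UNIV. \<integral>y. pd j (pd i f) (x + y) * (y $ i * y $ j / (norm y)\<^sup>2) \<partial>double_integrated_tail Q)
      = (\<Sum>i\<in>UNIV. \<Sum>j\<in>UNIV. \<integral>y. g i j y \<partial>ray_measure (\<lambda>r z. ennreal (r - z)) Q)"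
    unfolding tail g_def ..
  also have "\<dots> = (\<integral>y. (\<Sum>i\<in>UNIV. \<Sum>j\<in>UNIV. g i j y) \<partial>ray_measure (\<lambda>r z. ennreal (r - z)) Q)"
    using gi by (simp add: Bochner_Integration.integral_sum Bochner_Integration.integrable_sum)
  also have "\<dots> = (\<integral>y. f (x + y) - f x - grad f x \<bullet> y \<partial>Q)" by (rule ray(3)) auto
  finally show "(\<Sum>i\<in>UNIV. \<Sum>j\<in>UNIV. \<integral>y. pd j (pd i f) (x + y) * (y $ i * y $ j / (norm y)\<^sup>2) \<partial>double_integrated_tail Q)
      = (\<integral>y. f (x + y) - f x - grad f x \<bullet> y \<partial>Q)" .
qed

section \<open>The distributional equation\<close>

text \<open>By sigma-finiteness densities are unique, so the three weights add up to 1 almost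
  everywhere. Hence each of them is at most 1, and integrability of \<open>g\<close> passes to the
  three parts without further conditions.\<close>

lemma integral_three_densities:
  fixes M :: "'a measure" and h1 h2 h3 g :: "'a \<Rightarrow> real"
  assumes sf: "sigma_finite_measure M"
    and h[measurable]: "h1 \<in> borel_measurable M" "h2 \<in> borel_measurable M" "h3 \<in> borel_measurable M"
    and nonneg: "\<And>y. 0 \<le> h1 y" "\<And>y. 0 \<le> h2 y" "\<And>y. 0 \<le> h3 y"
    and eq: "\<And>B. B \<in> sets M \<Longrightarrow> emeasure M B = emeasure (density M (\<lambda>y. ennreal (h1 y))) B
        + emeasure (density M (\<lambda>y. ennreal (h2 y))) B + emeasure (density M (\<lambda>y. ennreal (h3 y))) B"
    and g: "integrable M g"
  shows "(\<integral>y. g y \<partial>M) = (\<integral>y. g y \<partial>density M (\<lambda>y. ennreal (h1 y)))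
    + (\<integral>y. g y \<partial>density M (\<lambda>y. ennreal (h2 y))) + (\<integral>y. g y \<partial>density M (\<lambda>y. ennreal (h3 y)))"
proof -
  interpret sigma_finite_measure M by fact
  have [measurable]: "g \<in> borel_measurable M" using g by simp
  have "density M (\<lambda>y. ennreal (h1 y) + ennreal (h2 y) + ennreal (h3 y)) = density M (\<lambda>_. 1)"
  proof (rule measure_eqI)
    fix B assume "B \<in> sets (density M (\<lambda>y. ennreal (h1 y) + ennreal (h2 y) + ennreal (h3 y)))"
    then have B: "B \<in> sets M" by simp
    have "emeasure (density M (\<lambda>y. ennreal (h1 y) + ennreal (h2 y) + ennreal (h3 y))) B
        = (\<integral>\<^sup>+y. ennreal (h1 y) * indicator B y + ennreal (h2 y) * indicator B y + ennreal (h3 y) * indicator B y \<partial>M)"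
      using B by (subst emeasure_density) (auto simp: distrib_right)
    also have "\<dots> = emeasure M B"
      using B by (simp add: eq[OF B] nn_integral_add emeasure_density)
    finally show "emeasure (density M (\<lambda>y. ennreal (h1 y) + ennreal (h2 y) + ennreal (h3 y))) B = emeasure (density M (\<lambda>_. 1)) B"
      by (simp add: density_1)
  qed simp
  then have "AE y in M. ennreal (h1 y) + ennreal (h2 y) + ennreal (h3 y) = 1"
    by (intro density_unique) auto
  then have sum1: "AE y in M. h1 y + h2 y + h3 y = 1"
    by (rule eventually_mono) (simp add: nonneg flip: ennreal_plus ennreal_1)
  have bd: "integrable M (\<lambda>y. h y * g y)" if "h \<in> {h1, h2, h3}" for h
  proof (rule Bochner_Integration.integrable_bound[OF g])
    show "(\<lambda>y. h y * g y) \<in> borel_measurable M" using that by auto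
    show "AE y in M. norm (h y * g y) \<le> norm (g y)"
      using sum1
    proof eventually_elim
      case (elim y)
      have "0 \<le> h y" "h y \<le> 1"
        using that elim nonneg[of y] by auto
      then show ?case by (simp add: abs_mult mult_left_le_one_le)
    qed
  qed
  have "(\<integral>y. g y \<partial>M) = (\<integral>y. h1 y * g y + h2 y * g y + h3 y * g y \<partial>M)"
  proof (rule integral_cong_AE)
    show "AE y in M. g y = h1 y * g y + h2 y * g y + h3 y * g y"
      using sum1 by eventually_elim (simp flip: distrib_right)
  qed auto
  also have "\<dots> = (\<integral>y. h1 y * g y \<partial>M) + (\<integral>y. h2 y * g y \<partial>M) + (\<integral>y. h3 y * g y \<partial>M)"
    using bd by (simp add: Bochner_Integration.integral_add Bochner_Integration.integrable_add)
  finally show ?thesis by (simp add: integral_density nonneg)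
qed

lemma integral_jump_integrand:
  fixes f :: "real^'n::finite \<Rightarrow> real" and \<Lambda> \<nu> \<mu> \<rho> :: "real^'n \<Rightarrow> (real^'n) measure"
  assumes conv: "convenient_decomposition \<Lambda> \<nu> \<mu> \<rho>" and levy: "levy_measure (\<Lambda> x)"
    and f: "f \<in> test_fun" and int: "integrable (\<Lambda> x) (jump_integrand f x)"
  shows "(\<integral>y. jump_integrand f x y \<partial>\<Lambda> x) = a_decomp \<nu> \<mu> \<rho> x \<bullet> grad f x + U_integrand \<nu> f x
    + (\<Sum>i\<in>UNIV. V_integrand \<mu> i (pd i f) x) + (\<Sum>i\<in>UNIV. \<Sum>j\<in>UNIV. W_integrand \<rho> i j (pd j (pd i f)) x)"
proof -
  obtain h1 h2 h3 :: "real^'n \<Rightarrow> real" where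
    h: "\<forall>h\<in>{h1, h2, h3}. continuous_on UNIV h \<and> (\<forall>y. 0 \<le> h y)"
    and \<nu>: "\<nu> x = density (\<Lambda> x) (\<lambda>y. ennreal (h1 y))"
    and \<mu>: "\<mu> x = density (\<Lambda> x) (\<lambda>y. ennreal (h2 y))"
    and \<rho>: "\<rho> x = density (\<Lambda> x) (\<lambda>y. ennreal (h3 y))"
    using conv unfolding convenient_decomposition_def by blast
  have eq: "emeasure (\<Lambda> x) B = emeasure (\<nu> x) B + emeasure (\<mu> x) B + emeasure (\<rho> x) B" if "B \<in> sets borel" for B
    using conv that unfolding convenient_decomposition_def by blast
  have fin\<nu>: "emeasure (\<nu> x) UNIV < \<infinity>"
    and fin\<mu>: "(\<integral>\<^sup>+y. ennreal (min 1 (norm y)) \<partial>\<mu> x) < \<infinity>"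
    and fin\<rho>: "(\<integral>\<^sup>+y. ennreal (min (norm y) ((norm y)\<^sup>2)) \<partial>\<rho> x) < \<infinity>"
    using conv unfolding convenient_decomposition_def by blast+
  have s\<Lambda>: "sets (\<Lambda> x) = sets borel" and \<Lambda>0: "emeasure (\<Lambda> x) {0} = 0"
    and fin\<Lambda>: "(\<integral>\<^sup>+y. ennreal (min 1 ((norm y)\<^sup>2)) \<partial>\<Lambda> x) < \<infinity>"
    using levy by (auto simp: levy_measure_def)
  have s: "sets (\<nu> x) = sets borel" "sets (\<mu> x) = sets borel" "sets (\<rho> x) = sets borel"
    by (simp_all add: \<nu> \<mu> \<rho> s\<Lambda>)
  have m: "g \<in> borel_measurable (\<Lambda> x)" "g \<in> borel_measurable (\<nu> x)" "g \<in> borel_measurable (\<mu> x)" "g \<in> borel_measurable (\<rho> x)"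
    if "g \<in> borel_measurable borel" for g :: "real^'n \<Rightarrow> 'b::topological_space"
    using that s\<Lambda> s measurable_cong_sets[of _ borel borel borel] by blast+
  have zero: "emeasure (\<mu> x) {0} = 0" "emeasure (\<rho> x) {0} = 0"
    using eq[of "{0}"] \<Lambda>0 by auto
  have sf: "sigma_finite_measure (\<Lambda> x)"
  proof (rule sigma_finite_if_nn_integral_finite[OF _ fin\<Lambda>])
    show "(\<lambda>y. min 1 ((norm y)\<^sup>2)) \<in> borel_measurable (\<Lambda> x)" by (rule m) measurable
    show "AE y in \<Lambda> x. 0 < min 1 ((norm y)\<^sup>2)" using \<Lambda>0 s\<Lambda> by (intro AE_I[where N="{0}"]) auto
  qed
  note [measurable] = test_fun_measurable[OF f]
  define small where "small y = indicator {y. norm y < 1} y *\<^sub>R y" for y :: "real^'n"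
  define large where "large y = indicator {y. norm y \<ge> 1} y *\<^sub>R y" for y :: "real^'n"
  have sm[measurable]: "small \<in> borel_measurable borel" "large \<in> borel_measurable borel"
    unfolding small_def[abs_def] large_def[abs_def] by measurable
  \<comment> \<open>The first form serves \<open>\<nu>\<close> and \<open>\<mu>\<close>, under which
    small jumps are integrable, so that the compensator can be split off. Under
    \<open>\<rho>\<close> they need not be: there the compensator is completed to the full linear
    term, and only large jumps, which are \<open>\<rho>\<close>-integrable, are split off. The
    separated integrals are the three terms of \<open>a_decomp\<close>, with its signs.\<close>
  have jump: "jump_integrand f x y = f (x + y) - f x - grad f x \<bullet> small y"
    "jump_integrand f x y = (f (x + y) - f x - grad f x \<bullet> y) + grad f x \<bullet> large y" for y
    by (auto simp: jump_integrand_def small_def large_def split: split_indicator)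
  interpret \<nu>: finite_measure "\<nu> x"
    using fin\<nu> sets_eq_imp_space_eq[OF s(1)] by (intro finite_measureI) simp
  obtain C where C: "\<And>y. \<bar>f y\<bar> \<le> C" using test_fun_bounds[OF f] by metis
  have "integrable (\<nu> x) (\<lambda>y. f (x + y))"
    using C by (intro \<nu>.integrable_const_bound[where B=C] m) auto
  moreover have i1: "integrable (\<nu> x) small"
    by (rule \<nu>.integrable_const_bound[where B=1, OF _ m(2)]) (auto simp: small_def split: split_indicator)
  ultimately have I1: "(\<integral>y. jump_integrand f x y \<partial>\<nu> x) = U_integrand \<nu> f x - grad f x \<bullet> (\<integral>y. small y \<partial>\<nu> x)"
    using sets_eq_imp_space_eq[OF s(1)] by (simp add: jump(1) U_integrand_def)
  have i2: "integrable (\<mu> x) small"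
  proof (rule integrableI_bounded)
    have "(\<integral>\<^sup>+y. ennreal (norm (small y)) \<partial>\<mu> x) \<le> (\<integral>\<^sup>+y. ennreal (min 1 (norm y)) \<partial>\<mu> x)"
      by (intro nn_integral_mono ennreal_leI) (auto simp: small_def split: split_indicator)
    then show "(\<integral>\<^sup>+y. ennreal (norm (small y)) \<partial>\<mu> x) < \<infinity>" using fin\<mu> by (rule le_less_trans)
  qed (rule m, measurable)
  have I2: "(\<integral>y. jump_integrand f x y \<partial>\<mu> x) = (\<Sum>i\<in>UNIV. V_integrand \<mu> i (pd i f) x) - grad f x \<bullet> (\<integral>y. small y \<partial>\<mu> x)"
    using integrated_tail_test_fun[OF s(2) zero(1) fin\<mu> f, of x] i2
    by (simp add: jump(1) V_integrand_def)
  have i3: "integrable (\<rho> x) large"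
  proof (rule integrableI_bounded)
    have "(\<integral>\<^sup>+y. ennreal (norm (large y)) \<partial>\<rho> x) \<le> (\<integral>\<^sup>+y. ennreal (min (norm y) ((norm y)\<^sup>2)) \<partial>\<rho> x)"
      by (intro nn_integral_mono ennreal_leI) (auto simp: large_def self_le_power split: split_indicator)
    then show "(\<integral>\<^sup>+y. ennreal (norm (large y)) \<partial>\<rho> x) < \<infinity>" using fin\<rho> by (rule le_less_trans)
  qed (rule m, measurable)
  have I3: "(\<integral>y. jump_integrand f x y \<partial>\<rho> x)
      = (\<Sum>i\<in>UNIV. \<Sum>j\<in>UNIV. W_integrand \<rho> i j (pd j (pd i f)) x) + grad f x \<bullet> (\<integral>y. large y \<partial>\<rho> x)"
    using double_integrated_tail_test_fun[OF s(3) zero(2) fin\<rho> f, of x] i3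
    by (simp add: jump(2) W_integrand_def)
  have "(\<integral>y. jump_integrand f x y \<partial>\<Lambda> x)
      = (\<integral>y. jump_integrand f x y \<partial>\<nu> x) + (\<integral>y. jump_integrand f x y \<partial>\<mu> x) + (\<integral>y. jump_integrand f x y \<partial>\<rho> x)"
    unfolding \<nu> \<mu> \<rho>
  proof (rule integral_three_densities[OF sf _ _ _ _ _ _ _ int])
    show "h1 \<in> borel_measurable (\<Lambda> x)" "h2 \<in> borel_measurable (\<Lambda> x)" "h3 \<in> borel_measurable (\<Lambda> x)"
      using h by (auto intro!: m borel_measurable_continuous_onI)
  qed (use h eq in \<open>auto simp: \<nu> \<mu> \<rho> s\<Lambda>\<close>)
  moreover have "a_decomp \<nu> \<mu> \<rho> x = - (\<integral>y. small y \<partial>\<nu> x) - (\<integral>y. small y \<partial>\<mu> x) + (\<integral>y. large y \<partial>\<rho> x)"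
    by (simp add: a_decomp_def set_lebesgue_integral_def small_def large_def)
  ultimately show ?thesis
    by (simp add: I1 I2 I3 inner_diff_left inner_add_left inner_commute[of "grad f x"])
qed

section \<open>Invariance and the limit of the difference quotients\<close>

text \<open>The laws \<open>\<kappa> x\<close> of \<open>X t\<close> form a probability kernel, and
  invariance means that \<open>\<eta>\<close> is a fixed point of \<open>bind\<close> with it.
  Nonnegative integrals then carry over from sets to functions; the bound \<open>C\<close> makes the
  semigroup a finite integral that agrees with its \<open>ennreal\<close> counterpart.\<close>

lemma invariant_measure_semigroup_nonneg:
  fixes P :: "real^'n::finite \<Rightarrow> 'w measure"
  assumes mp: "markov_process P X" and inv: "invariant_measure P X \<eta>" and s\<eta>: "sets \<eta> = sets borel"
    and t: "0 \<le> t" and h[measurable]: "h \<in> borel_measurable borel"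
    and h0: "\<And>x. 0 \<le> h x" and hC: "\<And>x. h x \<le> C" and int: "integrable \<eta> h"
  shows "has_bochner_integral \<eta> (markov_semigroup P X t h) (\<integral>x. h x \<partial>\<eta>)"
    and "markov_semigroup P X t h \<in> borel_measurable borel"
    and "integrable (P x) (\<lambda>\<omega>. h (X t \<omega>))"
proof -
  have X: "X t \<in> borel_measurable (P x)" and pr: "prob_space (P x)" for x
    using mp t by (auto simp: markov_process_def)
  define \<kappa> where "\<kappa> x = distr (P x) borel (X t)" for x
  have \<kappa>B: "emeasure (\<kappa> x) B = trans_prob P X t x B" if "B \<in> sets borel" for x B
    unfolding \<kappa>_def trans_prob_def using X that by (rule emeasure_distr)
  have \<kappa>p: "prob_space (\<kappa> x)" for x
    unfolding \<kappa>_def by (rule prob_space.prob_space_distr[OF pr X])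
  have \<kappa>[measurable]: "\<kappa> \<in> borel \<rightarrow>\<^sub>M subprob_algebra borel"
  proof (rule measurable_subprob_algebra)
    show "subprob_space (\<kappa> x)" for x using \<kappa>p prob_space_imp_subprob_space by blast
    show "sets (\<kappa> x) = sets borel" for x by (simp add: \<kappa>_def)
    show "(\<lambda>x. emeasure (\<kappa> x) B) \<in> borel_measurable borel" if "B \<in> sets borel" for B
      using mp t that by (simp add: \<kappa>B markov_process_def)
  qed
  have m\<eta>: "g \<in> borel_measurable \<eta>" if "g \<in> borel_measurable borel" for g :: "real^'n \<Rightarrow> 'b::topological_space"
    using that measurable_cong_sets[OF s\<eta> refl] by blast
  have \<kappa>\<eta>: "\<kappa> \<in> \<eta> \<rightarrow>\<^sub>M subprob_algebra borel"
    using \<kappa> measurable_cong_sets[OF s\<eta> refl] by blast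
  have sp: "space \<eta> = UNIV" using sets_eq_imp_space_eq[OF s\<eta>] by simp
  have bind: "\<eta> \<bind> \<kappa> = \<eta>"
  proof (rule measure_eqI)
    show s: "sets (\<eta> \<bind> \<kappa>) = sets \<eta>"
      by (subst sets_bind[where N=borel]) (auto simp: \<kappa>_def s\<eta> sp)
    fix B assume "B \<in> sets (\<eta> \<bind> \<kappa>)"
    then have B: "B \<in> sets borel" by (simp add: s s\<eta>)
    have "emeasure (\<eta> \<bind> \<kappa>) B = (\<integral>\<^sup>+x. emeasure (\<kappa> x) B \<partial>\<eta>)"
      by (rule emeasure_bind[OF _ \<kappa>\<eta> B]) (simp add: sp)
    also have "\<dots> = emeasure \<eta> B" using inv t B by (simp add: \<kappa>B invariant_measure_def)
    finally show "emeasure (\<eta> \<bind> \<kappa>) B = emeasure \<eta> B" .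
  qed
  have sg: "markov_semigroup P X t h x = (\<integral>y. h y \<partial>\<kappa> x)" for x
    unfolding markov_semigroup_def \<kappa>_def using X by (subst integral_distr) auto
  show m: "markov_semigroup P X t h \<in> borel_measurable borel"
    unfolding sg[abs_def] by (rule measurable_compose[OF \<kappa> integral_measurable_subprob_algebra]) measurable
  have "integrable (\<kappa> x) h" for x
    using h0 hC by (intro finite_measure.integrable_const_bound[where B=C] prob_space.finite_measure \<kappa>p) (auto simp: \<kappa>_def)
  then have e: "ennreal (markov_semigroup P X t h x) = (\<integral>\<^sup>+y. ennreal (h y) \<partial>\<kappa> x)" for x
    unfolding sg using h0 by (simp add: nn_integral_eq_integral)
  show "integrable (P x) (\<lambda>\<omega>. h (X t \<omega>))"
    using \<open>\<And>x. integrable (\<kappa> x) h\<close>[of x] X unfolding \<kappa>_def by (subst (asm) integrable_distr_eq) auto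
  have "(\<integral>\<^sup>+x. ennreal (markov_semigroup P X t h x) \<partial>\<eta>) = (\<integral>\<^sup>+y. ennreal (h y) \<partial>(\<eta> \<bind> \<kappa>))"
    unfolding e by (rule nn_integral_bind[OF _ \<kappa>\<eta>, symmetric]) measurable
  also have "\<dots> = ennreal (\<integral>x. h x \<partial>\<eta>)"
    using int h0 by (simp add: bind nn_integral_eq_integral)
  finally show "has_bochner_integral \<eta> (markov_semigroup P X t h) (\<integral>x. h x \<partial>\<eta>)"
    using h0 by (intro has_bochner_integral_nn_integral m\<eta> m) (auto simp: markov_semigroup_def intro!: integral_nonneg_AE)
qed

lemma invariant_measure_semigroup:
  fixes P :: "real^'n::finite \<Rightarrow> 'w measure"
  assumes mp: "markov_process P X" and inv: "invariant_measure P X \<eta>" and s\<eta>: "sets \<eta> = sets borel"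
    and t: "0 \<le> t" and h[measurable]: "h \<in> borel_measurable borel"
    and hC: "\<And>x. \<bar>h x\<bar> \<le> C" and int: "integrable \<eta> h"
  shows "has_bochner_integral \<eta> (markov_semigroup P X t h) (\<integral>x. h x \<partial>\<eta>)"
    and "markov_semigroup P X t h \<in> borel_measurable borel"
proof -
  define hp where "hp x = max 0 (h x)" for x
  define hm where "hm x = max 0 (- h x)" for x
  have [measurable]: "hp \<in> borel_measurable borel" "hm \<in> borel_measurable borel"
    unfolding hp_def[abs_def] hm_def[abs_def] by measurable
  have b: "0 \<le> hp x" "0 \<le> hm x" "hp x \<le> C" "hm x \<le> C" for x
    using hC[of x] by (auto simp: hp_def hm_def)
  have i: "integrable \<eta> hp" "integrable \<eta> hm"
    using int by (auto simp: hp_def[abs_def] hm_def[abs_def])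
  note p = invariant_measure_semigroup_nonneg[OF mp inv s\<eta> t _ b(1) b(3) i(1)]
  note m = invariant_measure_semigroup_nonneg[OF mp inv s\<eta> t _ b(2) b(4) i(2)]
  have h_eq: "h x = hp x - hm x" for x by (auto simp: hp_def hm_def)
  have sg: "markov_semigroup P X t h = (\<lambda>x. markov_semigroup P X t hp x - markov_semigroup P X t hm x)"
    using p(3) m(3) unfolding markov_semigroup_def h_eq by (intro ext Bochner_Integration.integral_diff) auto
  have "(\<integral>x. h x \<partial>\<eta>) = (\<integral>x. hp x \<partial>\<eta>) - (\<integral>x. hm x \<partial>\<eta>)"
    unfolding h_eq using i by simp
  then show "has_bochner_integral \<eta> (markov_semigroup P X t h) (\<integral>x. h x \<partial>\<eta>)"
    unfolding sg using p(1) m(1) by (simp add: has_bochner_integral_diff)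
  show "markov_semigroup P X t h \<in> borel_measurable borel"
    unfolding sg using p(2) m(2) by (intro borel_measurable_diff) auto
qed

lemma integral_pw_generator_eq_0:
  fixes P :: "real^'n::finite \<Rightarrow> 'w measure"
  assumes mp: "markov_process P X" and inv: "invariant_measure P X \<eta>" and radon: "radon_measure \<eta>"
    and f: "f \<in> test_fun" and dom: "f \<in> pw_generator_dom P X"
    and g: "integrable \<eta> g" and T: "0 < T"
    and bd: "\<And>x t. 0 < t \<Longrightarrow> t \<le> T \<Longrightarrow> \<bar>(markov_semigroup P X t f x - f x) / t\<bar> \<le> g x"
  shows "(\<integral>x. pw_generator P X f x \<partial>\<eta>) = 0"
proof -
  have s\<eta>: "sets \<eta> = sets borel" using radon by (simp add: radon_measure_def)
  have m\<eta>: "g \<in> borel_measurable \<eta>" if "g \<in> borel_measurable borel" for g :: "real^'n \<Rightarrow> real"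
    using that measurable_cong_sets[OF s\<eta> refl] by blast
  have fm: "f \<in> borel_measurable borel" by (rule test_fun_measurable[OF f])
  obtain C R where C: "\<And>x. \<bar>f x\<bar> \<le> C" and R: "\<And>x. R < norm x \<Longrightarrow> f x = 0"
    using test_fun_bounds[OF f] by metis
  \<comment> \<open>Here local finiteness enters: \<open>f\<close> is bounded and lives on a ball of
    finite \<open>\<eta>\<close>-measure. Integrability of \<open>f\<close> and of its image under
    the semigroup is what lets their equal integrals cancel in the difference quotient.\<close>
  have fint: "integrable \<eta> f"
  proof (rule integrableI_bounded_set[where A="cball 0 R" and B=C])
    show "emeasure \<eta> (cball 0 R) < \<infinity>" using radon by (simp add: radon_measure_def)
  qed (use C R in \<open>auto simp: s\<eta> m\<eta>[OF fm]\<close>)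
  \<comment> \<open>Dominated convergence works along sequences. This one tends to 0 inside
    \<open>(0, T]\<close>, so the bound \<open>g\<close> is available for every index.\<close>
  define t where "t n = T / real (Suc n)" for n
  have t: "0 < t n" "t n \<le> T" for n
    using T by (auto simp: t_def divide_le_eq mult_le_cancel_left1)
  have "t \<longlonglongrightarrow> 0"
    unfolding t_def[abs_def] using LIMSEQ_Suc[OF lim_const_over_n[of T]] by simp
  then have t_lim: "filterlim t (at_right 0) sequentially"
    using t(1) by (simp add: filterlim_at less_imp_neq[OF t(1), symmetric])
  define q where "q n x = (markov_semigroup P X (t n) f x - f x) / t n" for n x
  note sg = invariant_measure_semigroup[OF mp inv s\<eta> less_imp_le[OF t(1)] fm C fint]
  have qm: "q n \<in> borel_measurable \<eta>" for n
    unfolding q_def[abs_def] using sg(2)[of n] fm by (intro m\<eta> borel_measurable_divide borel_measurable_diff) auto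
  have lim: "(\<lambda>n. q n x) \<longlonglongrightarrow> pw_generator P X f x" for x
  proof -
    obtain l where l: "((\<lambda>t. (markov_semigroup P X t f x - f x) / t) \<longlongrightarrow> l) (at_right 0)"
      using dom by (auto simp: pw_generator_dom_def)
    then have "pw_generator P X f x = l"
      unfolding pw_generator_def by (intro tendsto_Lim) auto
    with filterlim_compose[OF l t_lim] show ?thesis by (simp add: q_def)
  qed
  have "(\<lambda>n. \<integral>x. q n x \<partial>\<eta>) \<longlonglongrightarrow> (\<integral>x. pw_generator P X f x \<partial>\<eta>)"
  proof (rule integral_dominated_convergence[OF _ qm g])
    show "pw_generator P X f \<in> borel_measurable \<eta>"
      by (rule borel_measurable_LIMSEQ_real[OF lim qm])
    show "AE x in \<eta>. (\<lambda>n. q n x) \<longlonglongrightarrow> pw_generator P X f x" using lim by simp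
    show "AE x in \<eta>. norm (q n x) \<le> g x" for n using bd[OF t] by (simp add: q_def)
  qed
  moreover have "(\<integral>x. q n x \<partial>\<eta>) = 0" for n
    using sg(1)[of n] fint by (simp add: q_def has_bochner_integral_iff)
  ultimately show ?thesis by (simp add: LIMSEQ_const_iff)
qed

theorem corollary5p4:
  fixes P :: "real^'n::finite \<Rightarrow> 'w measure"
    and X :: "real \<Rightarrow> 'w \<Rightarrow> real^'n"
    and E :: "(real^'n \<Rightarrow> real) set" and N :: "(real^'n \<Rightarrow> real) \<Rightarrow> real"
    and a :: "real^'n \<Rightarrow> real^'n"
    and b :: "real^'n \<Rightarrow> real^'n^'n"
    and \<Lambda> \<nu> \<mu> \<rho> :: "real^'n \<Rightarrow> (real^'n) measure"
    and \<eta> :: "(real^'n) measure"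
  assumes "markov_process P X"
    and "levy_type_operator E N (pw_generator_dom P X) (pw_generator P X) a b \<Lambda>"
    and "convenient_decomposition \<Lambda> \<nu> \<mu> \<rho>"
    and "test_fun \<subseteq> pw_generator_dom P X"
    and "\<eta> \<in> M_space a b \<nu> \<mu> \<rho>"
    and "invariant_measure P X \<eta>"
    and "\<And>f. f \<in> test_fun \<Longrightarrow> \<exists>g T. integrable \<eta> g \<and> 0 < T \<and>
           (\<forall>x t. 0 < t \<and> t \<le> T \<longrightarrow> \<bar>(markov_semigroup P X t f x - f x) / t\<bar> \<le> g x)"
  shows "solves_dist_equation a b \<nu> \<mu> \<rho> \<eta>"
  unfolding solves_dist_equation_def
proof
  fix f :: "real^'n \<Rightarrow> real" assume f: "f \<in> test_fun"
  let ?c = "\<lambda>x. a x + a_decomp \<nu> \<mu> \<rho> x"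
  have dom: "f \<in> pw_generator_dom P X" using assms(4) f by auto
  have radon: "radon_measure \<eta>" using assms(5) by (simp add: M_space_def)
  \<comment> \<open>Integrability of every term separately is part of \<open>M_space\<close>;
    integrability of the generator alone would not allow its integral to be split.\<close>
  have int_c: "integrable \<eta> (\<lambda>x. ?c x $ i * pd i f x)"
    and int_b: "integrable \<eta> (\<lambda>x. (1/2) * div_b_grad b f x)"
    and int_U: "integrable \<eta> (U_integrand \<nu> f)"
    and int_V: "integrable \<eta> (V_integrand \<mu> i (pd i f))"
    and int_W: "integrable \<eta> (W_integrand \<rho> i j (pd j (pd i f)))" for i j
    using assms(5) f unfolding M_space_def by blast+
  obtain g T where g: "integrable \<eta> g" "0 < T"
    "\<And>x t. 0 < t \<Longrightarrow> t \<le> T \<Longrightarrow> \<bar>(markov_semigroup P X t f x - f x) / t\<bar> \<le> g x"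
    using assms(7)[OF f] by blast
  have gen: "pw_generator P X f x = (\<Sum>i\<in>UNIV. ?c x $ i * pd i f x) + (1/2) * div_b_grad b f x
      + U_integrand \<nu> f x + (\<Sum>i\<in>UNIV. V_integrand \<mu> i (pd i f) x)
      + (\<Sum>i\<in>UNIV. \<Sum>j\<in>UNIV. W_integrand \<rho> i j (pd j (pd i f)) x)" for x
  proof -
    have C2: "C_k 2 f" using f by (simp add: test_fun_def)
    have levy: "levy_measure (\<Lambda> x)"
      using assms(2) by (simp add: levy_type_operator_def characteristic_triplet_def levy_kernel_def)
    have int: "integrable (\<Lambda> x) (jump_integrand f x)"
      and gen: "pw_generator P X f x = a x \<bullet> grad f x + (1/2) * div_b_grad b f x
                + (\<integral>y. jump_integrand f x y \<partial>\<Lambda> x)"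
      using assms(2) dom C2 unfolding levy_type_operator_def by blast+
    have "(\<Sum>i\<in>UNIV. ?c x $ i * pd i f x) = ?c x \<bullet> grad f x"
      by (simp add: inner_vec_def grad_def)
    then show ?thesis
      using gen integral_jump_integrand[OF assms(3) levy f int] by (simp add: inner_add_left)
  qed
  have "0 = (\<integral>x. pw_generator P X f x \<partial>\<eta>)"
    by (rule integral_pw_generator_eq_0[OF assms(1,6) radon f dom g, symmetric])
  also have "\<dots> = (\<Sum>i\<in>UNIV. \<integral>x. ?c x $ i * pd i f x \<partial>\<eta>) + (\<integral>x. (1/2) * div_b_grad b f x \<partial>\<eta>)
      + (\<integral>x. U_integrand \<nu> f x \<partial>\<eta>) + (\<Sum>i\<in>UNIV. \<integral>x. V_integrand \<mu> i (pd i f) x \<partial>\<eta>)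
      + (\<Sum>i\<in>UNIV. \<Sum>j\<in>UNIV. \<integral>x. W_integrand \<rho> i j (pd j (pd i f)) x \<partial>\<eta>)"
    unfolding gen using int_c int_b int_U int_V int_W
    by (simp only: Bochner_Integration.integral_add Bochner_Integration.integral_sum
          Bochner_Integration.integrable_add Bochner_Integration.integrable_sum)
  \<comment> \<open>\<open>dist_div\<close> carries the minus sign of integration by parts, so the
    minus signs in front of the drift and of the \<open>V\<close> term turn into plus signs; the two
    signs of \<open>dist_hess\<close> cancel.\<close>
  also have "\<dots> = - dist_div (weighted_fun ?c \<eta>) f + diffusion_fun b \<eta> f + U_fun \<nu> \<eta> f
     - dist_div (V_fun \<mu> \<eta>) f + dist_hess (W_fun \<rho> \<eta>) f"
    by (simp add: dist_div_def dist_hess_def weighted_fun_def diffusion_fun_def U_fun_def V_fun_def W_fun_def sum_negf)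
  finally show "- dist_div (weighted_fun ?c \<eta>) f + diffusion_fun b \<eta> f + U_fun \<nu> \<eta> f
     - dist_div (V_fun \<mu> \<eta>) f + dist_hess (W_fun \<rho> \<eta>) f = 0" by simp
qed

end
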